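(* Let $K\subset\mathbb{R}^D$ be a generalized Sierpiński carpet equipped with the metric $\overline d$ given by $\overline d(x,y):=\max_{1\le j\le D}|x_j-y_j|$. Suppose $\dim_{\mathrm H}(K,\overline d)=d_{\mathrm f}$. Let $(Z,d_Z)$ be any weak tangent of $(K,\overline d)$. Then $(Z,d_Z)$ is Ahlfors $d_{\mathrm f}$-regular, and $\mathrm{VM}_p$ holds for $(Z,d_Z,\mathcal{H}_{d_{\mathrm f}})$ for every $p\in[1,\infty)$, where $\mathcal{H}_{d_{\mathrm f}}$ is the $d_{\mathrm f}$-dimensional Hausdorff measure on $(Z,d_Z)$.
   Context: Generalized Sierpiński carpet: let $D\in\mathbb{N}$, $D\ge2$, $l\in\mathbb{N}$, $l\ge3$, and let $S\subsetneq\{0,1,\dots,l-1\}^D$ be non-empty. For $j\in S$ let $f_j:\mathbb{R}^D\to\mathbb{R}^D$, $f_j(x):=l^{-1}x+l^{-1}j$. Let $Q_0:=[0,1]^D$, $Q_1:=\bigcup_{j\in S}f_j(Q_0)$ (so $Q_1\subsetneq Q_0$), and let $K$ be the unique self-similar set associated with $\{f_j\}_{j\in S}$ (the unique non-empty compact set with $K=\bigcup_{j\in S}f_j(K)$). $K$ is a generalized Sierpiński carpet if: (GSC1) $f(Q_1)=Q_1$ for every isometry $f$ of $\mathbb{R}^D$ with $f(Q_0)=Q_0$; (GSC2) $Q_1$ is connected; (GSC3) $\mathrm{int}_{\mathbb{R}^D}\left(Q_1\cap\prod_{k=1}^D[(i_k-\varepsilon_k)l^{-1},(i_k+1)l^{-1}]\right)$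 is either empty or connected for every $(i_k)_{k=1}^D\in\mathbb{Z}^D$ and every $(\varepsilon_k)_{k=1}^D\in\{0,1\}^D$; (GSC4) $[0,1]\times\{0\}^{D-1}\subset Q_1$. Ahlfors $\alpha$-regular metric space $(X,d)$: there are a Radon measure $m$ and $C\in(1,\infty)$ with $C^{-1}r^\alpha\le m(B(x,r))\le Cr^\alpha$ for all $(x,r)\in X\times(0,\mathrm{diam}(X,d))$. Local Hausdorff convergence: nonempty closed subsets $F_i$ of a metric space $(M,d_M)$ converge locally in the Hausdorff sense to a nonempty closed $F\subset M$ if for every $q\in M$, $R>0$: $\lim_{i}\sup_{z\in F_i\cap B_M(q,R)}\mathrm{dist}_M(z,F)=0$ and $\lim_i\sup_{z\in F\cap B_M(q,R)}\mathrm{dist}_M(z,F_i)=0$ (a supremum over the empty set is $0$). Attouch–Wets convergence: pointed metric spaces $(X_j,d_j,p_j)$ converge, $(X_j,d_j,p_j)\xrightarrow{\mathrm{AW}}(X_\infty,d_\infty,p_\infty)$, if there are a pointed metric space $(M,d_M,p)$ and isometric embeddings $\iota_j:X_j\to M$, $\iota_\infty:X_\infty\to M$ with $\iota_j(p_j)=p=\iota_\infty(p_\infty)$ such that the closed sets $\iota_j(X_j)$ converge locally in the Hausdorff sense to $\iota_\infty(X_\infty)$ in $(M,d_M)$. Weak tangent: for a complete metric space $(X,d)$, a complete pointed metric space $(Z,d_Z,z)$ is a weak tangent of $(X,d)$ if there are $x_n\in X$ and $r_n\in(0,\mathrm{diam}(X,d))$ with $(X,r_n^{-1}d,x_n)\xrightarrow{\mathrm{AW}}(Z,d_Z,z)$;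 $(Z,d_Z)$ is called a weak tangent if this holds for some $z\in Z$. Modulus on $(Z,d_Z,\mathcal{H}_{d_{\mathrm f}})$: curves are non-constant continuous maps from an interval into $Z$. For a family $\Gamma$ of curves, a Borel $\rho:Z\to[0,\infty]$ is admissible if $\int_\gamma\rho\,ds\ge 1$ for every locally rectifiable $\gamma\in\Gamma$, and $\mathrm{Mod}_p(\Gamma):=\inf\{\int_Z\rho^p\,d\mathcal{H}_{d_{\mathrm f}}:\rho\text{ admissible for }\Gamma\}$. $\mathrm{VM}_p$ holds if $\mathrm{Mod}_p(\Gamma)=0$ for every family $\Gamma$ of curves in $(Z,d_Z)$. *)

theory Defs
  imports "HOL-Analysis.Analysis"
begin

section \<open>Metric preliminaries\<close>

definition ediam :: "'a metric \<Rightarrow> 'a set \<Rightarrow> ennreal" where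
  "ediam X A = (SUP x\<in>A. SUP y\<in>A. ennreal (mdist X x y))"

definition esetdist :: "'a metric \<Rightarrow> 'a \<Rightarrow> 'a set \<Rightarrow> ennreal" where
  "esetdist X x A = (INF y\<in>A. ennreal (mdist X x y))"

text \<open>Only used for positive factors \<open>c\<close>; otherwise the pair need not be a metric space.\<close>

definition scale_metric :: "real \<Rightarrow> 'a metric \<Rightarrow> 'a metric" where
  "scale_metric c X = metric (mspace X, \<lambda>x y. c * mdist X x y)"

lemma scale_metric:
  assumes "0 < c"
  shows mspace_scale_metric: "mspace (scale_metric c X) = mspace X"
    and mdist_scale_metric: "mdist (scale_metric c X) x y = c * mdist X x y"
proof -
  interpret Metric_space "mspace X" "\<lambda>x y. c * mdist X x y"
  proof
    show "c * mdist X x z \<le> c * mdist X x y + c * mdist X y z"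
      if "x \<in> mspace X" "y \<in> mspace X" "z \<in> mspace X" for x y z
      using mult_left_mono[OF mdist_triangle[OF that], of c] assms
      by (simp add: distrib_left)
  qed (use assms in \<open>auto simp: mdist_commute\<close>)
  show "mspace (scale_metric c X) = mspace X"
    "mdist (scale_metric c X) x y = c * mdist X x y"
    by (simp_all add: scale_metric_def)
qed

definition borel_of :: "'a topology \<Rightarrow> 'a measure" where
  "borel_of T = sigma (topspace T) {U. openin T U}"

text \<open>Powers \<open>x\<^sup>s\<close> on \<open>[0,\<infinity>]\<close> for \<open>s \<ge> 0\<close>, with \<open>x\<^sup>0 = 1\<close>; note that
  \<^term>\<open>(0::real) powr 0\<close> is \<open>0\<close>.\<close>

definition enn_powr :: "ennreal \<Rightarrow> real \<Rightarrow> ennreal" where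
  "enn_powr x s =
    (if s = 0 then 1 else if x = \<infinity> then \<infinity> else ennreal (enn2real x powr s))"


section \<open>Hausdorff measure and dimension\<close>

definition hausdorff_covers :: "'a metric \<Rightarrow> real \<Rightarrow> 'a set \<Rightarrow> (nat \<Rightarrow> 'a set) set" where
  "hausdorff_covers X \<delta> E =
    {A. (\<forall>i. A i \<subseteq> mspace X \<and> ediam X (A i) \<le> ennreal \<delta>) \<and> E \<subseteq> (\<Union>i. A i)}"

text \<open>The empty set contributes \<open>0\<close> also for \<open>s = 0\<close>.\<close>

definition hausdorff_gauge :: "real \<Rightarrow> 'a metric \<Rightarrow> 'a set \<Rightarrow> ennreal" where
  "hausdorff_gauge s X A = (if A = {} then 0 else enn_powr (ediam X A) s)"

definition hausdorff_pre :: "real \<Rightarrow> 'a metric \<Rightarrow> real \<Rightarrow> 'a set \<Rightarrow> ennreal" where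
  "hausdorff_pre s X \<delta> E =
    (INF A\<in>hausdorff_covers X \<delta> E. \<Sum>i. hausdorff_gauge s X (A i))"

definition hausdorff_outer :: "real \<Rightarrow> 'a metric \<Rightarrow> 'a set \<Rightarrow> ennreal" where
  "hausdorff_outer s X E = (SUP \<delta>\<in>{0<..}. hausdorff_pre s X \<delta> E)"

definition hausdorff_measure :: "real \<Rightarrow> 'a metric \<Rightarrow> 'a measure" where
  "hausdorff_measure s X =
    measure_of (mspace X) {U. openin (mtopology_of X) U} (hausdorff_outer s X)"

definition hausdorff_dim :: "'a metric \<Rightarrow> ereal" where
  "hausdorff_dim X = (INF s\<in>{s. 0 \<le> s \<and> hausdorff_outer s X (mspace X) = 0}. ereal s)"

lemma ediam_upper: "x \<in> A \<Longrightarrow> y \<in> A \<Longrightarrow> ennreal (mdist X x y) \<le> ediam X A"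
  unfolding ediam_def by (meson SUP_upper2 order_refl)

lemma hausdorff_pre_mono:
  "A \<subseteq> B \<Longrightarrow> hausdorff_pre s X \<delta> A \<le> hausdorff_pre s X \<delta> B"
  unfolding hausdorff_pre_def by (rule INF_superset_mono) (auto simp: hausdorff_covers_def)

lemma hausdorff_pre_antimono:
  "\<delta> \<le> \<delta>' \<Longrightarrow> hausdorff_pre s X \<delta>' E \<le> hausdorff_pre s X \<delta> E"
  unfolding hausdorff_pre_def
  by (rule INF_superset_mono)
    (auto simp: hausdorff_covers_def intro: order_trans ennreal_leI)

lemma hausdorff_pre_empty: "hausdorff_pre s X \<delta> {} = 0"
proof -
  have "(\<lambda>_. {}) \<in> hausdorff_covers X \<delta> {}"
    by (auto simp: hausdorff_covers_def ediam_def bot_ennreal)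
  then have "hausdorff_pre s X \<delta> {} \<le> (\<Sum>i. hausdorff_gauge s X ((\<lambda>_::nat. {}) i))"
    unfolding hausdorff_pre_def by (rule INF_lower)
  then show ?thesis
    by (simp add: hausdorff_gauge_def)
qed

lemma hausdorff_pre_subadditive:
  "hausdorff_pre s X \<delta> (\<Union>i::nat. E i) \<le> (\<Sum>i. hausdorff_pre s X \<delta> (E i))"
proof (rule ennreal_le_epsilon)
  fix e :: real
  assume fin: "(\<Sum>i. hausdorff_pre s X \<delta> (E i)) < top" and "0 < e"
  define g where "g = hausdorff_gauge s X"
  have "\<exists>A. A \<in> hausdorff_covers X \<delta> (E i) \<and>
      (\<Sum>j. g (A j)) \<le> hausdorff_pre s X \<delta> (E i) + e * (1/2) ^ Suc i" for i
  proof -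
    have "hausdorff_pre s X \<delta> (E i) < top"
      using ennreal_suminf_lessD[OF fin] by blast
    then have "hausdorff_pre s X \<delta> (E i) < hausdorff_pre s X \<delta> (E i) + e * (1/2) ^ Suc i"
      using \<open>0 < e\<close> by (simp add: ennreal_zero_less_mult_iff)
    then show ?thesis
      unfolding hausdorff_pre_def INF_less_iff g_def by (auto intro: less_imp_le)
  qed
  then obtain A where A: "\<And>i. A i \<in> hausdorff_covers X \<delta> (E i)"
    and le: "\<And>i. (\<Sum>j. g (A i j)) \<le> hausdorff_pre s X \<delta> (E i) + e * (1/2) ^ Suc i"
    by metis
  define C where "C = case_prod A \<circ> prod_decode"
  have C: "C (prod_encode (i, j)) = A i j" for i j
    by (simp add: C_def)
  have "C \<in> hausdorff_covers X \<delta> (\<Union>i. E i)"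
    unfolding hausdorff_covers_def mem_Collect_eq
  proof (intro conjI allI)
    fix k
    show "C k \<subseteq> mspace X" "ediam X (C k) \<le> ennreal \<delta>"
      using A by (auto simp: C_def hausdorff_covers_def split: prod.split)
  next
    have "E i \<subseteq> (\<Union>k. C k)" for i
    proof
      fix x assume "x \<in> E i"
      then obtain j where "x \<in> A i j"
        using A unfolding hausdorff_covers_def by blast
      then have "x \<in> C (prod_encode (i, j))"
        by (simp add: C)
      then show "x \<in> (\<Union>k. C k)"
        by blast
    qed
    then show "(\<Union>i. E i) \<subseteq> (\<Union>k. C k)"
      by blast
  qed
  then have "hausdorff_pre s X \<delta> (\<Union>i. E i) \<le> (\<Sum>k. g (C k))"
    unfolding hausdorff_pre_def g_def by (rule INF_lower)
  also have "\<dots> = (\<Sum>i. \<Sum>j. g (A i j))"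
    unfolding C_def comp_def by (intro suminf_ennreal_2dimen) auto
  also have "\<dots> \<le> (\<Sum>i. hausdorff_pre s X \<delta> (E i) + e * (1/2) ^ Suc i)"
    using le by (intro suminf_le) auto
  also have "\<dots> = (\<Sum>i. hausdorff_pre s X \<delta> (E i)) + (\<Sum>i. ennreal e * ennreal ((1/2) ^ Suc i))"
    using \<open>0 < e\<close> by (subst suminf_add[symmetric]) (auto simp del: ennreal_suminf_cmult simp add: ennreal_mult[symmetric])
  also have "\<dots> = (\<Sum>i. hausdorff_pre s X \<delta> (E i)) + e"
    unfolding ennreal_suminf_cmult
    by (subst suminf_ennreal_eq[OF zero_le_power power_half_series]) auto
  finally show "hausdorff_pre s X \<delta> (\<Union>i. E i) \<le> (\<Sum>i. hausdorff_pre s X \<delta> (E i)) + e" .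
qed

lemma outer_measure_space_hausdorff_outer:
  "outer_measure_space (Pow (mspace X)) (hausdorff_outer s X)"
  unfolding outer_measure_space_def
proof (intro conjI)
  show "positive (Pow (mspace X)) (hausdorff_outer s X)"
    by (simp add: positive_def hausdorff_outer_def hausdorff_pre_empty)
  show "increasing (Pow (mspace X)) (hausdorff_outer s X)"
    unfolding increasing_def hausdorff_outer_def by (blast intro: SUP_mono hausdorff_pre_mono)
  show "countably_subadditive (Pow (mspace X)) (hausdorff_outer s X)"
    unfolding countably_subadditive_def
  proof safe
    fix E :: "nat \<Rightarrow> 'a set"
    show "hausdorff_outer s X (\<Union>i. E i) \<le> (\<Sum>i. hausdorff_outer s X (E i))"
      unfolding hausdorff_outer_def[of s X "\<Union>i. E i"]
    proof (rule SUP_least)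
      fix \<delta> :: real assume "\<delta> \<in> {0<..}"
      then have "hausdorff_pre s X \<delta> (E i) \<le> hausdorff_outer s X (E i)" for i
        unfolding hausdorff_outer_def by (rule SUP_upper)
      then show "hausdorff_pre s X \<delta> (\<Union>i. E i) \<le> (\<Sum>i. hausdorff_outer s X (E i))"
        by (intro order_trans[OF hausdorff_pre_subadditive] suminf_le) auto
    qed
  qed
qed

lemma hausdorff_outer_separated:
  assumes "A \<subseteq> mspace X" "B \<subseteq> mspace X" "0 < e"
    and sep: "\<And>a b. a \<in> A \<Longrightarrow> b \<in> B \<Longrightarrow> e \<le> mdist X a b"
  shows "hausdorff_outer s X A + hausdorff_outer s X B \<le> hausdorff_outer s X (A \<union> B)"
proof -
  have *: "hausdorff_pre s X \<delta> A + hausdorff_pre s X \<delta> B \<le> hausdorff_outer s X (A \<union> B)"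
    if \<delta>: "0 < \<delta>" "\<delta> < e" for \<delta>
  proof -
    have "hausdorff_pre s X \<delta> A + hausdorff_pre s X \<delta> B \<le> hausdorff_pre s X \<delta> (A \<union> B)"
      unfolding hausdorff_pre_def[of s X \<delta> "A \<union> B"]
    proof (rule INF_greatest)
      fix C assume C: "C \<in> hausdorff_covers X \<delta> (A \<union> B)"
      define CA where "CA i = (if C i \<inter> A = {} then {} else C i)" for i
      define CB where "CB i = (if C i \<inter> B = {} then {} else C i)" for i
      have not_both: "C i \<inter> A = {} \<or> C i \<inter> B = {}" for i
      proof (rule ccontr)
        assume "\<not> ?thesis"
        then obtain a b where ab: "a \<in> C i" "a \<in> A" "b \<in> C i" "b \<in> B" by blast
        have "ennreal (mdist X a b) \<le> ennreal \<delta>"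
          using C ediam_upper[OF ab(1,3), of X]
          by (auto simp: hausdorff_covers_def intro: order_trans)
        then show False
          using sep[OF ab(2,4)] \<delta> by (simp add: ennreal_le_iff)
      qed
      have "CA \<in> hausdorff_covers X \<delta> A" "CB \<in> hausdorff_covers X \<delta> B"
        using C by (fastforce simp: hausdorff_covers_def CA_def CB_def ediam_def bot_ennreal)+
      then have "hausdorff_pre s X \<delta> A + hausdorff_pre s X \<delta> B
          \<le> (\<Sum>i. hausdorff_gauge s X (CA i)) + (\<Sum>i. hausdorff_gauge s X (CB i))"
        unfolding hausdorff_pre_def by (intro add_mono INF_lower)
      also have "\<dots> = (\<Sum>i. hausdorff_gauge s X (CA i) + hausdorff_gauge s X (CB i))"
        by (rule suminf_add) auto
      also have "\<dots> \<le> (\<Sum>i. hausdorff_gauge s X (C i))"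
        using not_both by (intro suminf_le) (auto simp: CA_def CB_def hausdorff_gauge_def)
      finally show "hausdorff_pre s X \<delta> A + hausdorff_pre s X \<delta> B
          \<le> (\<Sum>i. hausdorff_gauge s X (C i))" .
    qed
    also have "\<dots> \<le> hausdorff_outer s X (A \<union> B)"
      unfolding hausdorff_outer_def using \<delta> by (intro SUP_upper) auto
    finally show ?thesis .
  qed
  have small: "hausdorff_outer s X E = (SUP \<delta>\<in>{0<..<e}. hausdorff_pre s X \<delta> E)" for E
  proof (rule antisym)
    show "hausdorff_outer s X E \<le> (SUP \<delta>\<in>{0<..<e}. hausdorff_pre s X \<delta> E)"
      unfolding hausdorff_outer_def
    proof (rule SUP_least)
      fix \<delta> :: real assume "\<delta> \<in> {0<..}"
      then show "hausdorff_pre s X \<delta> E \<le> (SUP \<delta>\<in>{0<..<e}. hausdorff_pre s X \<delta> E)"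
        using \<open>0 < e\<close> by (intro SUP_upper2[of "min \<delta> (e/2)"] hausdorff_pre_antimono) auto
    qed
    show "(SUP \<delta>\<in>{0<..<e}. hausdorff_pre s X \<delta> E) \<le> hausdorff_outer s X E"
      unfolding hausdorff_outer_def by (rule SUP_subset_mono) auto
  qed
  have "{0<..<e} \<noteq> {}" using \<open>0 < e\<close> by simp
  have "(SUP \<delta>\<in>{0<..<e}. hausdorff_pre s X \<delta> A) + (SUP \<delta>\<in>{0<..<e}. hausdorff_pre s X \<delta> B)
      = (SUP \<delta>\<in>{0<..<e}. hausdorff_pre s X \<delta> A + hausdorff_pre s X \<delta> B)"
  proof (rule SUP_add_directed_ennreal[symmetric])
    fix i j assume "i \<in> {0<..<e}" "j \<in> {0<..<e}"
    then show "\<exists>k\<in>{0<..<e}. hausdorff_pre s X i A + hausdorff_pre s X j B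
        \<le> hausdorff_pre s X k A + hausdorff_pre s X k B"
      by (intro bexI[of _ "min i j"] add_mono hausdorff_pre_antimono) auto
  qed
  then show ?thesis
    unfolding small[of A] small[of B] using * by (auto intro!: SUP_least)
qed

lemma openin_lambda_system:
  assumes oms: "outer_measure_space (Pow (mspace X)) f"
    and sep: "\<And>A B e. \<lbrakk>A \<subseteq> mspace X; B \<subseteq> mspace X; 0 < e;
      \<And>a b. a \<in> A \<Longrightarrow> b \<in> B \<Longrightarrow> e \<le> mdist X a b\<rbrakk> \<Longrightarrow> f A + f B \<le> f (A \<union> B)"
    and U: "openin (mtopology_of X) U"
  shows "U \<in> lambda_system (mspace X) (Pow (mspace X)) f"
proof -
  interpret Metric_space "mspace X" "mdist X" by simp
  have U_sub: "U \<subseteq> mspace X"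
    using openin_subset[OF U] by simp
  have mono: "f A \<le> f B" if "A \<subseteq> B" "B \<subseteq> mspace X" for A B
    using oms that unfolding outer_measure_space_def increasing_def by (meson PowI order_trans)
  have f0: "f {} = 0"
    using oms by (auto simp: outer_measure_space_def positive_def)
  have csub: "f (\<Union>i. A i) \<le> (\<Sum>i. f (A i))" if A: "\<And>i::nat. A i \<subseteq> mspace X" for A
  proof -
    have sub: "disjointed A i \<subseteq> A i" for i
      by (rule disjointed_subset)
    have "f (\<Union>i. disjointed A i) \<le> (\<Sum>i. f (disjointed A i))"
    proof -
      have "range (disjointed A) \<subseteq> Pow (mspace X)" "(\<Union>i. disjointed A i) \<in> Pow (mspace X)"
        using A sub by blast+
      then show ?thesis
        using oms disjoint_family_disjointed[of A]
        unfolding outer_measure_space_def countably_subadditive_def by blast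
    qed
    also have "\<dots> \<le> (\<Sum>i. f (A i))"
      using A sub mono by (intro suminf_le) auto
    finally show ?thesis
      by (simp add: UN_disjointed_eq)
  qed
  have "f (E \<inter> U) + f (E - U) = f E" if E: "E \<subseteq> mspace X" for E
  proof (rule antisym)
    show "f E \<le> f (E \<inter> U) + f (E - U)"
    proof -
      have "f (\<Union>i. binaryset (E \<inter> U) (E - U) i) \<le> (\<Sum>i. f (binaryset (E \<inter> U) (E - U) i))"
        using E by (intro csub) (auto simp: binaryset_def)
      also have "\<dots> = f (E \<inter> U) + f (E - U)"
        by (rule suminf_binaryset_eq) (rule f0)
      finally show ?thesis
        by (simp add: UN_binaryset_eq Int_Diff_Un)
    qed
    show "f (E \<inter> U) + f (E - U) \<le> f E"
    proof (cases "f E = \<infinity> \<or> U = mspace X")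
      case True
      moreover have "E \<inter> mspace X = E" "E - mspace X = {}" using E by blast+
      ultimately show ?thesis using f0 by (metis add.right_neutral infinity_ennreal_def order_refl top_greatest)
    next
      case False
      then have fin: "f E < \<infinity>" and "U \<noteq> mspace X"
        by (auto simp: less_top)
      define C where "C = mspace X - U"
      have C: "C \<noteq> {}" "C \<subseteq> mspace X"
        using U_sub \<open>U \<noteq> mspace X\<close> by (auto simp: C_def)
      define F where "F n = {x \<in> E \<inter> U. \<forall>c\<in>C. 1 \<le> mdist X x c * real n}" for n
      define R where "R n = F (Suc n) - F n" for n
      have F_sub: "F n \<subseteq> E \<inter> U" for n
        by (auto simp: F_def)
      have F0: "F 0 = {}"
        using C by (auto simp: F_def)
      have F_mono: "F m \<subseteq> F n" if "m \<le> n" for m n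
      proof -
        have "mdist X x c * real m \<le> mdist X x c * real n" for x c
          using that by (intro mult_left_mono) auto
        then show ?thesis
          by (auto simp: F_def intro: order_trans)
      qed
      have UN_F: "E \<inter> U = (\<Union>n. F n)"
      proof
        show "E \<inter> U \<subseteq> (\<Union>n. F n)"
        proof
          fix x assume x: "x \<in> E \<inter> U"
          then obtain r where r: "0 < r" "mball x r \<subseteq> U"
            using U by (auto simp: mtopology_of_def openin_mtopology)
          obtain n :: nat where "1 / r < real n"
            using reals_Archimedean2 by blast
          then have n: "1 \<le> r * real n"
            using r by (simp add: field_simps)
          have "1 \<le> mdist X x c * real n" if "c \<in> C" for c
          proof -
            have "r \<le> mdist X x c"
              using r that x E C by (force simp: C_def)
            then show ?thesis
              using n mult_right_mono[of r "mdist X x c" "real n"] by linarith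
          qed
          then show "x \<in> (\<Union>n. F n)"
            using x by (auto simp: F_def)
        qed
      qed (use F_sub in blast)
      have F_R: "f (F m) + f (R n) \<le> f (F (Suc n))" if "m < n \<or> m = 0" for m n
      proof (cases "m = 0")
        case True
        have "R n \<subseteq> F (Suc n)" "F (Suc n) \<subseteq> mspace X"
          using F_sub E by (auto simp: R_def)
        then show ?thesis using True by (simp add: F0 f0 mono)
      next
        case False
        with that have mn: "0 < m" "m < n" by auto
        have "f (F m) + f (R n) \<le> f (F m \<union> R n)"
        proof (rule sep)
          show "F m \<subseteq> mspace X" "R n \<subseteq> mspace X"
            using F_sub E by (auto simp: R_def)
          show "0 < 1 / real m - 1 / real n"
            using mn by (simp add: field_simps)
          fix x y assume x: "x \<in> F m" and y: "y \<in> R n"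
          then obtain c where c: "c \<in> C" "mdist X y c * real n < 1"
            using F_sub[of "Suc n"] by (force simp: R_def F_def)
          have "1 \<le> mdist X x c * real m"
            using x c by (auto simp: F_def)
          then have "1 / real m \<le> mdist X x c" "mdist X y c < 1 / real n"
            using c mn by (simp_all add: field_simps)
          moreover have "mdist X x c \<le> mdist X x y + mdist X y c"
            using x y c C E F_sub by (intro mdist_triangle) (auto simp: R_def)
          ultimately show "1 / real m - 1 / real n \<le> mdist X x y"
            by linarith
        qed
        also have "\<dots> \<le> f (F (Suc n))"
          using F_mono[of m "Suc n"] mn F_sub[of "Suc n"] E by (intro mono) (auto simp: R_def)
        finally show ?thesis .
      qed
      have half: "(\<Sum>k<N. f (R (2 * k + b))) \<le> f (F (2 * N + b - 1))" for b N
      proof (induction N)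
        case (Suc N)
        have "(\<Sum>k<Suc N. f (R (2 * k + b))) \<le> f (F (2 * N + b - 1)) + f (R (2 * N + b))"
          using Suc by (simp add: add_right_mono)
        also have "\<dots> \<le> f (F (Suc (2 * N + b)))"
          by (rule F_R) auto
        finally show ?case by simp
      qed simp
      have F_E: "f (F n) \<le> f E" for n
        using F_sub E by (intro mono) auto
      have "(\<Sum>k. f (R k)) \<le> f E + f E"
      proof (rule suminf_le_const)
        fix n
        have "(\<Sum>k<n. f (R k)) \<le> (\<Sum>k<n * 2. f (R k))"
          by (rule sum_mono2) auto
        also have "\<dots> = (\<Sum>k<n. f (R (2 * k + 0))) + (\<Sum>k<n. f (R (2 * k + 1)))"
          by (induction n) (simp_all add: ac_simps)
        also have "\<dots> \<le> f E + f E"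
          by (intro add_mono order_trans[OF half F_E])
        finally show "(\<Sum>k<n. f (R k)) \<le> f E + f E" .
      qed simp
      then have T: "(\<Sum>k. f (R k)) < \<infinity>"
        using fin by (auto simp: less_top[symmetric] top_unique)
      have E_U: "f (E \<inter> U) + (\<Sum>k<n. f (R k)) \<le> f (F n) + (\<Sum>k. f (R k))" for n
      proof -
        define A where "A k = (case k of 0 \<Rightarrow> F n | Suc k \<Rightarrow> R (k + n))" for k
        have "x \<in> (\<Union>k. A k)" if "x \<in> F m" for x m
          using that
        proof (induction m)
          case (Suc m)
          consider "x \<in> F m" | "x \<in> F n" | "x \<in> R m" "x \<notin> F n"
            using Suc.prems by (auto simp: R_def)
          then show ?case
          proof cases
            case 2
            then have "x \<in> A 0" by (simp add: A_def)
            then show ?thesis by blast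
          next
            case 3
            have "n \<le> m"
              using F_mono[of "Suc m" n] Suc.prems 3 by force
            then have "x \<in> A (Suc (m - n))" using 3 by (simp add: A_def)
            then show ?thesis by blast
          qed (rule Suc.IH)
        qed (simp add: F0)
        moreover have A_sub: "A k \<subseteq> mspace X" for k
          using F_sub[of n] F_sub[of "Suc (k - 1 + n)"] E
          by (cases k) (auto simp: A_def R_def)
        ultimately have "f (E \<inter> U) \<le> f (\<Union>k. A k)"
          unfolding UN_F by (intro mono) blast+
        also have "\<dots> \<le> (\<Sum>k. f (A k))"
          by (rule csub) (rule A_sub)
        also have "\<dots> = f (F n) + (\<Sum>k. f (R (k + n)))"
          using suminf_offset[of "\<lambda>k. f (A k)" 1] by (simp add: A_def)
        finally have "f (E \<inter> U) + (\<Sum>k<n. f (R k))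
            \<le> f (F n) + ((\<Sum>k. f (R (k + n))) + (\<Sum>k<n. f (R k)))"
          by (simp add: add_right_mono add.assoc[symmetric])
        also have "(\<Sum>k. f (R (k + n))) + (\<Sum>k<n. f (R k)) = (\<Sum>k. f (R k))"
          using suminf_offset[of "\<lambda>k. f (R k)" n] by (simp add: add.commute)
        finally show ?thesis .
      qed
      have F_diff: "f (F n) + f (E - U) \<le> f E" for n
      proof (cases "n = 0")
        case True
        then show ?thesis using E by (simp add: F0 f0 mono)
      next
        case False
        have "f (F n) + f (E - U) \<le> f (F n \<union> (E - U))"
        proof (rule sep)
          show "0 < 1 / real n" using False by simp
          show "1 / real n \<le> mdist X x y" if "x \<in> F n" "y \<in> E - U" for x y
          proof -
            have "1 \<le> mdist X x y * real n"
              using that E by (auto simp: F_def C_def)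
            then show ?thesis using False by (simp add: field_simps)
          qed
        qed (use F_sub E in auto)
        also have "\<dots> \<le> f E"
          using F_sub E by (intro mono) auto
        finally show ?thesis .
      qed
      have "f (E \<inter> U) + f (E - U) + (\<Sum>k. f (R k))
          = (SUP n. f (E \<inter> U) + f (E - U) + (\<Sum>k<n. f (R k)))"
        by (simp add: suminf_eq_SUP ennreal_SUP_add_right)
      also have "\<dots> \<le> f E + (\<Sum>k. f (R k))"
      proof (rule SUP_least)
        fix n
        have "f (E \<inter> U) + f (E - U) + (\<Sum>k<n. f (R k))
            = f (E \<inter> U) + (\<Sum>k<n. f (R k)) + f (E - U)"
          by (simp add: ac_simps)
        also have "\<dots> \<le> f (F n) + (\<Sum>k. f (R k)) + f (E - U)"
          by (intro add_right_mono E_U)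
        also have "\<dots> = f (F n) + f (E - U) + (\<Sum>k. f (R k))"
          by (simp add: ac_simps)
        also have "\<dots> \<le> f E + (\<Sum>k. f (R k))"
          by (intro add_right_mono F_diff)
        finally show "f (E \<inter> U) + f (E - U) + (\<Sum>k<n. f (R k)) \<le> f E + (\<Sum>k. f (R k))" .
      qed
      finally show ?thesis
        using T by (simp add: ennreal_add_left_cancel_le add.commute[of _ "\<Sum>k. f (R k)"]
          less_top[symmetric])
    qed
  qed
  then show ?thesis
    using U_sub by (auto simp: algebra.lambda_system_eq[OF algebra_Pow])
qed

lemma emeasure_hausdorff_measure:
  assumes "A \<in> sets (hausdorff_measure s X)"
  shows "emeasure (hausdorff_measure s X) A = hausdorff_outer s X A"
proof -
  have gen: "{U. openin (mtopology_of X) U} \<subseteq> Pow (mspace X)"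
    using openin_subset by fastforce
  interpret P: sigma_algebra "mspace X" "Pow (mspace X)"
    by (rule sigma_algebra_Pow)
  have ms: "measure_space (mspace X) (lambda_system (mspace X) (Pow (mspace X)) (hausdorff_outer s X))
      (hausdorff_outer s X)"
    by (rule P.caratheodory_lemma[OF outer_measure_space_hausdorff_outer])
  have "sigma_sets (mspace X) {U. openin (mtopology_of X) U}
      \<subseteq> lambda_system (mspace X) (Pow (mspace X)) (hausdorff_outer s X)"
    using ms unfolding measure_space_def
    by (intro sigma_algebra.sigma_sets_subset)
      (auto intro!: openin_lambda_system outer_measure_space_hausdorff_outer
        hausdorff_outer_separated)
  with ms have "measure_space (mspace X) (sigma_sets (mspace X) {U. openin (mtopology_of X) U})
      (hausdorff_outer s X)"
    unfolding measure_space_def positive_def countably_additive_def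
    by (auto intro!: sigma_algebra_sigma_sets gen)
  then show ?thesis
    using assms gen
    by (intro emeasure_measure_of[OF hausdorff_measure_def])
      (auto simp: measure_space_def hausdorff_measure_def)
qed


section \<open>Ahlfors regularity\<close>

definition radon_measure :: "'a topology \<Rightarrow> 'a measure \<Rightarrow> bool" where
  "radon_measure T m \<longleftrightarrow>
    space m = topspace T \<and> sets m = sets (borel_of T) \<and>
    (\<forall>C. compactin T C \<longrightarrow> emeasure m C < \<infinity>) \<and>
    (\<forall>B\<in>sets m. emeasure m B = (INF U\<in>{U. openin T U \<and> B \<subseteq> U}. emeasure m U)) \<and>
    (\<forall>U. openin T U \<longrightarrow>
      emeasure m U = (SUP C\<in>{C. compactin T C \<and> closedin T C \<and> C \<subseteq> U}. emeasure m C))"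

definition ahlfors_regular :: "real \<Rightarrow> 'a metric \<Rightarrow> bool" where
  "ahlfors_regular \<alpha> X \<longleftrightarrow>
    (\<exists>m C. radon_measure (mtopology_of X) m \<and> 1 < C \<and>
      (\<forall>x\<in>mspace X. \<forall>r. 0 < r \<and> ennreal r < ediam X (mspace X) \<longrightarrow>
        ennreal (r powr \<alpha> / C) \<le> emeasure m (mball_of X x r) \<and>
        emeasure m (mball_of X x r) \<le> ennreal (C * r powr \<alpha>)))"


section \<open>Weak tangents\<close>

definition isometric_embedding :: "'a metric \<Rightarrow> 'b metric \<Rightarrow> ('a \<Rightarrow> 'b) \<Rightarrow> bool" where
  "isometric_embedding X Y f \<longleftrightarrow>
    f ` mspace X \<subseteq> mspace Y \<and>
    (\<forall>x\<in>mspace X. \<forall>y\<in>mspace X. mdist Y (f x) (f y) = mdist X x y)"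

text \<open>The suprema are taken in \<^typ>\<open>ennreal\<close>, so that the supremum over the empty set is \<open>0\<close>.\<close>

definition local_hausdorff_limit :: "'a metric \<Rightarrow> (nat \<Rightarrow> 'a set) \<Rightarrow> 'a set \<Rightarrow> bool" where
  "local_hausdorff_limit M F G \<longleftrightarrow>
    (\<forall>i. closedin (mtopology_of M) (F i) \<and> F i \<noteq> {}) \<and>
    closedin (mtopology_of M) G \<and> G \<noteq> {} \<and>
    (\<forall>q\<in>mspace M. \<forall>R>0.
      (\<lambda>i. SUP z\<in>F i \<inter> mball_of M q R. esetdist M z G) \<longlonglongrightarrow> 0 \<and>
      (\<lambda>i. SUP z\<in>G \<inter> mball_of M q R. esetdist M z (F i)) \<longlonglongrightarrow> 0)"

text \<open>A definition cannot quantify over types, so the type from which the points of the ambient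
  space \<open>M\<close> are drawn is a parameter. In a theorem that has the convergence as a hypothesis, this
  type is universally quantified, so nothing is assumed about \<open>M\<close> beyond its existence.\<close>

definition attouch_wets ::
  "'m itself \<Rightarrow> (nat \<Rightarrow> 'a metric) \<Rightarrow> (nat \<Rightarrow> 'a) \<Rightarrow> 'b metric \<Rightarrow> 'b \<Rightarrow> bool" where
  "attouch_wets _ X x Y y \<longleftrightarrow>
    (\<exists>(M :: 'm metric) p f g. p \<in> mspace M \<and>
      (\<forall>j. isometric_embedding (X j) M (f j) \<and> f j (x j) = p) \<and>
      isometric_embedding Y M g \<and> g y = p \<and>
      local_hausdorff_limit M (\<lambda>j. f j ` mspace (X j)) (g ` mspace Y))"

definition pointed_weak_tangent ::
  "'m itself \<Rightarrow> 'a metric \<Rightarrow> 'b metric \<Rightarrow> 'b \<Rightarrow> bool" where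
  "pointed_weak_tangent T X Z z \<longleftrightarrow>
    mcomplete_of Z \<and> z \<in> mspace Z \<and>
    (\<exists>x r. (\<forall>n. x n \<in> mspace X \<and> 0 < r n \<and> ennreal (r n) < ediam X (mspace X)) \<and>
      attouch_wets T (\<lambda>n. scale_metric (1 / r n) X) x Z z)"

definition weak_tangent :: "'m itself \<Rightarrow> 'a metric \<Rightarrow> 'b metric \<Rightarrow> bool" where
  "weak_tangent T X Z \<longleftrightarrow> (\<exists>z. pointed_weak_tangent T X Z z)"


section \<open>Modulus of curve families\<close>

text \<open>A curve is given by its interval of parameters and a function, whose values outside this
  interval are irrelevant. The interval may be open, half-open or unbounded.\<close>

type_synonym 'a param_curve = "real set \<times> (real \<Rightarrow> 'a)"

definition curves :: "'a metric \<Rightarrow> 'a param_curve set" where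
  "curves X = {(I, \<gamma>). is_interval I \<and>
    continuous_map (top_of_set I) (mtopology_of X) \<gamma> \<and> (\<exists>s\<in>I. \<exists>t\<in>I. \<gamma> s \<noteq> \<gamma> t)}"

definition curve_length :: "'a metric \<Rightarrow> (real \<Rightarrow> 'a) \<Rightarrow> real set \<Rightarrow> ennreal" where
  "curve_length X \<gamma> J = (SUP ts\<in>{ts. sorted ts \<and> set ts \<subseteq> J}.
    \<Sum>i<length ts - 1. ennreal (mdist X (\<gamma> (ts ! i)) (\<gamma> (ts ! Suc i))))"

definition locally_rectifiable :: "'a metric \<Rightarrow> 'a param_curve \<Rightarrow> bool" where
  "locally_rectifiable X = (\<lambda>(I, \<gamma>).
    \<forall>a b. {a..b} \<subseteq> I \<longrightarrow> curve_length X \<gamma> {a..b} < \<infinity>)"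

text \<open>The arc-length parametrization of \<open>\<gamma>\<close> on \<open>[a,b]\<close>. The defining equation determines it on
  \<open>[0, L]\<close>, where \<open>L\<close> is the (finite) length of \<open>\<gamma>\<close> on \<open>[a,b]\<close>, because the length of \<open>\<gamma>\<close> on
  \<open>[a,t]\<close> is continuous in \<open>t\<close>.\<close>

definition arclength_param :: "'a metric \<Rightarrow> (real \<Rightarrow> 'a) \<Rightarrow> real \<Rightarrow> real \<Rightarrow> real \<Rightarrow> 'a" where
  "arclength_param X \<gamma> a b =
    (SOME g. \<forall>t\<in>{a..b}. g (enn2real (curve_length X \<gamma> {a..t})) = \<gamma> t)"

definition segment_integral ::
  "'a metric \<Rightarrow> ('a \<Rightarrow> ennreal) \<Rightarrow> (real \<Rightarrow> 'a) \<Rightarrow> real \<Rightarrow> real \<Rightarrow> ennreal" where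
  "segment_integral X \<rho> \<gamma> a b =
    (\<integral>\<^sup>+u\<in>{0..enn2real (curve_length X \<gamma> {a..b})}. \<rho> (arclength_param X \<gamma> a b u) \<partial>lborel)"

definition line_integral :: "'a metric \<Rightarrow> ('a \<Rightarrow> ennreal) \<Rightarrow> 'a param_curve \<Rightarrow> ennreal" where
  "line_integral X \<rho> = (\<lambda>(I, \<gamma>).
    SUP (a, b)\<in>{(a, b). a \<le> b \<and> {a..b} \<subseteq> I}. segment_integral X \<rho> \<gamma> a b)"

definition admissible :: "'a metric \<Rightarrow> 'a param_curve set \<Rightarrow> ('a \<Rightarrow> ennreal) \<Rightarrow> bool" where
  "admissible X \<Gamma> \<rho> \<longleftrightarrow>
    \<rho> \<in> borel_measurable (borel_of (mtopology_of X)) \<and>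
    (\<forall>c\<in>\<Gamma>. locally_rectifiable X c \<longrightarrow> 1 \<le> line_integral X \<rho> c)"

definition modulus :: "real \<Rightarrow> 'a metric \<Rightarrow> 'a measure \<Rightarrow> 'a param_curve set \<Rightarrow> ennreal" where
  "modulus p X \<mu> \<Gamma> = (INF \<rho>\<in>{\<rho>. admissible X \<Gamma> \<rho>}. \<integral>\<^sup>+x. enn_powr (\<rho> x) p \<partial>\<mu>)"

definition vanishing_modulus :: "real \<Rightarrow> 'a metric \<Rightarrow> 'a measure \<Rightarrow> bool" where
  "vanishing_modulus p X \<mu> \<longleftrightarrow> (\<forall>\<Gamma>\<subseteq>curves X. modulus p X \<mu> \<Gamma> = 0)"


section \<open>Generalized Sierpinski carpets\<close>

definition unit_cube :: "(real ^ 'n) set" where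
  "unit_cube = {x. \<forall>k. 0 \<le> x $ k \<and> x $ k \<le> 1}"

definition carpet_map :: "nat \<Rightarrow> nat ^ 'n \<Rightarrow> real ^ 'n \<Rightarrow> real ^ 'n" where
  "carpet_map l j x = (\<chi> k. x $ k / real l + real (j $ k) / real l)"

definition carpet_level1 :: "nat \<Rightarrow> (nat ^ 'n) set \<Rightarrow> (real ^ 'n) set" where
  "carpet_level1 l S = (\<Union>j\<in>S. carpet_map l j ` unit_cube)"

text \<open>The last condition is the one on \<open>[0,1] \<times> {0}\<^sup>D\<^sup>-\<^sup>1\<close>, where \<open>D = CARD('n)\<close>. The index type \<open>'n\<close> has no
  distinguished first coordinate; \<open>k0\<close> is the coordinate that is counted as the first. By the
  symmetry condition, it does not matter which one it is.\<close>

definition generalized_sierpinski_carpet ::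
  "nat \<Rightarrow> (nat ^ 'n) set \<Rightarrow> (real ^ 'n) set \<Rightarrow> bool" where
  "generalized_sierpinski_carpet l S K \<longleftrightarrow>
    2 \<le> CARD('n) \<and> 3 \<le> l \<and> S \<noteq> {} \<and> S \<subset> {j. \<forall>k. j $ k < l} \<and>
    compact K \<and> K \<noteq> {} \<and> K = (\<Union>j\<in>S. carpet_map l j ` K) \<and>
    (\<forall>f :: real ^ 'n \<Rightarrow> real ^ 'n.
      (\<forall>x y. dist (f x) (f y) = dist x y) \<and> f ` unit_cube = unit_cube \<longrightarrow>
      f ` carpet_level1 l S = carpet_level1 l S) \<and>
    connected (carpet_level1 l S) \<and>
    (\<forall>(i :: int ^ 'n) (\<epsilon> :: int ^ 'n). (\<forall>k. \<epsilon> $ k \<in> {0, 1}) \<longrightarrow>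
      (let V = interior (carpet_level1 l S \<inter>
          {x. \<forall>k. real_of_int (i $ k - \<epsilon> $ k) / real l \<le> x $ k \<and>
                  x $ k \<le> real_of_int (i $ k + 1) / real l})
       in V = {} \<or> connected V)) \<and>
    (\<exists>k0. {x. 0 \<le> x $ k0 \<and> x $ k0 \<le> 1 \<and> (\<forall>k. k \<noteq> k0 \<longrightarrow> x $ k = 0)} \<subseteq> carpet_level1 l S)"

definition sup_metric :: "(real ^ 'n) metric" where
  "sup_metric = metric (UNIV, \<lambda>x y. MAX k. \<bar>x $ k - y $ k\<bar>)"

lemma Metric_space_sup_metric:
  "Metric_space (UNIV :: (real ^ 'n) set) (\<lambda>x y. MAX k. \<bar>x $ k - y $ k\<bar>)"
proof
  fix x y z :: "real ^ 'n"
  have le: "\<bar>a $ k - b $ k\<bar> \<le> (MAX k. \<bar>a $ k - b $ k\<bar>)" for a b :: "real ^ 'n" and k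
    by (rule Max_ge) auto
  show "0 \<le> (MAX k. \<bar>x $ k - y $ k\<bar>)"
    using le[of x _ y] abs_ge_zero order_trans by blast
  show "(MAX k. \<bar>x $ k - y $ k\<bar>) = (MAX k. \<bar>y $ k - x $ k\<bar>)"
    by (simp add: abs_minus_commute)
  show "(MAX k. \<bar>x $ k - y $ k\<bar>) = 0 \<longleftrightarrow> x = y"
  proof
    assume "(MAX k. \<bar>x $ k - y $ k\<bar>) = 0"
    then have "x $ k = y $ k" for k
      using le[of x k y] by simp
    then show "x = y" by (simp add: vec_eq_iff)
  qed simp
  show "(MAX k. \<bar>x $ k - z $ k\<bar>) \<le> (MAX k. \<bar>x $ k - y $ k\<bar>) + (MAX k. \<bar>y $ k - z $ k\<bar>)"
  proof (rule Max.boundedI)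
    fix r assume "r \<in> range (\<lambda>k. \<bar>x $ k - z $ k\<bar>)"
    then obtain k where "r = \<bar>x $ k - z $ k\<bar>" by blast
    then show "r \<le> (MAX k. \<bar>x $ k - y $ k\<bar>) + (MAX k. \<bar>y $ k - z $ k\<bar>)"
      using le[of x k y] le[of y k z] by linarith
  qed auto
qed

lemma mspace_sup_metric [simp]: "mspace sup_metric = UNIV"
  unfolding sup_metric_def by (rule Metric_space.mspace_metric[OF Metric_space_sup_metric])

lemma mdist_sup_metric: "mdist sup_metric x y = (MAX k. \<bar>x $ k - y $ k\<bar>)"
  unfolding sup_metric_def by (simp add: Metric_space.mdist_metric[OF Metric_space_sup_metric])

end

theory Submission
  imports Defs
begin

text \<open>The dimension is \<open>d = log N / log l\<close> with \<open>N = |S|\<close>: the cells of level \<open>n\<close> give covers of bounded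
  \<open>d\<close>-cost, and counting the cells met by a ball gives a lower bound for every cover. Hence
  \<open>0 < \<H>\<^sub>d(K) < \<infinity>\<close>, distinct cells of a level overlap in null sets, and \<open>K\<close> is \<open>d\<close>-regular under \<open>\<H>\<^sub>d\<close>.

  Blow up \<open>K\<close> by powers of \<open>l\<close> comparable to \<open>1/r\<^sub>n\<close> and translate by integer vectors: the results are
  unions of integer translates of \<open>K\<close>. Along an ultrafilter these unions stabilize on bounded sets,
  and the approximating points converge, so \<open>Z\<close> is similar to some \<open>\<Union>j\<in>J. K + j\<close> with
  \<open>J \<subseteq> \<int>\<^sup>D\<close>, whose balls are balls of blow-ups of \<open>K\<close>; this gives the regularity of \<open>Z\<close>.

  For the modulus, a bump moved inside the cube from a hole of \<open>K\<close> to a point of \<open>K\<close> has a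
  non-constant integral, so some test function supported in the open cube has a non-zero mean gradient
  over \<open>K\<close>. By the symmetries of \<open>K\<close> all mean gradients occur, so every linear function \<open>a \<bullet> x\<close> can be
  perturbed inside the cube so that the \<open>2q\<close>-energy decreases by a factor \<open>\<theta> < 1\<close> independent of \<open>a\<close>.
  Repeating this in small cells, where gradients are almost constant, gives functions uniformly close to the
  coordinates with arbitrarily small energy. Weighted gradients of these are admissible for all curves.\<close>

section \<open>Hausdorff measures and similarities\<close>

text \<open>Over the full cube, functions supported inside have mean gradient zero and linear
  functions minimize the energy; a hole is what breaks this. Moving against a non-zero mean gradient
  lowers the energy to first order, with an error of second order. The exponent \<open>2 * q\<close>
  is even so that the energy is a power of a squared norm and this expansion is elementary; a
  general \<open>p\<close> is bounded through such an exponent. Supports in the open cube matter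
  throughout: perturbations in different cells do not interact, nothing has to be matched across
  faces, and one function can be copied into every translate of \<open>K\<close> in a tangent.
  Rescaling to small cells keeps gradients and shrinks values, so staying close to the coordinates
  costs nothing. A tangent comes with an unknown ambient space, and limits are needed for all its
  points and all integer vectors at once; an ultrafilter takes them without subsequences. A tangent
  may be unbounded, and no lower bound on the size of curves is available. Hence gradients of ever
  better approximations, with growing weights and cut off at growing boxes, are combined into one
  density, their energies decaying faster than the weights grow.\<close>

definition similarity :: "real \<Rightarrow> 'a metric \<Rightarrow> 'b metric \<Rightarrow> ('a \<Rightarrow> 'b) \<Rightarrow> bool" where
  "similarity c X Y f \<longleftrightarrow> 0 < c \<and> f ` mspace X \<subseteq> mspace Y \<and>
    (\<forall>x\<in>mspace X. \<forall>y\<in>mspace X. mdist Y (f x) (f y) = c * mdist X x y)"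

lemma similarity_inj_on: "similarity c X Y f \<Longrightarrow> inj_on f (mspace X)"
  unfolding similarity_def inj_on_def by (metis mdist_zero mult_eq_0_iff order_less_irrefl subset_iff image_eqI)

text \<open>Multiplication by a positive finite constant is an order isomorphism of the extended
  half-line, with inverse \<open>1 / c\<close>, so it respects infima as well as suprema.\<close>

lemma INF_mult_left_ennreal:
  assumes "0 < c"
  shows "(INF i\<in>I. ennreal c * f i) = ennreal c * (INF i\<in>I. f i)"
proof (rule antisym)
  have inv: "ennreal c * (ennreal (1 / c) * x) = x" "ennreal (1 / c) * (ennreal c * x) = x" for x
    using assms by (simp_all add: mult.assoc[symmetric] ennreal_mult[symmetric])
  have "ennreal (1 / c) * (INF i\<in>I. ennreal c * f i) \<le> ennreal (1 / c) * (ennreal c * f i)" if "i \<in> I" for i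
    using that by (intro mult_left_mono INF_lower) auto
  then have "ennreal (1 / c) * (INF i\<in>I. ennreal c * f i) \<le> (INF i\<in>I. f i)"
    by (intro INF_greatest) (simp add: inv)
  then have "ennreal c * (ennreal (1 / c) * (INF i\<in>I. ennreal c * f i)) \<le> ennreal c * (INF i\<in>I. f i)"
    by (rule mult_left_mono) auto
  then show "(INF i\<in>I. ennreal c * f i) \<le> ennreal c * (INF i\<in>I. f i)"
    by (simp only: inv)
qed (auto intro!: INF_greatest mult_left_mono INF_lower)

lemma ediam_similarity_image:
  assumes "similarity c X Y f" "B \<subseteq> mspace X"
  shows "ediam Y (f ` B) = ennreal c * ediam X B"
proof -
  have "(SUP y\<in>B. ennreal (mdist Y (f x) (f y))) = ennreal c * (SUP y\<in>B. ennreal (mdist X x y))"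
    if "x \<in> B" for x
  proof (cases "B = {}")
    case False
    have "ennreal (mdist Y (f x) (f y)) = ennreal c * ennreal (mdist X x y)" if "y \<in> B" for y
      using assms \<open>x \<in> B\<close> that unfolding similarity_def by (auto simp: ennreal_mult subset_iff)
    then show ?thesis
      by (simp add: SUP_mult_left_ennreal)
  qed (use that in auto)
  then show ?thesis
    unfolding ediam_def by (simp add: image_image SUP_mult_left_ennreal)
qed

lemma enn_powr_mult:
  assumes "0 < c"
  shows "enn_powr (ennreal c * x) s = ennreal (c powr s) * enn_powr x s"
proof (cases x)
  case (real r)
  then show ?thesis
    using assms by (auto simp: enn_powr_def ennreal_mult[symmetric] powr_mult)
next
  case top
  then show ?thesis
    using assms by (auto simp: enn_powr_def ennreal_mult_top)
qed

lemma hausdorff_gauge_similarity_image: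
  assumes "similarity c X Y f" "B \<subseteq> mspace X"
  shows "hausdorff_gauge s Y (f ` B) = ennreal (c powr s) * hausdorff_gauge s X B"
proof -
  have "0 < c" using assms by (simp add: similarity_def)
  then show ?thesis
    by (simp add: hausdorff_gauge_def ediam_similarity_image[OF assms] enn_powr_mult)
qed

lemma enn_powr_mono:
  assumes "x \<le> y" "0 \<le> s"
  shows "enn_powr x s \<le> enn_powr y s"
proof (cases y)
  case (real r)
  then obtain r' where "x = ennreal r'" "0 \<le> r'" "r' \<le> r"
    using assms by (cases x) (auto simp: top_unique)
  then show ?thesis
    using real assms by (auto simp: enn_powr_def intro!: ennreal_leI powr_mono2)
qed (auto simp: enn_powr_def)

lemma hausdorff_gauge_mono:
  assumes "A \<subseteq> B" "0 \<le> s"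
  shows "hausdorff_gauge s X A \<le> hausdorff_gauge s X B"
proof -
  have le: "ediam X A \<le> ediam X B"
    unfolding ediam_def by (meson SUP_subset_mono assms(1) order_refl)
  then show ?thesis
    using le assms by (auto simp: hausdorff_gauge_def intro: enn_powr_mono)
qed

text \<open>Covers are transported both ways. The map need not be onto, so the sets of a cover of
  the image may stick out of its range; their preimages still cover \<open>A\<close>, and passing to
  the images of these preimages only makes the sets smaller.\<close>

lemma hausdorff_pre_similarity_image:
  assumes f: "similarity c X Y f" and A: "A \<subseteq> mspace X" and s: "0 \<le> s" and \<delta>: "0 < \<delta>"
  shows "hausdorff_pre s Y (c * \<delta>) (f ` A) = ennreal (c powr s) * hausdorff_pre s X \<delta> A"
proof (rule antisym)
  have c: "0 < c" using f by (simp add: similarity_def)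
  show "hausdorff_pre s Y (c * \<delta>) (f ` A) \<le> ennreal (c powr s) * hausdorff_pre s X \<delta> A"
  proof -
    have le: "hausdorff_pre s Y (c * \<delta>) (f ` A) \<le> ennreal (c powr s) * (\<Sum>i. hausdorff_gauge s X (B i))"
      if B: "B \<in> hausdorff_covers X \<delta> A" for B
    proof -
      have Bs: "B i \<subseteq> mspace X" "ediam X (B i) \<le> ennreal \<delta>" for i
        using B by (auto simp: hausdorff_covers_def)
      have "(\<lambda>i. f ` B i) \<in> hausdorff_covers Y (c * \<delta>) (f ` A)"
        unfolding hausdorff_covers_def mem_Collect_eq
      proof (intro conjI allI)
        show "f ` B i \<subseteq> mspace Y" for i
          using f Bs(1)[of i] by (auto simp: similarity_def)
        show "ediam Y (f ` B i) \<le> ennreal (c * \<delta>)" for i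
          using c \<delta> Bs(2)[of i]
          by (simp add: ediam_similarity_image[OF f Bs(1)] ennreal_mult mult_left_mono)
        show "f ` A \<subseteq> (\<Union>i. f ` B i)"
          using B unfolding hausdorff_covers_def by blast
      qed
      then have "hausdorff_pre s Y (c * \<delta>) (f ` A) \<le> (\<Sum>i. hausdorff_gauge s Y (f ` B i))"
        unfolding hausdorff_pre_def by (rule INF_lower)
      then show ?thesis
        by (simp add: hausdorff_gauge_similarity_image[OF f Bs(1)])
    qed
    show ?thesis
      unfolding hausdorff_pre_def[of s X] using c
      by (subst INF_mult_left_ennreal[symmetric]) (auto intro!: INF_greatest le)
  qed
  show "ennreal (c powr s) * hausdorff_pre s X \<delta> A \<le> hausdorff_pre s Y (c * \<delta>) (f ` A)"
    unfolding hausdorff_pre_def[of s Y]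
  proof (rule INF_greatest)
    fix B assume B: "B \<in> hausdorff_covers Y (c * \<delta>) (f ` A)"
    define B' where "B' i = {x \<in> mspace X. f x \<in> B i}" for i
    have B's: "B' i \<subseteq> mspace X" for i by (auto simp: B'_def)
    have img: "f ` B' i \<subseteq> B i" for i by (auto simp: B'_def)
    have "ennreal c * ediam X (B' i) \<le> ennreal c * ennreal \<delta>" for i
    proof -
      have "ennreal c * ediam X (B' i) = ediam Y (f ` B' i)"
        by (simp add: ediam_similarity_image[OF f B's])
      also have "\<dots> \<le> ediam Y (B i)"
        unfolding ediam_def using img by (meson SUP_subset_mono order_refl)
      also have "\<dots> \<le> ennreal (c * \<delta>)"
        using B by (simp add: hausdorff_covers_def)
      finally show ?thesis using c \<delta> by (simp add: ennreal_mult)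
    qed
    then have d: "ediam X (B' i) \<le> ennreal \<delta>" for i
      using c by (metis ennreal_eq_0_iff ennreal_mult_le_mult_iff ennreal_neq_top not_le)
    have "B' \<in> hausdorff_covers X \<delta> A"
      using B A d unfolding hausdorff_covers_def by (fastforce simp: B'_def)
    then have "ennreal (c powr s) * hausdorff_pre s X \<delta> A
        \<le> ennreal (c powr s) * (\<Sum>i. hausdorff_gauge s X (B' i))"
      unfolding hausdorff_pre_def by (intro mult_left_mono INF_lower) auto
    also have "\<dots> = (\<Sum>i. hausdorff_gauge s Y (f ` B' i))"
      by (simp add: hausdorff_gauge_similarity_image[OF f B's])
    also have "\<dots> \<le> (\<Sum>i. hausdorff_gauge s Y (B i))"
      using img s by (intro suminf_le hausdorff_gauge_mono) auto
    finally show "ennreal (c powr s) * hausdorff_pre s X \<delta> A \<le> (\<Sum>i. hausdorff_gauge s Y (B i))" .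
  qed
qed

text \<open>Hausdorff measure is intrinsic: as \<open>f\<close> need not be onto, the case
  \<open>c = 1\<close> compares a set in a subspace with the same set in the whole space.\<close>

lemma hausdorff_outer_similarity_image:
  assumes f: "similarity c X Y f" and A: "A \<subseteq> mspace X" and s: "0 \<le> s"
  shows "hausdorff_outer s Y (f ` A) = ennreal (c powr s) * hausdorff_outer s X A"
proof -
  have c: "0 < c" using f by (simp add: similarity_def)
  have "{0<..} = (\<lambda>\<delta>. c * \<delta>) ` {0::real<..}"
  proof -
    have "x \<in> (\<lambda>\<delta>. c * \<delta>) ` {0::real<..}" if "0 < x" for x
      using c that by (intro image_eqI[of _ _ "x / c"]) auto
    then show ?thesis using c by auto
  qed
  then have "hausdorff_outer s Y (f ` A) = (SUP \<delta>\<in>{0<..}. hausdorff_pre s Y (c * \<delta>) (f ` A))"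
    unfolding hausdorff_outer_def by (metis (no_types, lifting) image_image SUP_cong)
  also have "\<dots> = (SUP \<delta>\<in>{0<..}. ennreal (c powr s) * hausdorff_pre s X \<delta> A)"
    by (intro SUP_cong refl hausdorff_pre_similarity_image[OF f A s]) auto
  also have "\<dots> = ennreal (c powr s) * hausdorff_outer s X A"
    unfolding hausdorff_outer_def by (simp add: SUP_mult_left_ennreal)
  finally show ?thesis .
qed

text \<open>A finite cover becomes a sequence by padding with empty sets, whose gauge is
  \<open>0\<close> for every exponent.\<close>

lemma hausdorff_pre_le_sum:
  assumes "finite I" "\<And>i. i \<in> I \<Longrightarrow> A i \<subseteq> mspace X" "\<And>i. i \<in> I \<Longrightarrow> ediam X (A i) \<le> ennreal \<delta>"
    and "E \<subseteq> (\<Union>i\<in>I. A i)"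
  shows "hausdorff_pre s X \<delta> E \<le> (\<Sum>i\<in>I. hausdorff_gauge s X (A i))"
proof -
  obtain g where g: "bij_betw g {..<card I} I"
    using ex_bij_betw_nat_finite[OF assms(1)] by (auto simp: lessThan_atLeast0)
  define B where "B n = (if n < card I then A (g n) else {})" for n
  have gI: "g n \<in> I" if "n < card I" for n
    using g that by (auto simp: bij_betw_def)
  have "E \<subseteq> (\<Union>n. B n)"
  proof
    fix x assume "x \<in> E"
    then obtain i where i: "i \<in> I" "x \<in> A i" using assms(4) by auto
    then obtain n where "n < card I" "g n = i"
      using g unfolding bij_betw_def by (metis imageE lessThan_iff)
    then show "x \<in> (\<Union>n. B n)" using i by (auto simp: B_def intro!: exI[of _ n])
  qed
  then have "B \<in> hausdorff_covers X \<delta> E"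
    using assms(2,3) gI by (auto simp: hausdorff_covers_def B_def ediam_def bot_ennreal)
  then have "hausdorff_pre s X \<delta> E \<le> (\<Sum>n. hausdorff_gauge s X (B n))"
    unfolding hausdorff_pre_def by (rule INF_lower)
  also have "\<dots> = (\<Sum>n<card I. hausdorff_gauge s X (B n))"
    by (rule suminf_finite) (auto simp: B_def hausdorff_gauge_def)
  also have "\<dots> = (\<Sum>n<card I. hausdorff_gauge s X (A (g n)))"
    by (rule sum.cong) (auto simp: B_def)
  also have "\<dots> = (\<Sum>i\<in>I. hausdorff_gauge s X (A i))"
    using sum.reindex_bij_betw[OF g, of "\<lambda>i. hausdorff_gauge s X (A i)"] by simp
  finally show ?thesis .
qed

lemma hausdorff_gauge_le:
  assumes "ediam X A \<le> ennreal r" "0 \<le> r" "0 < s"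
  shows "hausdorff_gauge s X A \<le> ennreal (r powr s)"
proof -
  obtain q where "ediam X A = ennreal q" "0 \<le> q" "q \<le> r"
    using assms by (cases "ediam X A") (auto simp: top_unique)
  then show ?thesis
    using assms(3) by (auto simp: hausdorff_gauge_def enn_powr_def intro!: ennreal_leI powr_mono2)
qed

text \<open>For a set of diameter at most \<delta>, raising the exponent from \<open>s\<close> to
  \<open>t\<close> gains a factor \<open>\<delta> powr (t - s)\<close>. As \<delta> tends to zero, a
  vanishing factor meets a finite number.\<close>

lemma hausdorff_outer_eq_0_of_finite:
  assumes fin: "hausdorff_outer s X E < \<infinity>" and st: "0 \<le> s" "s < t"
  shows "hausdorff_outer t X E = 0"
proof -
  have gauge: "hausdorff_gauge t X A \<le> ennreal (\<delta> powr (t - s)) * hausdorff_gauge s X A"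
    if le: "ediam X A \<le> ennreal \<delta>" and "0 < \<delta>" for A \<delta>
  proof -
    obtain q where q: "ediam X A = ennreal q" "0 \<le> q" "q \<le> \<delta>"
      using le \<open>0 < \<delta>\<close> by (cases "ediam X A") (auto simp: top_unique)
    \<comment> \<open>The case distinction mirrors the convention \<open>x^0 = 1\<close> of
      \<open>enn_powr\<close>, from which \<open>powr\<close> deviates at \<open>0\<close>.\<close>
    have "q powr t \<le> \<delta> powr (t - s) * (if s = 0 then 1 else q powr s)"
    proof (cases "s = 0")
      case True
      then show ?thesis using q st by (auto intro!: powr_mono2)
    next
      case False
      have "q powr t = q powr (t - s) * q powr s"
        by (simp add: powr_add[symmetric])
      then show ?thesis using q st False by (auto intro!: mult_right_mono powr_mono2)
    qed
    then show ?thesis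
      using q st by (auto simp: hausdorff_gauge_def enn_powr_def ennreal_mult[symmetric] intro!: ennreal_leI split: if_splits)
  qed
  have pre: "hausdorff_pre t X \<delta> E \<le> ennreal (\<delta> powr (t - s)) * hausdorff_outer s X E" if "0 < \<delta>" for \<delta>
  proof -
    have le: "hausdorff_pre s X \<delta> E \<le> hausdorff_outer s X E"
      unfolding hausdorff_outer_def using that by (intro SUP_upper) auto
    have "hausdorff_pre t X \<delta> E \<le>
        (INF A\<in>hausdorff_covers X \<delta> E. ennreal (\<delta> powr (t - s)) * (\<Sum>i. hausdorff_gauge s X (A i)))"
    proof (rule INF_greatest)
      fix A assume A: "A \<in> hausdorff_covers X \<delta> E"
      then have "hausdorff_pre t X \<delta> E \<le> (\<Sum>i. hausdorff_gauge t X (A i))"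
        unfolding hausdorff_pre_def by (rule INF_lower)
      also have "\<dots> \<le> (\<Sum>i. ennreal (\<delta> powr (t - s)) * hausdorff_gauge s X (A i))"
        using A that by (intro suminf_le gauge) (auto simp: hausdorff_covers_def)
      finally show "hausdorff_pre t X \<delta> E \<le> ennreal (\<delta> powr (t - s)) * (\<Sum>i. hausdorff_gauge s X (A i))"
        by simp
    qed
    also have "\<dots> = ennreal (\<delta> powr (t - s)) * hausdorff_pre s X \<delta> E"
      unfolding hausdorff_pre_def by (rule INF_mult_left_ennreal) (use that in auto)
    also have "\<dots> \<le> ennreal (\<delta> powr (t - s)) * hausdorff_outer s X E"
      by (intro mult_left_mono le) auto
    finally show ?thesis .
  qed
  obtain c where c: "hausdorff_outer s X E = ennreal c" "0 \<le> c"
    using fin by (cases "hausdorff_outer s X E") auto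
  have "hausdorff_pre t X \<delta> E \<le> 0" if "0 < \<delta>" for \<delta>
  proof (rule ennreal_le_epsilon)
    fix e :: real assume e: "0 < e"
    \<comment> \<open>Chosen so that \<open>\<eta> powr (t - s) * c \<le> e\<close>; the
      \<open>c + 1\<close> avoids a division by zero.\<close>
    define \<eta> where "\<eta> = min \<delta> ((e / (c + 1)) powr (1 / (t - s)))"
    have \<eta>: "0 < \<eta>" using that e c by (auto simp: \<eta>_def)
    have "\<eta> powr (t - s) \<le> ((e / (c + 1)) powr (1 / (t - s))) powr (t - s)"
      using \<eta> st by (intro powr_mono2) (auto simp: \<eta>_def)
    also have "\<dots> = e / (c + 1)" using e c st by (simp add: powr_powr)
    finally have "\<eta> powr (t - s) * c \<le> e / (c + 1) * c" using c by (intro mult_right_mono) auto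
    also have "\<dots> \<le> e" using e c by (simp add: field_simps)
    finally have le: "\<eta> powr (t - s) * c \<le> e" .
    have "hausdorff_pre t X \<delta> E \<le> hausdorff_pre t X \<eta> E"
      by (rule hausdorff_pre_antimono) (simp add: \<eta>_def)
    also have "\<dots> \<le> ennreal (\<eta> powr (t - s)) * ennreal c" using pre[OF \<eta>] c by simp
    also have "\<dots> \<le> ennreal e" using le c by (simp add: ennreal_mult[symmetric] ennreal_leI)
    finally show "hausdorff_pre t X \<delta> E \<le> 0 + ennreal e" by simp
  qed
  then show ?thesis
    unfolding hausdorff_outer_def by (auto intro!: antisym SUP_least)
qed

lemma hausdorff_dim_eqI:
  assumes s: "0 < s" and pos: "hausdorff_outer s X (mspace X) \<noteq> 0"
    and fin: "hausdorff_outer s X (mspace X) < \<infinity>"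
  shows "hausdorff_dim X = ereal s"
proof (rule antisym)
  show "hausdorff_dim X \<le> ereal s"
  proof (rule ereal_le_epsilon2)
    fix e :: real assume "0 < e"
    then have "hausdorff_outer (s + e) X (mspace X) = 0"
      using s by (intro hausdorff_outer_eq_0_of_finite[OF fin]) auto
    then show "hausdorff_dim X \<le> ereal s + ereal e"
      unfolding hausdorff_dim_def using s \<open>0 < e\<close> by (intro INF_lower2[of "s + e"]) auto
  qed
  show "ereal s \<le> hausdorff_dim X"
    unfolding hausdorff_dim_def
  proof (rule INF_greatest)
    fix t assume "t \<in> {t. 0 \<le> t \<and> hausdorff_outer t X (mspace X) = 0}"
    then show "ereal s \<le> ereal t"
      using hausdorff_outer_eq_0_of_finite[of t X "mspace X" s] pos by force
  qed
qed

section \<open>The maximum metric\<close>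

lemma sup_dist_le_iff: "mdist sup_metric x y \<le> r \<longleftrightarrow> (\<forall>k. \<bar>x $ k - y $ k\<bar> \<le> r)"
  by (simp add: mdist_sup_metric)

lemma sup_dist_less_iff: "mdist sup_metric x y < r \<longleftrightarrow> (\<forall>k. \<bar>x $ k - y $ k\<bar> < r)"
  by (simp add: mdist_sup_metric)

lemma component_le_sup_dist: "\<bar>x $ k - y $ k\<bar> \<le> mdist sup_metric x y"
  using sup_dist_le_iff[of x y "mdist sup_metric x y"] by blast

lemma sup_dist_le_dist: "mdist sup_metric x y \<le> dist x y"
  using component_le_norm_cart[of "x - y"] by (simp add: sup_dist_le_iff dist_norm)

lemma dist_le_sup_dist:
  fixes x y :: "real ^ 'n"
  shows "dist x y \<le> real CARD('n) * mdist sup_metric x y"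
proof -
  have "dist x y \<le> (\<Sum>k\<in>UNIV. \<bar>(x - y) $ k\<bar>)"
    unfolding dist_norm by (rule norm_le_l1_cart)
  also have "\<dots> \<le> (\<Sum>k\<in>(UNIV :: 'n set). mdist sup_metric x y)"
    using component_le_sup_dist[of x _ y] by (intro sum_mono) simp
  finally show ?thesis by simp
qed

lemma open_sup_ball: "open {y. mdist sup_metric a y < r}"
proof -
  have "{y. mdist sup_metric a y < r} = (\<Inter>k. {y. \<bar>a $ k - y $ k\<bar> < r})"
    by (auto simp: sup_dist_less_iff)
  moreover have "open {y. \<bar>a $ k - y $ k\<bar> < r}" for k
    by (intro open_Collect_less continuous_intros)
  ultimately show ?thesis by (simp add: open_INT)
qed

text \<open>The two metrics bound each other up to the dimension as a factor, so the Hausdorff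
  measures of the maximum metric live on the usual Borel sets.\<close>

lemma mtopology_of_sup_metric: "mtopology_of (sup_metric :: (real ^ 'n) metric) = euclidean"
proof (rule topology_eq[THEN iffD2], intro allI)
  interpret Metric_space "UNIV :: (real ^ 'n) set" "mdist sup_metric"
    using Metric_space_mspace_mdist[of "sup_metric :: (real ^ 'n) metric"] by simp
  fix U :: "(real ^ 'n) set"
  have "(\<exists>e>0. \<forall>y. dist y x < e \<longrightarrow> y \<in> U) \<longleftrightarrow> (\<exists>r>0. mball x r \<subseteq> U)" for x
  proof safe
    fix e :: real assume e: "0 < e" "\<forall>y. dist y x < e \<longrightarrow> y \<in> U"
    have "y \<in> U" if "mdist sup_metric x y < e / real CARD('n)" for y
    proof -
      have "dist y x \<le> real CARD('n) * mdist sup_metric x y"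
        using dist_le_sup_dist[of x y] by (simp add: dist_commute)
      also have "\<dots> < e" using that by (simp add: field_simps)
      finally show ?thesis using e by blast
    qed
    then show "\<exists>r>0. mball x r \<subseteq> U"
      using e by (intro exI[of _ "e / real CARD('n)"]) (auto simp: subset_iff)
  next
    fix r :: real assume r: "0 < r" "mball x r \<subseteq> U"
    show "\<exists>e>0. \<forall>y. dist y x < e \<longrightarrow> y \<in> U"
    proof (intro exI conjI allI impI)
      fix y assume "dist y x < r"
      then have "mdist sup_metric x y < r"
        using sup_dist_le_dist[of x y] by (simp add: dist_commute)
      then show "y \<in> U" using r by auto
    qed (rule r)
  qed
  then show "openin (mtopology_of sup_metric) U \<longleftrightarrow> openin euclidean U"
    by (auto simp: mtopology_of_def openin_mtopology open_dist)
qed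

lemma sets_hausdorff_sup_metric [simp]:
  "sets (hausdorff_measure s (sup_metric :: (real ^ 'n) metric)) = sets borel"
  by (simp add: hausdorff_measure_def mtopology_of_sup_metric borel_def)

lemma space_hausdorff_sup_metric [simp]:
  "space (hausdorff_measure s (sup_metric :: (real ^ 'n) metric)) = UNIV"
  by (simp add: hausdorff_measure_def)

lemma emeasure_hausdorff_sup_metric:
  fixes A :: "(real ^ 'n) set"
  shows "A \<in> sets borel \<Longrightarrow> emeasure (hausdorff_measure s sup_metric) A = hausdorff_outer s sup_metric A"
  by (simp add: emeasure_hausdorff_measure)

lemma measurable_hausdorff_sup_metric [simp]:
  "measurable (hausdorff_measure s (sup_metric :: (real ^ 'n) metric)) N = measurable borel N"
  by (rule measurable_cong_sets) auto

text \<open>Translation comes before scaling, so that the cells of level \<open>n\<close> are the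
  images of \<open>K\<close> for \<open>c = 1 / l^n\<close> and integer vectors
  \<open>v\<close>.\<close>

definition affine_scale :: "real \<Rightarrow> real ^ 'n \<Rightarrow> real ^ 'n \<Rightarrow> real ^ 'n" where
  "affine_scale c v x = c *\<^sub>R (x + v)"

lemma affine_scale_nth [simp]: "affine_scale c v x $ k = c * (x $ k + v $ k)"
  by (simp add: affine_scale_def)

lemma sup_dist_scale:
  assumes "0 \<le> c" shows "mdist sup_metric (c *\<^sub>R x) (c *\<^sub>R y) = c * mdist sup_metric x y"
proof (rule antisym)
  have le: "mdist sup_metric (c *\<^sub>R x) (c *\<^sub>R y) \<le> c * mdist sup_metric x y" if "0 \<le> c" for c and x y :: "real ^ 'n"
    using component_le_sup_dist[of x _ y] that
    by (simp add: sup_dist_le_iff right_diff_distrib[symmetric] abs_mult mult_left_mono)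
  show "mdist sup_metric (c *\<^sub>R x) (c *\<^sub>R y) \<le> c * mdist sup_metric x y"
    by (rule le[OF assms])
  show "c * mdist sup_metric x y \<le> mdist sup_metric (c *\<^sub>R x) (c *\<^sub>R y)"
  proof (cases "c = 0")
    case False
    then have "mdist sup_metric x y \<le> (1/c) * mdist sup_metric (c *\<^sub>R x) (c *\<^sub>R y)"
      using le[of "1/c" "c *\<^sub>R x" "c *\<^sub>R y"] assms by simp
    then show ?thesis using False assms by (simp add: field_simps)
  qed simp
qed

lemma sup_dist_add_right [simp]: "mdist sup_metric (x + v) (y + v) = mdist sup_metric x y"
  by (simp add: mdist_sup_metric)

lemma sup_dist_affine_scale:
  "0 \<le> c \<Longrightarrow> mdist sup_metric (affine_scale c v x) (affine_scale c v y) = c * mdist sup_metric x y"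
  by (simp add: affine_scale_def sup_dist_scale)

lemma similarity_affine_scale: "0 < c \<Longrightarrow> similarity c sup_metric sup_metric (affine_scale c v)"
  by (simp add: similarity_def sup_dist_affine_scale)

lemma affine_scale_inverse:
  "c \<noteq> 0 \<Longrightarrow> affine_scale (1/c) (- (c *\<^sub>R v)) (affine_scale c v x) = x"
  "c \<noteq> 0 \<Longrightarrow> affine_scale c v (affine_scale (1/c) (- (c *\<^sub>R v)) x) = x"
  by (simp_all add: vec_eq_iff field_simps)

lemma continuous_on_affine_scale [continuous_intros]:
  "continuous_on A f \<Longrightarrow> continuous_on A (\<lambda>x. affine_scale c v (f x))"
  unfolding affine_scale_def by (intro continuous_intros)

lemma measurable_affine_scale [measurable]: "affine_scale c v \<in> borel_measurable borel"
  by (intro borel_measurable_continuous_onI continuous_intros continuous_on_id)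

lemma emeasure_hausdorff_vimage:
  fixes f :: "real ^ 'n \<Rightarrow> real ^ 'n"
  assumes f: "similarity c sup_metric sup_metric f" and surj: "surj f" and s: "0 \<le> s"
    and m: "f \<in> borel_measurable borel" and A: "A \<in> sets borel"
  shows "ennreal (c powr s) * emeasure (hausdorff_measure s sup_metric) (f -` A)
    = emeasure (hausdorff_measure s sup_metric) A"
proof -
  have "f -` A \<in> sets borel" using measurable_sets[OF m A] by simp
  then show ?thesis
    using hausdorff_outer_similarity_image[OF f _ s, of "f -` A"] surj A
    by (simp add: emeasure_hausdorff_sup_metric surj_image_vimage_eq)
qed

text \<open>Up to the factor \<open>c powr s\<close> the measure is its own image under
  \<open>f\<close>, which turns the scaling of measures into a change of variables.\<close>

lemma nn_integral_hausdorff_similarity: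
  fixes f :: "real ^ 'n \<Rightarrow> real ^ 'n" and g :: "real ^ 'n \<Rightarrow> ennreal"
  assumes f: "similarity c sup_metric sup_metric f" and surj: "surj f" and s: "0 \<le> s"
    and m: "f \<in> borel_measurable borel" and g: "g \<in> borel_measurable borel"
  shows "ennreal (c powr s) * (\<integral>\<^sup>+x. g (f x) \<partial>hausdorff_measure s sup_metric)
    = (\<integral>\<^sup>+x. g x \<partial>hausdorff_measure s sup_metric)"
proof -
  let ?H = "hausdorff_measure s (sup_metric :: (real ^ 'n) metric)"
  have mH: "f \<in> measurable ?H borel" using m by simp
  have gB: "g \<in> borel_measurable (distr ?H borel f)" using g by simp
  have eq: "scale_measure (ennreal (c powr s)) (distr ?H borel f) = ?H"
  proof (rule measure_eqI)
    fix A assume "A \<in> sets (scale_measure (ennreal (c powr s)) (distr ?H borel f))"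
    then have A: "A \<in> sets borel" by simp
    then show "emeasure (scale_measure (ennreal (c powr s)) (distr ?H borel f)) A = emeasure ?H A"
      using emeasure_hausdorff_vimage[OF f surj s m A] by (simp add: emeasure_distr[OF mH])
  qed simp
  have "(\<integral>\<^sup>+x. g x \<partial>?H) = (\<integral>\<^sup>+x. g x \<partial>scale_measure (ennreal (c powr s)) (distr ?H borel f))"
    by (simp only: eq)
  also have "\<dots> = ennreal (c powr s) * (\<integral>\<^sup>+x. g (f x) \<partial>?H)"
    using g by (simp add: nn_integral_scale_measure[OF gB] nn_integral_distr[OF mH])
  finally show ?thesis by simp
qed

lemma surj_affine_scale: "c \<noteq> 0 \<Longrightarrow> surj (affine_scale c v)"
  by (metis affine_scale_inverse(2) surjI)

lemma nn_integral_hausdorff_affine_scale: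
  fixes g :: "real ^ 'n \<Rightarrow> ennreal"
  assumes "0 < c" "0 \<le> s" "g \<in> borel_measurable borel"
  shows "ennreal (c powr s) * (\<integral>\<^sup>+x. g (affine_scale c v x) \<partial>hausdorff_measure s sup_metric)
    = (\<integral>\<^sup>+x. g x \<partial>hausdorff_measure s sup_metric)"
  using assms by (intro nn_integral_hausdorff_similarity similarity_affine_scale surj_affine_scale) auto

lemma ediam_sup_metric_le:
  assumes "\<And>x y. x \<in> A \<Longrightarrow> y \<in> A \<Longrightarrow> mdist sup_metric x y \<le> r"
  shows "ediam sup_metric A \<le> ennreal r"
  unfolding ediam_def using assms by (auto intro!: SUP_least ennreal_leI)


section \<open>Integer vectors\<close>

definition int_vecs :: "(real ^ 'n) set" where
  "int_vecs = {v. \<forall>k. v $ k \<in> \<int>}"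

lemma int_vecs_diff: "v \<in> int_vecs \<Longrightarrow> w \<in> int_vecs \<Longrightarrow> v - w \<in> int_vecs"
  by (auto simp: int_vecs_def)

text \<open>Rounding down embeds the vectors in a product of integer intervals, from the ceiling of
  \<open>a $ k\<close> to the floor of \<open>a $ k + m\<close>; each has at most
  \<open>m + 1\<close> elements.\<close>

lemma card_int_vecs_box:
  fixes a :: "real ^ 'n"
  assumes A: "A \<subseteq> int_vecs" "\<And>v k. v \<in> A \<Longrightarrow> a $ k \<le> v $ k \<and> v $ k \<le> a $ k + real m"
  shows "finite A \<and> card A \<le> (m + 1) ^ CARD('n)"
proof -
  define B where "B = (\<Pi>\<^sub>E k\<in>(UNIV :: 'n set). {\<lceil>a $ k\<rceil>..\<lfloor>a $ k + real m\<rfloor>})"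
  define f where "f v = (\<lambda>k. \<lfloor>v $ k\<rfloor>)" for v :: "real ^ 'n"
  have fin: "finite B"
    unfolding B_def by (intro finite_PiE) auto
  have "card B = (\<Prod>k\<in>(UNIV :: 'n set). card {\<lceil>a $ k\<rceil>..\<lfloor>a $ k + real m\<rfloor>})"
    unfolding B_def by (simp add: card_PiE)
  also have "\<dots> \<le> (\<Prod>k\<in>(UNIV :: 'n set). m + 1)"
  proof (intro prod_mono conjI)
    fix k :: 'n
    have "\<lfloor>a $ k\<rfloor> + int m - \<lceil>a $ k\<rceil> \<le> int m" by linarith
    then show "card {\<lceil>a $ k\<rceil>..\<lfloor>a $ k + real m\<rfloor>} \<le> m + 1" by (simp add: nat_le_iff)
  qed simp
  finally have card: "card B \<le> (m + 1) ^ CARD('n)" by simp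
  have inj: "inj_on f A"
  proof (rule inj_onI)
    fix v w assume vw: "v \<in> A" "w \<in> A" "f v = f w"
    have "v $ k = w $ k" for k
    proof -
      have "v $ k \<in> \<int>" "w $ k \<in> \<int>"
        using vw A by (auto simp: int_vecs_def)
      moreover have "\<lfloor>v $ k\<rfloor> = \<lfloor>w $ k\<rfloor>"
        using fun_cong[OF vw(3), of k] by (simp add: f_def)
      ultimately show ?thesis by (metis floor_of_int Ints_cases)
    qed
    then show "v = w" by (simp add: vec_eq_iff)
  qed
  have "f ` A \<subseteq> B"
  proof
    fix g assume "g \<in> f ` A"
    then obtain v where v: "v \<in> A" "g = f v" by blast
    have "\<lceil>a $ k\<rceil> \<le> \<lfloor>v $ k\<rfloor> \<and> \<lfloor>v $ k\<rfloor> \<le> \<lfloor>a $ k + real m\<rfloor>" for k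
    proof -
      have "v $ k \<in> \<int>" using v A by (auto simp: int_vecs_def)
      then obtain z where "v $ k = of_int z" by (auto elim: Ints_cases)
      then show ?thesis using A(2)[OF v(1), of k] by (simp add: ceiling_le_iff le_floor_iff ) linarith
    qed
    then show "g \<in> B" using v by (auto simp: B_def f_def)
  qed
  then show ?thesis
    using fin card inj by (metis card_inj_on_le finite_imageD finite_subset le_trans)
qed

section \<open>Cells of a self-similar carpet\<close>

definition real_vec :: "nat ^ 'n \<Rightarrow> real ^ 'n" where
  "real_vec j = (\<chi> k. real (j $ k))"

lemma real_vec_nth [simp]: "real_vec j $ k = real (j $ k)"
  by (simp add: real_vec_def)

lemma inj_real_vec: "inj real_vec"
  by (auto simp: inj_def vec_eq_iff)

text \<open>The cells of level \<open>n\<close> are the sets \<open>(K + v) / l\<^sup>n\<close>, where \<open>v\<close> ranges over \<open>cell_vecs l S n\<close>.\<close>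

primrec cell_vecs :: "nat \<Rightarrow> (nat ^ 'n) set \<Rightarrow> nat \<Rightarrow> (real ^ 'n) set" where
  "cell_vecs l S 0 = {0}"
| "cell_vecs l S (Suc n) = (\<lambda>(v, j). real l *\<^sub>R v + real_vec j) ` (cell_vecs l S n \<times> S)"

lemma carpet_map_eq: "carpet_map l j = affine_scale (1 / real l) (real_vec j)"
  by (rule ext) (simp add: carpet_map_def vec_eq_iff field_simps add_divide_distrib)

locale carpet =
  fixes l :: nat and S :: "(nat ^ 'n) set" and K :: "(real ^ 'n) set"
  assumes gsc: "generalized_sierpinski_carpet l S K"
begin

abbreviation "V \<equiv> cell_vecs l S"
abbreviation "cell n \<equiv> affine_scale (1 / real l ^ n)"

lemma l3: "3 \<le> l" and S_sub: "S \<subset> {j. \<forall>k. j $ k < l}"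
  and K_compact: "compact K" and K_ne: "K \<noteq> {}" and K_eq: "K = (\<Union>j\<in>S. carpet_map l j ` K)"
  and symm: "\<And>f. (\<And>x y. dist (f x) (f y) = dist x y) \<Longrightarrow> f ` unit_cube = unit_cube \<Longrightarrow>
      f ` carpet_level1 l S = carpet_level1 l S"
  using gsc unfolding generalized_sierpinski_carpet_def by blast+

lemma l_pos [simp]: "0 < l" and l_ne_0 [simp]: "l \<noteq> 0" using l3 by simp_all

lemma S_less: "j \<in> S \<Longrightarrow> j $ k < l"
  using S_sub by blast

lemma finite_S: "finite S"
proof -
  have "real_vec ` S \<subseteq> int_vecs" by (auto simp: int_vecs_def)
  moreover have "(0 :: real ^ 'n) $ k \<le> v $ k \<and> v $ k \<le> (0 :: real ^ 'n) $ k + real l"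
    if "v \<in> real_vec ` S" for v k
    using that S_less by (force intro: less_imp_le)
  ultimately have "finite (real_vec ` S)"
    using card_int_vecs_box[of "real_vec ` S" 0 l] by blast
  then show ?thesis
    using inj_real_vec finite_imageD inj_on_subset by blast
qed

lemma K_closed: "closed K" using K_compact by (rule compact_imp_closed)
lemma K_borel [measurable, simp]: "K \<in> sets borel" using K_closed by (rule borel_closed)

text \<open>At a point of \<open>K\<close> where coordinate \<open>k\<close> is extremal,
  self-similarity expresses this coordinate through that of another point of \<open>K\<close>, which
  cannot be more extreme. This forces the extremal values into the unit interval.\<close>

lemma K_sub_cube: "K \<subseteq> unit_cube"
proof
  fix x assume x: "x \<in> K"
  have "x $ k \<le> 1" for k
  proof -
    have "continuous_on K (\<lambda>x. x $ k)" by (intro continuous_intros)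
    from continuous_attains_sup[OF K_compact K_ne this]
    obtain m where m: "m \<in> K" "\<forall>y\<in>K. y $ k \<le> m $ k" by blast
    obtain j y where jy: "j \<in> S" "y \<in> K" "m = carpet_map l j y"
      using subsetD[OF equalityD1[OF K_eq] m(1)] by auto
    have "real (j $ k) \<le> real l - 1" using S_less[OF jy(1), of k] by simp
    moreover have "real l * m $ k = y $ k + real (j $ k)"
      using jy(3) by (simp add: carpet_map_def add_divide_distrib[symmetric])
    moreover have "y $ k \<le> m $ k" using m(2) jy(2) by blast
    ultimately have "real l * m $ k \<le> m $ k + real l - 1" by linarith
    then have "(real l - 1) * (m $ k - 1) \<le> 0" by (simp add: algebra_simps)
    then have "m $ k \<le> 1" using l3 by (simp add: mult_le_0_iff)
    then show ?thesis using m x by force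
  qed
  moreover have "0 \<le> x $ k" for k
  proof -
    have "continuous_on K (\<lambda>x. x $ k)" by (intro continuous_intros)
    from continuous_attains_inf[OF K_compact K_ne this]
    obtain m where m: "m \<in> K" "\<forall>y\<in>K. m $ k \<le> y $ k" by blast
    obtain j y where jy: "j \<in> S" "y \<in> K" "m = carpet_map l j y"
      using subsetD[OF equalityD1[OF K_eq] m(1)] by auto
    have "m $ k \<le> y $ k" using m jy by blast
    moreover have "real l * m $ k = y $ k + real (j $ k)"
      using jy(3) by (simp add: carpet_map_def add_divide_distrib[symmetric])
    ultimately have "m $ k \<le> real l * m $ k" by linarith
    then have "0 \<le> (real l - 1) * m $ k" by (simp add: algebra_simps)
    then have "0 \<le> m $ k" using l3 by (simp add: zero_le_mult_iff)
    then show ?thesis using m x by force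
  qed
  ultimately show "x \<in> unit_cube" by (simp add: unit_cube_def)
qed

lemma K_nth: "x \<in> K \<Longrightarrow> 0 \<le> x $ k" "x \<in> K \<Longrightarrow> x $ k \<le> 1"
  using K_sub_cube by (auto simp: unit_cube_def)

lemma cell_cell: "cell n v (cell 1 w x) = cell (Suc n) (real l *\<^sub>R v + w) x"
  by (simp add: vec_eq_iff field_simps)

lemma K_eq_cell1: "(\<Union>j\<in>S. cell 1 (real_vec j) ` K) = K"
  using K_eq unfolding carpet_map_eq by simp

lemma K_eq_cells: "K = (\<Union>v\<in>V n. cell n v ` K)"
proof (induction n)
  case 0
  have "affine_scale 1 0 = (\<lambda>x :: real ^ 'n. x)" by (simp add: affine_scale_def fun_eq_iff)
  then show ?case by simp
next
  case (Suc n)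
  have "(\<Union>v\<in>V (Suc n). cell (Suc n) v ` K) = (\<Union>v\<in>V n. \<Union>j\<in>S. cell (Suc n) (real l *\<^sub>R v + real_vec j) ` K)"
    by auto
  also have "\<dots> = (\<Union>v\<in>V n. cell n v ` (\<Union>j\<in>S. cell 1 (real_vec j) ` K))"
    by (simp only: image_UN image_image cell_cell)
  also have "\<dots> = (\<Union>v\<in>V n. cell n v ` K)"
    by (simp only: K_eq_cell1)
  finally show ?case using Suc by simp
qed

lemma V_int_vecs: "V n \<subseteq> int_vecs"
  by (induction n) (auto simp: int_vecs_def)

lemma V_bounds: "v \<in> V n \<Longrightarrow> 0 \<le> v $ k \<and> v $ k \<le> real l ^ n - 1"
proof (induction n arbitrary: v)
  case (Suc n)
  then obtain w j where w: "w \<in> V n" "j \<in> S" "v = real l *\<^sub>R w + real_vec j" by auto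
  have "real (j $ k) \<le> real l - 1" using S_less[OF w(2), of k] by simp
  moreover have "real l * w $ k \<le> real l * (real l ^ n - 1)"
    using Suc.IH[OF w(1)] by (intro mult_left_mono) auto
  ultimately show ?case using Suc.IH[OF w(1)] w(3) by (simp add: algebra_simps)
qed simp

lemma finite_V: "finite (V n)"
  by (induction n) (auto simp: finite_S)

text \<open>Digits in base \<open>l\<close> are unique: reduction modulo \<open>l\<close> recovers
  \<open>j\<close>, because its entries are less than \<open>l\<close>.\<close>

lemma card_V: "card (V n) = card S ^ n"
proof (induction n)
  case (Suc n)
  have "inj_on (\<lambda>(v, j). real l *\<^sub>R v + real_vec j) (V n \<times> S)"
  proof (rule inj_onI, clarify)
    fix v j v' j' assume *: "v \<in> V n" "j \<in> S" "v' \<in> V n" "j' \<in> S"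
      "real l *\<^sub>R v + real_vec j = real l *\<^sub>R v' + real_vec j'"
    have "v $ k = v' $ k \<and> j $ k = j' $ k" for k
    proof -
      have "v $ k \<in> \<int>" "v' $ k \<in> \<int>" using *(1,3) V_int_vecs by (auto simp: int_vecs_def)
      then obtain a b where ab: "v $ k = of_int a" "v' $ k = of_int b" by (auto elim!: Ints_cases)
      have "(real l *\<^sub>R v + real_vec j) $ k = (real l *\<^sub>R v' + real_vec j') $ k" using *(5) by simp
      then have "real_of_int (int l * a + int (j $ k)) = real_of_int (int l * b + int (j' $ k))"
        using ab by simp
      then have eq: "int l * a + int (j $ k) = int l * b + int (j' $ k)" by linarith
      have "(int l * a + int (j $ k)) mod int l = int (j $ k)"
        "(int l * b + int (j' $ k)) mod int l = int (j' $ k)"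
        using S_less[OF *(2), of k] S_less[OF *(4), of k] by simp_all
      then have "j $ k = j' $ k" using eq by simp
      then show ?thesis using eq ab by simp
    qed
    then show "v = v' \<and> j = j'" by (simp add: vec_eq_iff)
  qed
  then show ?case using Suc by (simp add: card_image card_cartesian_product)
qed simp

text \<open>Concatenation of addresses: a cell of level \<open>m + n\<close> is a cell of level
  \<open>n\<close> inside one of level \<open>m\<close>, and \<open>l^n\<close> shifts the digits of
  the coarse cell.\<close>

lemma V_add: "V (m + n) = (\<lambda>(v, w). real l ^ n *\<^sub>R v + w) ` (V m \<times> V n)"
proof (induction n)
  case (Suc n)
  have "V (m + Suc n) = (\<lambda>(v, j). real l *\<^sub>R v + real_vec j) `
      ((\<lambda>(v, w). real l ^ n *\<^sub>R v + w) ` (V m \<times> V n) \<times> S)"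
    by (simp add: Suc)
  also have "\<dots> = (\<lambda>(v, w). real l ^ Suc n *\<^sub>R v + w) ` (V m \<times> V (Suc n))"
  proof -
    have eq: "real l *\<^sub>R (real l ^ n *\<^sub>R v + w) + real_vec j = real l ^ Suc n *\<^sub>R v + (real l *\<^sub>R w + real_vec j)"
      for v w :: "real ^ 'n" and j
      by (simp add: scaleR_add_right add.assoc)
    have "(\<lambda>(v, j). real l *\<^sub>R v + real_vec j) ` ((\<lambda>(v, w). real l ^ n *\<^sub>R v + w) ` (V m \<times> V n) \<times> S)
      = (\<Union>v\<in>V m. \<Union>w\<in>V n. \<Union>j\<in>S. {real l *\<^sub>R (real l ^ n *\<^sub>R v + w) + real_vec j})"
      by auto
    also have "\<dots> = (\<Union>v\<in>V m. \<Union>w\<in>V n. \<Union>j\<in>S. {real l ^ Suc n *\<^sub>R v + (real l *\<^sub>R w + real_vec j)})"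
      by (simp only: eq)
    also have "\<dots> = (\<lambda>(v, w). real l ^ Suc n *\<^sub>R v + w) ` (V m \<times> V (Suc n))"
      by (auto simp del: power_Suc)
    finally show ?thesis .
  qed
  finally show ?case .
qed force

lemma cell_in_K: "v \<in> V n \<Longrightarrow> y \<in> K \<Longrightarrow> cell n v y \<in> K"
  using K_eq_cells[of n] by blast

lemma K_sup_dist: "x \<in> K \<Longrightarrow> y \<in> K \<Longrightarrow> mdist sup_metric x y \<le> 1"
proof -
  assume "x \<in> K" "y \<in> K"
  then have "\<bar>x $ k - y $ k\<bar> \<le> 1" for k
    using K_nth[of x k] K_nth[of y k] by linarith
  then show ?thesis by (simp add: sup_dist_le_iff)
qed

text \<open>Invariance of \<open>Q\<^sub>1\<close> under a map that permutes the level-one subcubes of \<open>Q\<^sub>0\<close> passes on to \<open>S\<close>,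
  because a subcube in \<open>Q\<^sub>1\<close> has its midpoint in no other subcube.\<close>

lemma in_S_if_midpoint:
  assumes "cell 1 (real_vec j) (\<chi> k. 1/2) \<in> carpet_level1 l S"
  shows "j \<in> S"
proof -
  obtain j' y where j': "j' \<in> S" "y \<in> unit_cube" "cell 1 (real_vec j) (\<chi> k. 1/2) = cell 1 (real_vec j') y"
    using assms by (auto simp: carpet_level1_def carpet_map_eq)
  have "j $ k = j' $ k" for k
  proof -
    have "1/2 + real (j $ k) = y $ k + real (j' $ k)"
      using arg_cong[OF j'(3), of "\<lambda>x. x $ k"] by simp
    moreover have "0 \<le> y $ k" "y $ k \<le> 1" using j'(2) by (auto simp: unit_cube_def)
    ultimately have "\<bar>real (j $ k) - real (j' $ k)\<bar> < 1" by linarith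
    then show ?thesis by linarith
  qed
  then have "j = j'" by (simp add: vec_eq_iff)
  then show ?thesis using j'(1) by simp
qed

text \<open>The midpoint of subcube \<open>j\<close> goes to the midpoint of subcube
  \<open>fh j\<close>, and a midpoint detects its subcube.\<close>

lemma symm_S:
  assumes iso: "\<And>x y. dist (f x) (f y) = dist x y" and cube: "f ` unit_cube = unit_cube"
    and comm: "\<And>j x. j \<in> S \<Longrightarrow> f (cell 1 (real_vec j) x) = cell 1 (real_vec (fh j)) (f x)"
    and mid: "f (\<chi> k. 1/2) = (\<chi> k. 1/2)" and j: "j \<in> S"
  shows "fh j \<in> S"
proof (rule in_S_if_midpoint)
  have "(\<chi> k. 1/2) \<in> (unit_cube :: (real ^ 'n) set)" by (simp add: unit_cube_def)
  then have "cell 1 (real_vec j) (\<chi> k. 1/2) \<in> carpet_level1 l S"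
    using j by (auto simp: carpet_level1_def carpet_map_eq)
  then have "f (cell 1 (real_vec j) (\<chi> k. 1/2)) \<in> carpet_level1 l S"
    using symm[OF iso cube] by blast
  then show "cell 1 (real_vec (fh j)) (\<chi> k. 1/2) \<in> carpet_level1 l S"
    using comm[OF j] mid by simp
qed

text \<open>The cube of level \<open>n\<close> with an address in \<open>V n\<close> contains a cell
  of \<open>K\<close>, so \<open>x\<close> is at distance of order \<open>1 / l^n\<close> from
  \<open>K\<close>, which is closed.\<close>

lemma near_cells_imp_in_K:
  assumes "\<And>n. \<exists>v\<in>V n. \<exists>y\<in>unit_cube. x = cell n v y"
  shows "x \<in> K"
proof -
  obtain z where z: "z \<in> K" using K_ne by blast
  have "x \<in> closure K"
    unfolding closure_approachable
  proof (intro allI impI)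
    fix e :: real assume e: "0 < e"
    have "(\<lambda>n. real CARD('n) * (1 / real l) ^ n) \<longlonglongrightarrow> real CARD('n) * 0"
      using l3 by (intro tendsto_intros LIMSEQ_realpow_zero) auto
    then have "\<forall>\<^sub>F n in sequentially. real CARD('n) * (1 / real l) ^ n < e"
      using e by (auto simp: order_tendsto_iff)
    then obtain n where n: "real CARD('n) * (1 / real l) ^ n < e"
      by (auto simp: eventually_sequentially)
    obtain v y where vy: "v \<in> V n" "y \<in> unit_cube" "x = cell n v y" using assms by blast
    have "\<bar>z $ k - y $ k\<bar> \<le> 1" for k
    proof -
      have "0 \<le> y $ k" "y $ k \<le> 1" using vy(2) by (auto simp: unit_cube_def)
      then show ?thesis using K_nth[OF z, of k] by linarith
    qed
    then have "mdist sup_metric z y \<le> 1" by (simp add: sup_dist_le_iff)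
    then have "mdist sup_metric (cell n v z) x \<le> 1 / real l ^ n * 1"
      unfolding vy(3) by (subst sup_dist_affine_scale) (auto intro!: divide_right_mono)
    then have "dist (cell n v z) x \<le> real CARD('n) * (1 / real l ^ n)"
      using dist_le_sup_dist[of "cell n v z" x]
      by (smt (verit) mult_left_mono of_nat_0_le_iff)
    then have "dist (cell n v z) x < e"
      using n by (simp add: power_divide)
    then show "\<exists>y\<in>K. dist y x < e" using cell_in_K[OF vy(1) z] by blast
  qed
  then show ?thesis using K_closed by simp
qed

text \<open>On addresses \<open>f\<close> acts digit by digit through \<open>fh\<close>, which
  preserves \<open>S\<close>; hence every point of the image lies in an addressed cube of each
  level.\<close>

lemma symm_K_subset:
  assumes iso: "\<And>x y. dist (f x) (f y) = dist x y" and cube: "f ` unit_cube = unit_cube"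
    and comm: "\<And>j x. j \<in> S \<Longrightarrow> f (cell 1 (real_vec j) x) = cell 1 (real_vec (fh j)) (f x)"
    and mid: "f (\<chi> k. 1/2) = (\<chi> k. 1/2)"
  shows "f ` K \<subseteq> K"
proof
  fix x assume x: "x \<in> f ` K"
  show "x \<in> K"
  proof (rule near_cells_imp_in_K)
    fix n
    have "\<exists>v\<in>V n. \<exists>y\<in>f ` K. x = cell n v y"
    proof (induction n)
      case 0
      then show ?case using x by (auto simp: affine_scale_def)
    next
      case (Suc n)
      then obtain v y where v: "v \<in> V n" "y \<in> K" "x = cell n v (f y)" by blast
      then obtain j z where j: "j \<in> S" "z \<in> K" "y = cell 1 (real_vec j) z"
        using K_eq_cell1 by blast
      have "x = cell (Suc n) (real l *\<^sub>R v + real_vec (fh j)) (f z)"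
        by (simp only: v(3) j(3) comm[OF j(1)] cell_cell)
      moreover have "real l *\<^sub>R v + real_vec (fh j) \<in> V (Suc n)"
        using v(1) symm_S[OF iso cube comm mid j(1)] by auto
      ultimately show ?case using j(2) by blast
    qed
    then show "\<exists>v\<in>V n. \<exists>y\<in>unit_cube. x = cell n v y"
      using K_sub_cube cube by blast
  qed
qed

section \<open>Reflections and coordinate transpositions\<close>

definition refl1 :: "'n \<Rightarrow> real ^ 'n \<Rightarrow> real ^ 'n" where
  "refl1 k x = (\<chi> i. if i = k then 1 - x $ i else x $ i)"

definition swap1 :: "'n \<Rightarrow> 'n \<Rightarrow> real ^ 'n \<Rightarrow> real ^ 'n" where
  "swap1 a b x = (\<chi> i. x $ Transposition.transpose a b i)"

lemma refl1_nth [simp]: "refl1 k x $ i = (if i = k then 1 - x $ i else x $ i)"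
  by (simp add: refl1_def)

lemma swap1_nth [simp]: "swap1 a b x $ i = x $ Transposition.transpose a b i"
  by (simp add: swap1_def)

lemma refl1_refl1 [simp]: "refl1 k (refl1 k x) = x" and swap1_swap1 [simp]: "swap1 a b (swap1 a b x) = x"
  by (simp_all add: vec_eq_iff)

lemma involution_image_unit_cube:
  assumes "\<And>x. f (f x) = x" "\<And>x. x \<in> unit_cube \<Longrightarrow> f x \<in> unit_cube"
  shows "f ` unit_cube = unit_cube"
proof
  show "unit_cube \<subseteq> f ` unit_cube"
    using assms by (metis image_eqI subsetI)
qed (use assms in auto)

text \<open>An involution that maps \<open>K\<close> into itself maps it onto itself.\<close>

lemma refl1_K: "refl1 k ` K = K"
proof -
  have "refl1 k ` K \<subseteq> K"
  proof (rule symm_K_subset[where fh = "\<lambda>j. \<chi> i. if i = k then l - 1 - j $ i else j $ i"])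
    show "dist (refl1 k x) (refl1 k y) = dist x y" for x y
      unfolding dist_vec_def by (intro L2_set_cong refl) (auto simp: dist_real_def)
    show "refl1 k ` unit_cube = unit_cube"
      by (rule involution_image_unit_cube) (auto simp: unit_cube_def)
    show "refl1 k (cell 1 (real_vec j) x) = cell 1 (real_vec (\<chi> i. if i = k then l - 1 - j $ i else j $ i)) (refl1 k x)"
      if "j \<in> S" for j x
    proof -
      have "real (l - 1 - j $ k) = real l - 1 - real (j $ k)"
        using S_less[OF that, of k] by linarith
      then show ?thesis by (simp add: vec_eq_iff field_simps)
    qed
  qed (simp add: vec_eq_iff)
  moreover from this have "refl1 k ` (refl1 k ` K) \<subseteq> refl1 k ` K" by (rule image_mono)
  ultimately show ?thesis by (simp add: image_image)
qed

lemma swap1_K: "swap1 a b ` K = K"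
proof -
  have "swap1 a b ` K \<subseteq> K"
  proof (rule symm_K_subset[where fh = "\<lambda>j. \<chi> i. j $ Transposition.transpose a b i"])
    show "dist (swap1 a b x) (swap1 a b y) = dist x y" for x y
    proof -
      have "(\<Sum>i\<in>UNIV. (dist (x $ Transposition.transpose a b i) (y $ Transposition.transpose a b i))\<^sup>2)
        = (\<Sum>i\<in>UNIV. (dist (x $ i) (y $ i))\<^sup>2)"
        by (rule sum.reindex_bij_betw[where g = "\<lambda>i. (dist (x $ i) (y $ i))\<^sup>2"]) simp
      then show ?thesis by (simp add: dist_vec_def L2_set_def)
    qed
    show "swap1 a b ` unit_cube = unit_cube"
      by (rule involution_image_unit_cube) (auto simp: unit_cube_def)
  qed (simp_all add: vec_eq_iff)
  moreover from this have "swap1 a b ` (swap1 a b ` K) \<subseteq> swap1 a b ` K" by (rule image_mono)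
  ultimately show ?thesis by (simp add: image_image)
qed

text \<open>The origin lies on the edge contained in \<open>carpet_level1 l S\<close>, and among the
  subcubes only that of index \<open>0\<close> contains it. The point reflection in the centre of
  the cube carries this subcube to the opposite corner.\<close>

lemma zero_S: "0 \<in> S" and one_S: "(\<chi> k. l - 1) \<in> S"
proof -
  obtain k0 where k0: "{x. 0 \<le> x $ k0 \<and> x $ k0 \<le> 1 \<and> (\<forall>k. k \<noteq> k0 \<longrightarrow> x $ k = 0)} \<subseteq> carpet_level1 l S"
    using gsc unfolding generalized_sierpinski_carpet_def by blast
  then have "0 \<in> carpet_level1 l S" by (simp add: subset_iff)
  then obtain j y where jy: "j \<in> S" "y \<in> unit_cube" "0 = cell 1 (real_vec j) y"
    by (auto simp: carpet_level1_def carpet_map_eq)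
  have "j $ k = 0" for k
  proof -
    have "y $ k + real (j $ k) = 0" using arg_cong[OF jy(3), of "\<lambda>x. x $ k"] by simp
    moreover have "0 \<le> y $ k" using jy(2) by (simp add: unit_cube_def)
    ultimately show ?thesis by linarith
  qed
  then have "j = 0" by (simp add: vec_eq_iff)
  then show 0: "0 \<in> S" using jy(1) by simp
  have "(\<chi> k. l - 1 - (0 :: nat ^ 'n) $ k) \<in> S"
  proof (rule symm_S[where f = "\<lambda>x. \<chi> k. 1 - x $ k" and fh = "\<lambda>j. \<chi> k. l - 1 - j $ k"])
    show "dist (\<chi> k. 1 - x $ k) (\<chi> k. 1 - y $ k) = dist x y" for x y :: "real ^ 'n"
      unfolding dist_vec_def by (intro L2_set_cong refl) (auto simp: dist_real_def)
    show "(\<lambda>x :: real ^ 'n. \<chi> k. 1 - x $ k) ` unit_cube = unit_cube"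
      by (rule involution_image_unit_cube) (auto simp: unit_cube_def vec_eq_iff)
    show "(\<chi> k. 1 - cell 1 (real_vec j) x $ k) = cell 1 (real_vec (\<chi> k. l - 1 - j $ k)) (\<chi> k. 1 - x $ k)"
      if "j \<in> S" for j x
    proof -
      have "real (l - 1 - j $ k) = real l - 1 - real (j $ k)" for k
        using S_less[OF that, of k] by linarith
      then show ?thesis by (simp add: vec_eq_iff field_simps)
    qed
    show "(\<chi> k. 1 - (\<chi> k. 1/2) $ k) = ((\<chi> k. 1/2) :: real ^ 'n)" by (simp add: vec_eq_iff)
  qed (rule 0)
  then show "(\<chi> k. l - 1) \<in> S" by simp
qed

text \<open>Two opposite corner cells are distinct. This makes the dimension positive.\<close>

lemma card_S: "2 \<le> card S"
proof -
  have "(\<chi> k. l - 1) \<noteq> (0 :: nat ^ 'n)" using l3 by (auto simp: vec_eq_iff)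
  then have "card {0, (\<chi> k. l - 1) :: nat ^ 'n} = 2" by (subst card_2_iff) blast
  moreover have "card {0, (\<chi> k. l - 1) :: nat ^ 'n} \<le> card S"
    using zero_S one_S finite_S by (intro card_mono) auto
  ultimately show ?thesis by simp
qed

text \<open>The far corner of the cell at the origin: a point of \<open>K\<close> in the open cube,
  around which a bump fits inside the cube.\<close>

lemma corner_in_K: "(\<chi> k. 1 / real l) \<in> K"
proof -
  have "(1 :: real ^ 'n) \<in> K"
  proof (rule near_cells_imp_in_K)
    fix n
    \<comment> \<open>The address all of whose digits are \<open>l - 1\<close>; its cubes shrink to
      the far corner of the unit cube.\<close>
    have "(\<chi> k. real l ^ n - 1) \<in> V n"
    proof (induction n)
      case (Suc n)
      have "(\<chi> k. real l ^ Suc n - 1) = real l *\<^sub>R (\<chi> k. real l ^ n - 1) + real_vec (\<chi> k. l - 1)"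
        using l3 by (simp add: vec_eq_iff right_diff_distrib of_nat_diff)
      then show ?case
        unfolding cell_vecs.simps using Suc one_S
        by (intro image_eqI[of _ _ "(\<chi> k. real l ^ n - 1, \<chi> k. l - 1)"]) auto
    qed (simp add: vec_eq_iff)
    then show "\<exists>v\<in>V n. \<exists>y\<in>unit_cube. 1 = cell n v y"
      by (intro bexI[of _ "\<chi> k. real l ^ n - 1"] bexI[of _ 1]) (auto simp: vec_eq_iff unit_cube_def)
  qed
  then have "cell 1 (real_vec 0) 1 \<in> K"
    using K_eq_cell1 zero_S by blast
  moreover have "cell 1 (real_vec 0) (1 :: real ^ 'n) = (\<chi> k. 1 / real l)"
    by (simp add: vec_eq_iff)
  ultimately show ?thesis by simp
qed

text \<open>The midpoint of a missing subcube. Half the side of a subcube,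
  \<open>1 / (2 * l)\<close>, separates it in the maximum metric from all other subcubes and from
  the boundary of the cube.\<close>

lemma hole: "\<exists>y. (\<forall>k. 1 / (2 * real l) \<le> y $ k \<and> y $ k \<le> 1 - 1 / (2 * real l)) \<and>
    (\<forall>x\<in>K. 1 / (2 * real l) \<le> mdist sup_metric x y)"
proof -
  obtain j where j: "\<And>k. j $ k < l" "j \<notin> S" using S_sub by blast
  define y where "y = cell 1 (real_vec j) (\<chi> k. 1/2)"
  have "1 / (2 * real l) \<le> y $ k \<and> y $ k \<le> 1 - 1 / (2 * real l)" for k
  proof -
    have "real (j $ k) \<le> real l - 1" using j(1)[of k] by simp
    then have "(1/2) / real l \<le> (1/2 + real (j $ k)) / real l"
      "(1/2 + real (j $ k)) / real l \<le> (real l - 1/2) / real l"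
      by (auto simp del: divide_divide_eq_left intro!: divide_right_mono)
    moreover have "1 / (2 * real l) = (1/2) / real l" "1 - 1 / (2 * real l) = (real l - 1/2) / real l"
      "y $ k = (1/2 + real (j $ k)) / real l"
      by (simp_all add: y_def diff_divide_distrib)
    ultimately show ?thesis by (simp only:)
  qed
  moreover have "1 / (2 * real l) \<le> mdist sup_metric x y" if "x \<in> K" for x
  proof -
    have "x \<in> (\<Union>j\<in>S. cell 1 (real_vec j) ` K)"
      using that by (simp only: K_eq_cell1)
    then obtain j' z where j': "j' \<in> S" "z \<in> K" "x = cell 1 (real_vec j') z"
      by blast
    then have "j' \<noteq> j" using j(2) by blast
    then obtain k where k: "j' $ k \<noteq> j $ k" by (auto simp: vec_eq_iff)
    have "1 \<le> \<bar>real (j' $ k) - real (j $ k)\<bar>" using k by linarith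
    moreover have "0 \<le> z $ k" "z $ k \<le> 1" using K_nth[OF j'(2)] by auto
    ultimately have "1/2 \<le> \<bar>(z $ k + real (j' $ k)) - (1/2 + real (j $ k))\<bar>" by linarith
    then have "1/2 / real l \<le> \<bar>(z $ k + real (j' $ k)) - (1/2 + real (j $ k))\<bar> / real l"
      by (intro divide_right_mono) auto
    also have "\<dots> = \<bar>x $ k - y $ k\<bar>"
    proof -
      have "\<bar>a - b\<bar> / real l = \<bar>a / real l - b / real l\<bar>" for a b
        by (simp add: diff_divide_distrib[symmetric] abs_divide)
      then show ?thesis by (simp add: y_def j'(3))
    qed
    finally show ?thesis using component_le_sup_dist[of x k y] by simp
  qed
  ultimately show ?thesis by blast
qed

end

section \<open>Hausdorff measure of a carpet\<close>

text \<open>The least exponent \<open>n\<close> with \<open>1 / b^n < r\<close> is positive because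
  \<open>r \<le> 1\<close>; its predecessor is \<open>m\<close>.\<close>

lemma scale_index:
  assumes "0 < r" "r \<le> 1" "1 < (b :: real)"
  shows "\<exists>m. 1 / b ^ Suc m < r \<and> r \<le> 1 / b ^ m"
proof -
  have "\<exists>n. (1 / b) ^ n < r" using assms by (intro real_arch_pow_inv) auto
  then have ex: "\<exists>n. 1 / b ^ n < r" by (simp add: power_divide)
  define n where "n = (LEAST n. 1 / b ^ n < r)"
  have n: "1 / b ^ n < r" unfolding n_def using ex by (rule LeastI_ex)
  then have "n \<noteq> 0" using assms(2) by (cases "n = 0") auto
  then obtain m where m: "n = Suc m" using not0_implies_Suc by blast
  have "\<not> 1 / b ^ m < r"
    using not_less_Least[of m "\<lambda>n. 1 / b ^ n < r"] m by (simp add: n_def)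
  then show ?thesis using n m by (intro exI[of _ m]) auto
qed

context carpet
begin

definition dimK :: real where "dimK = log (real l) (real (card S))"

abbreviation "H \<equiv> hausdorff_measure dimK (sup_metric :: (real ^ 'n) metric)"

lemma dimK_pos: "0 < dimK"
  unfolding dimK_def using l3 card_S by (intro zero_less_log_cancel_iff[THEN iffD2]) auto

lemma l_powr_dimK: "real l powr dimK = real (card S)"
  unfolding dimK_def using l3 card_S by (intro powr_log_cancel) auto

lemma cell_powr_dimK: "(1 / real l ^ n) powr dimK = 1 / real (card S) ^ n"
proof (induction n)
  case (Suc n)
  have "(1 / real l ^ Suc n) powr dimK = (1 / real l) powr dimK * (1 / real l ^ n) powr dimK"
    by (simp add: powr_mult[symmetric])
  also have "(1 / real l) powr dimK = 1 / real (card S)"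
    by (simp add: powr_divide l_powr_dimK)
  finally show ?case using Suc by simp
qed simp

section \<open>Counting the cells that meet a ball\<close>

definition near_cells :: "nat \<Rightarrow> real ^ 'n \<Rightarrow> real \<Rightarrow> (real ^ 'n) set" where
  "near_cells n a r = {v \<in> V n. \<exists>y\<in>K. mdist sup_metric a (cell n v y) < r}"

text \<open>The power of \<open>4\<close> bounds the number of cells of comparable size that meet a
  ball; the factor \<open>card S\<close> pays for rounding the radius to a power of
  \<open>1 / l\<close>.\<close>

definition near_const :: real where
  "near_const = 4 ^ CARD('n) * real (card S)"

lemma near_const_pos: "0 < near_const"
  using card_S by (simp add: near_const_def)

lemma card_near_cells_scale:
  assumes "r \<le> 1 / real l ^ m"
  shows "finite (near_cells m a r) \<and> card (near_cells m a r) \<le> 4 ^ CARD('n)"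
proof -
  have "finite (near_cells m a r) \<and> card (near_cells m a r) \<le> (3 + 1) ^ CARD('n)"
  \<comment> \<open>Each entry of \<open>l^m * a\<close> is within \<open>1\<close> of that of
    \<open>y + v\<close>, and \<open>y\<close> lies in the unit cube; so each entry of
    \<open>v\<close> is between those of \<open>l^m * a - 2\<close> and \<open>l^m * a + 1\<close>,
    an interval of length \<open>3\<close>.\<close>
  proof (rule card_int_vecs_box[where a = "real l ^ m *\<^sub>R a - (\<chi> k. 2)"])
    show "near_cells m a r \<subseteq> int_vecs" using V_int_vecs by (auto simp: near_cells_def)
    fix v k assume "v \<in> near_cells m a r"
    then obtain y where y: "y \<in> K" "mdist sup_metric a (cell m v y) < r" by (auto simp: near_cells_def)
    have "\<bar>a $ k - cell m v y $ k\<bar> < 1 / real l ^ m"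
      using component_le_sup_dist[of a k "cell m v y"] y(2) assms by linarith
    then have "real l ^ m * \<bar>a $ k - cell m v y $ k\<bar> < 1"
      by (simp add: field_simps)
    then have "\<bar>real l ^ m * (a $ k - cell m v y $ k)\<bar> < 1"
      by (simp add: abs_mult)
    then have "\<bar>real l ^ m * a $ k - (y $ k + v $ k)\<bar> < 1"
      by (simp add: right_diff_distrib)
    then show "(real l ^ m *\<^sub>R a - (\<chi> k. 2)) $ k \<le> v $ k \<and> v $ k \<le> (real l ^ m *\<^sub>R a - (\<chi> k. 2)) $ k + real 3"
      using K_nth[OF y(1), of k] by (simp add: abs_less_iff)
  qed
  then show ?thesis by simp
qed

lemma cell_add: "cell (m + n) (real l ^ n *\<^sub>R v + w) x = cell m v (cell n w x)"
  by (simp add: vec_eq_iff power_add field_simps)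

text \<open>A cell of level \<open>n\<close> near the ball lies in a near cell of level
  \<open>m\<close>, where \<open>1 / l^m\<close> is comparable to \<open>r\<close>. Those are
  boundedly many, each with \<open>card S ^ (n - m)\<close> subcells. For \<open>r > 1\<close> the
  total number of cells is a sufficient bound.\<close>

lemma card_near_cells:
  assumes r: "0 < r" and n: "1 / real l ^ n \<le> r"
  shows "real (card (near_cells n a r)) \<le> near_const * r powr dimK * real (card S) ^ n"
proof (cases "r \<le> 1")
  case False
  have "card (near_cells n a r) \<le> card S ^ n"
    unfolding card_V[symmetric] by (rule card_mono[OF finite_V]) (auto simp: near_cells_def)
  then have "real (card (near_cells n a r)) \<le> 1 * real (card S) ^ n"
    using of_nat_mono by fastforce
  also have "\<dots> \<le> (near_const * r powr dimK) * real (card S) ^ n"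
  proof (rule mult_right_mono)
    have "1 * 1 \<le> near_const"
      unfolding near_const_def using card_S by (intro mult_mono) auto
    moreover have "1 \<le> r powr dimK"
      using False dimK_pos ge_one_powr_ge_zero[of r dimK] by auto
    ultimately have "1 * 1 \<le> near_const * r powr dimK" by (intro mult_mono) auto
    then show "1 \<le> near_const * r powr dimK" by simp
  qed simp
  finally show ?thesis .
next
  case True
  obtain m where m: "1 / real l ^ Suc m < r" "r \<le> 1 / real l ^ m"
    using scale_index[OF r True, of "real l"] l3 by auto
  have "1 / real l ^ n \<le> 1 / real l ^ m" using n m by linarith
  then have "real l ^ m \<le> real l ^ n" by (simp add: field_simps)
  then have mn: "m \<le> n" using l3 by (simp add: power_increasing_iff)
  then obtain q where q: "n = m + q" using le_Suc_ex by blast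
  have "near_cells n a r \<subseteq> (\<lambda>(v, w). real l ^ q *\<^sub>R v + w) ` (near_cells m a r \<times> V q)"
  proof
    fix u assume u: "u \<in> near_cells n a r"
    then obtain y where y: "u \<in> V n" "y \<in> K" "mdist sup_metric a (cell n u y) < r"
      by (auto simp: near_cells_def)
    then obtain v w where vw: "v \<in> V m" "w \<in> V q" "u = real l ^ q *\<^sub>R v + w"
      using V_add[of m q] q by auto
    have "cell n u y = cell m v (cell q w y)" unfolding vw(3) q by (rule cell_add)
    then have "v \<in> near_cells m a r"
      using y(3) vw(1) cell_in_K[OF vw(2) y(2)] by (auto simp: near_cells_def)
    then show "u \<in> (\<lambda>(v, w). real l ^ q *\<^sub>R v + w) ` (near_cells m a r \<times> V q)"
      using vw by force
  qed
  then have "card (near_cells n a r) \<le> card (near_cells m a r \<times> V q)"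
    using card_near_cells_scale[OF m(2), of a] finite_V
    by (meson card_image_le card_mono finite_SigmaI finite_imageI le_trans)
  also have "\<dots> \<le> 4 ^ CARD('n) * card S ^ q"
    using card_near_cells_scale[OF m(2), of a] by (simp add: card_cartesian_product card_V)
  finally have "real (card (near_cells n a r)) \<le> real (4 ^ CARD('n) * card S ^ q)"
    by (rule of_nat_mono)
  also have "\<dots> = 4 ^ CARD('n) * real (card S) ^ q" by simp
  also have "\<dots> = near_const * (1 / real l ^ Suc m) powr dimK * real (card S) ^ n"
    using card_S by (simp only: cell_powr_dimK) (simp add: near_const_def q power_add)
  also have "\<dots> \<le> near_const * r powr dimK * real (card S) ^ n"
    using m(1) dimK_pos near_const_pos
    by (intro mult_right_mono mult_left_mono powr_mono2) auto
  finally show ?thesis .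
qed

section \<open>Positive and finite Hausdorff measure\<close>

lemma hausdorff_pre_K_le: assumes "0 < \<delta>" shows "hausdorff_pre dimK sup_metric \<delta> K \<le> 1"
proof -
  obtain n where n: "(1 / real l) ^ n < \<delta>"
    using real_arch_pow_inv[of \<delta> "1 / real l"] assms l3 by auto
  have diam: "ediam sup_metric (cell n v ` K) \<le> ennreal (1 / real l ^ n)" for v
  proof (rule ediam_sup_metric_le, elim imageE)
    fix x y x' y' assume "x = cell n v x'" "y = cell n v y'" "x' \<in> K" "y' \<in> K"
    then show "mdist sup_metric x y \<le> 1 / real l ^ n"
      using K_sup_dist[of x' y'] by (simp add: sup_dist_affine_scale divide_right_mono)
  qed
  have "hausdorff_pre dimK sup_metric \<delta> K \<le> (\<Sum>v\<in>V n. hausdorff_gauge dimK sup_metric (cell n v ` K))"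
  proof (rule hausdorff_pre_le_sum[OF finite_V])
    show "K \<subseteq> (\<Union>v\<in>V n. cell n v ` K)" by (rule equalityD1[OF K_eq_cells])
    show "ediam sup_metric (cell n v ` K) \<le> ennreal \<delta>" for v
      using diam[of v] n by (auto elim!: order_trans intro!: ennreal_leI simp: power_divide)
  qed auto
  also have "\<dots> \<le> (\<Sum>v\<in>V n. ennreal ((1 / real l ^ n) powr dimK))"
    by (intro sum_mono hausdorff_gauge_le diam dimK_pos) auto
  also have "\<dots> = (\<Sum>v\<in>V n. ennreal (1 / real (card S) ^ n))"
    by (simp only: cell_powr_dimK)
  also have "\<dots> = ennreal (\<Sum>v\<in>V n. 1 / real (card S) ^ n)"
    by (rule sum_ennreal) auto
  also have "\<dots> = 1" using card_S by (simp add: card_V)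
  finally show ?thesis .
qed

lemma hausdorff_outer_K_le: "hausdorff_outer dimK sup_metric K \<le> 1"
  unfolding hausdorff_outer_def by (auto intro!: SUP_least hausdorff_pre_K_le)

text \<open>A mass distribution principle by counting: on a level finer than all the radii, each of
  the \<open>card S ^ n\<close> cells meets some ball, and no ball meets more than its
  share.\<close>

lemma finite_ball_cover_bound:
  assumes I: "finite I" and r: "\<And>i. i \<in> I \<Longrightarrow> 0 < r i"
    and cover: "K \<subseteq> (\<Union>i\<in>I. {y. mdist sup_metric (a i) y < r i})"
  shows "1 \<le> near_const * (\<Sum>i\<in>I. r i powr dimK)"
proof -
  have "I \<noteq> {}" using cover K_ne by auto
  define r0 where "r0 = Min (r ` I)"
  have r0: "0 < r0" "\<And>i. i \<in> I \<Longrightarrow> r0 \<le> r i"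
    using I r \<open>I \<noteq> {}\<close> by (auto simp: r0_def)
  obtain n where n: "(1 / real l) ^ n < r0"
    using real_arch_pow_inv[of r0 "1 / real l"] r0(1) l3 by auto
  obtain z where z: "z \<in> K" using K_ne by blast
  have "V n \<subseteq> (\<Union>i\<in>I. near_cells n (a i) (r i))"
  proof
    fix v assume v: "v \<in> V n"
    then have "cell n v z \<in> K" using z by (rule cell_in_K)
    then obtain i where "i \<in> I" "mdist sup_metric (a i) (cell n v z) < r i" using cover by blast
    then show "v \<in> (\<Union>i\<in>I. near_cells n (a i) (r i))"
      using v z by (auto simp: near_cells_def)
  qed
  moreover have "finite (\<Union>i\<in>I. near_cells n (a i) (r i))"
    using I finite_V finite_subset[of _ "V n"] by (auto simp: near_cells_def)
  ultimately have "card (V n) \<le> card (\<Union>i\<in>I. near_cells n (a i) (r i))"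
    by (intro card_mono)
  also have "\<dots> \<le> (\<Sum>i\<in>I. card (near_cells n (a i) (r i)))"
    using I by (rule card_UN_le)
  finally have "real (card (V n)) \<le> (\<Sum>i\<in>I. real (card (near_cells n (a i) (r i))))"
    by (metis of_nat_mono of_nat_sum)
  also have "\<dots> \<le> (\<Sum>i\<in>I. near_const * r i powr dimK * real (card S) ^ n)"
  proof (intro sum_mono card_near_cells r)
    fix i assume "i \<in> I"
    then show "1 / real l ^ n \<le> r i" using n r0(2)[of i] by (simp add: power_divide)
  qed
  also have "\<dots> = (near_const * (\<Sum>i\<in>I. r i powr dimK)) * real (card S) ^ n"
    by (simp add: sum_distrib_left sum_distrib_right)
  finally have "1 * real (card S) ^ n \<le> (near_const * (\<Sum>i\<in>I. r i powr dimK)) * real (card S) ^ n"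
    by (simp add: card_V)
  moreover have "0 < real (card S) ^ n" using card_S by simp
  ultimately show ?thesis by (simp only: mult_le_cancel_right_pos)
qed

text \<open>Compactness reduces an arbitrary cover to finitely many balls, once each set is enlarged
  to an open ball at a total extra cost of \<open>e\<close>.\<close>

lemma hausdorff_gauge_cover_bound:
  assumes cover: "K \<subseteq> (\<Union>i. A i)"
  shows "ennreal (1 / near_const) \<le> (\<Sum>i. hausdorff_gauge dimK sup_metric (A i))"
proof (rule ennreal_le_epsilon)
  fix e :: real
  assume fin: "(\<Sum>i. hausdorff_gauge dimK sup_metric (A i)) < top" and e: "0 < e"
  define g where "g i = enn2real (hausdorff_gauge dimK sup_metric (A i))" for i
  have g: "hausdorff_gauge dimK sup_metric (A i) = ennreal (g i)" "0 \<le> g i" for i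
    using ennreal_suminf_lessD[OF fin, of i] by (auto simp: g_def)
  \<comment> \<open>The gauge plus a summable error, turned back into a radius; because the error is
    positive, the open ball about any point of \<open>A i\<close> contains all of
    \<open>A i\<close>.\<close>
  define r where "r i = (g i + e * (1/2) ^ Suc i) powr (1 / dimK)" for i
  have gpos: "0 < g i + e * (1/2) ^ Suc i" for i using g(2)[of i] e by (simp add: add_nonneg_pos)
  have r: "0 < r i" "r i powr dimK = g i + e * (1/2) ^ Suc i" for i
    using gpos[of i] dimK_pos by (auto simp: r_def powr_powr)
  define a where "a i = (SOME x. x \<in> A i)" for i
  have ball: "A i \<subseteq> {y. mdist sup_metric (a i) y < r i}" for i
  proof
    fix y assume y: "y \<in> A i"
    then have a: "a i \<in> A i" unfolding a_def by (rule someI)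
    have "A i \<noteq> {}" using y by auto
    then have "ediam sup_metric (A i) \<noteq> \<infinity>"
      using g(1)[of i] dimK_pos by (auto simp: hausdorff_gauge_def enn_powr_def)
    then obtain q where q: "ediam sup_metric (A i) = ennreal q" "0 \<le> q"
      by (cases "ediam sup_metric (A i)") auto
    then have "g i = q powr dimK"
      using y dimK_pos by (auto simp: g_def hausdorff_gauge_def enn_powr_def)
    then have "q powr dimK < r i powr dimK" using r(2)[of i] e by simp
    then have "q < r i" using powr_less_cancel2[OF dimK_pos] q(2) r(1)[of i] by (metis less_eq_real_def not_less powr_mono2)
    moreover have "mdist sup_metric (a i) y \<le> q"
      using ediam_upper[OF a y, of sup_metric] q by simp
    ultimately show "y \<in> {y. mdist sup_metric (a i) y < r i}" by simp
  qed
  obtain I where I: "finite I" "K \<subseteq> (\<Union>i\<in>I. {y. mdist sup_metric (a i) y < r i})"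
  proof (rule compactE_image[OF K_compact])
    show "open {y. mdist sup_metric (a i) y < r i}" for i by (rule open_sup_ball)
    show "K \<subseteq> (\<Union>i\<in>UNIV. {y. mdist sup_metric (a i) y < r i})" using cover ball by blast
  qed (use that in blast)
  have "1 \<le> near_const * (\<Sum>i\<in>I. r i powr dimK)"
    using I r(1) by (intro finite_ball_cover_bound) auto
  then have "1 / near_const \<le> (\<Sum>i\<in>I. g i + e * (1/2) ^ Suc i)"
    using near_const_pos by (simp add: r(2) field_simps)
  then have "ennreal (1 / near_const) \<le> ennreal (\<Sum>i\<in>I. g i + e * (1/2) ^ Suc i)"
    by (rule ennreal_leI)
  also have "\<dots> = (\<Sum>i\<in>I. ennreal (g i) + ennreal (e * (1/2) ^ Suc i))"
    using gpos g(2) e by (subst sum_ennreal[symmetric]) (auto simp: less_imp_le ennreal_plus[symmetric] simp del: ennreal_plus)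
  also have "\<dots> \<le> (\<Sum>i. ennreal (g i) + ennreal (e * (1/2) ^ Suc i))"
    using I(1) by (intro sum_le_suminf) auto
  also have "\<dots> = (\<Sum>i. ennreal (g i)) + (\<Sum>i. ennreal (e * (1/2) ^ Suc i))"
    by (rule suminf_add[symmetric]) auto
  also have "(\<Sum>i. ennreal (e * (1/2) ^ Suc i)) = ennreal e"
    using sums_mult[OF power_half_series, of e] e by (intro suminf_ennreal_eq) auto
  finally show "ennreal (1 / near_const) \<le> (\<Sum>i. hausdorff_gauge dimK sup_metric (A i)) + ennreal e"
    by (simp add: g(1))
qed

lemma hausdorff_outer_K_pos: "0 < hausdorff_outer dimK sup_metric K"
proof -
  have "0 < ennreal (1 / near_const)" using near_const_pos by simp
  also have "\<dots> \<le> hausdorff_pre dimK sup_metric 1 K"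
    unfolding hausdorff_pre_def
    by (intro INF_greatest hausdorff_gauge_cover_bound) (auto simp: hausdorff_covers_def)
  also have "\<dots> \<le> hausdorff_outer dimK sup_metric K"
    unfolding hausdorff_outer_def by (intro SUP_upper) auto
  finally show ?thesis .
qed

lemma hausdorff_dim_K: "hausdorff_dim (submetric sup_metric K) = ereal dimK"
proof (rule hausdorff_dim_eqI[OF dimK_pos])
  have "similarity 1 (submetric sup_metric K) sup_metric id"
    by (simp add: similarity_def)
  from hausdorff_outer_similarity_image[OF this, of K dimK]
  have "hausdorff_outer dimK (submetric sup_metric K) K = hausdorff_outer dimK sup_metric K"
    using dimK_pos by simp
  then show "hausdorff_outer dimK (submetric sup_metric K) (mspace (submetric sup_metric K)) \<noteq> 0"
    "hausdorff_outer dimK (submetric sup_metric K) (mspace (submetric sup_metric K)) < \<infinity>"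
    using hausdorff_outer_K_pos hausdorff_outer_K_le by (auto simp: order_le_less_trans)
qed

section \<open>Integration over cells\<close>

definition massK :: real where "massK = enn2real (emeasure H K)"

lemma massK: "emeasure H K = ennreal massK" and massK_pos: "0 < massK"
proof -
  have eq: "emeasure H K = hausdorff_outer dimK sup_metric K"
    by (rule emeasure_hausdorff_sup_metric) simp
  then have "emeasure H K < top"
    using hausdorff_outer_K_le by (simp add: order_le_less_trans)
  then show 1: "emeasure H K = ennreal massK" by (simp add: massK_def)
  show "0 < massK" using eq 1 hausdorff_outer_K_pos by (metis ennreal_less_zero_iff)
qed

lemma nn_integral_cell:
  assumes "g \<in> borel_measurable borel"
  shows "(\<integral>\<^sup>+x. g x \<partial>H) = ennreal (1 / real (card S) ^ n) * (\<integral>\<^sup>+x. g (cell n v x) \<partial>H)"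
  using nn_integral_hausdorff_affine_scale[of "1 / real l ^ n" dimK g v] assms dimK_pos
  by (simp add: cell_powr_dimK[symmetric])

lemma inj_affine_scale: "c \<noteq> 0 \<Longrightarrow> inj (affine_scale c v)"
  by (metis affine_scale_inverse(1) injI)

lemma cell_image_borel [measurable]: "cell n v ` K \<in> sets borel"
  by (intro borel_compact compact_continuous_image K_compact continuous_intros continuous_on_id)

lemma nn_integral_cell_set:
  assumes "g \<in> borel_measurable borel"
  shows "(\<integral>\<^sup>+x\<in>cell n v ` K. g x \<partial>H) = ennreal (1 / real (card S) ^ n) * (\<integral>\<^sup>+x\<in>K. g (cell n v x) \<partial>H)"
proof -
  have ind: "indicator (cell n v ` K) (cell n v x) = (indicator K x :: ennreal)" for x
    using inj_affine_scale[of "1 / real l ^ n" v] by (auto simp: indicator_def inj_image_mem_iff)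
  have "(\<lambda>x. g x * indicator (cell n v ` K) x) \<in> borel_measurable borel"
    using assms by measurable
  then show ?thesis by (subst nn_integral_cell[where n = n and v = v]) (auto simp: ind)
qed

lemma emeasure_cell: "emeasure H (cell n v ` K) = ennreal (massK / real (card S) ^ n)"
  using nn_integral_cell_set[of "\<lambda>_. 1" n v] massK_pos
  by (simp add: massK ennreal_mult[symmetric])

text \<open>The cells of level \<open>n\<close> overlap in null sets, because their measures add up to that of \<open>K\<close>.\<close>

lemma AE_cells: "AE x in H. (\<Sum>v\<in>V n. indicator (cell n v ` K) x) = (indicator K x :: ennreal)"
proof -
  define f :: "real ^ 'n \<Rightarrow> ennreal" where "f x = (\<Sum>v\<in>V n. indicator (cell n v ` K) x)" for x
  have fm: "f \<in> borel_measurable borel" unfolding f_def by measurable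
  have ge: "indicator K x \<le> f x" for x
  proof (cases "x \<in> K")
    case True
    then obtain v where v: "v \<in> V n" "x \<in> cell n v ` K" using K_eq_cells[of n] by blast
    have "(1 :: ennreal) = (\<Sum>u\<in>{v}. indicator (cell n u ` K) x)" using v by simp
    also have "\<dots> \<le> f x" unfolding f_def using v finite_V by (intro sum_mono2) auto
    finally show ?thesis using True by simp
  qed simp
  have "(\<integral>\<^sup>+x. f x \<partial>H) = (\<Sum>v\<in>V n. emeasure H (cell n v ` K))"
    unfolding f_def by (subst nn_integral_sum) (auto simp: nn_integral_indicator)
  also have "\<dots> = ennreal (\<Sum>v\<in>V n. massK / real (card S) ^ n)"
    using massK_pos by (subst sum_ennreal[symmetric]) (auto simp: emeasure_cell)
  also have "\<dots> = ennreal massK" using card_S by (simp add: card_V)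
  finally have int: "(\<integral>\<^sup>+x. f x \<partial>H) = ennreal massK" .
  have "(\<integral>\<^sup>+x. f x - indicator K x \<partial>H) = (\<integral>\<^sup>+x. f x \<partial>H) - (\<integral>\<^sup>+x. indicator K x \<partial>H)"
    using fm ge by (intro nn_integral_diff) (auto simp: massK)
  also have "\<dots> = 0" by (simp add: int massK)
  finally have "AE x in H. f x - indicator K x = 0"
    using fm by (subst (asm) nn_integral_0_iff_AE) auto
  then show ?thesis
  proof eventually_elim
    case (elim x)
    then have "f x \<le> indicator K x" by (simp add: diff_eq_0_iff_ennreal)
    then show ?case using ge[of x] by (simp add: f_def antisym)
  qed
qed

text \<open>The cells tile \<open>K\<close> up to null sets, and each is a copy of \<open>K\<close>
  with the measure scaled by \<open>1 / card S ^ n\<close>.\<close>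

lemma nn_integral_K_cells:
  assumes g: "g \<in> borel_measurable borel"
  shows "(\<integral>\<^sup>+x\<in>K. g x \<partial>H) = (\<Sum>v\<in>V n. ennreal (1 / real (card S) ^ n) * (\<integral>\<^sup>+x\<in>K. g (cell n v x) \<partial>H))"
proof -
  have "(\<integral>\<^sup>+x\<in>K. g x \<partial>H) = (\<integral>\<^sup>+x. (\<Sum>v\<in>V n. g x * indicator (cell n v ` K) x) \<partial>H)"
    using AE_cells[of n] by (intro nn_integral_cong_AE) (auto simp: sum_distrib_left[symmetric])
  also have "\<dots> = (\<Sum>v\<in>V n. (\<integral>\<^sup>+x\<in>cell n v ` K. g x \<partial>H))"
    using g by (intro nn_integral_sum) auto
  finally show ?thesis by (simp only: nn_integral_cell_set[OF g])
qed

section \<open>Measure of balls in the carpet\<close>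

lemma K_ball_upper:
  assumes "0 < r"
  shows "emeasure H (K \<inter> {y. mdist sup_metric a y < r}) \<le> ennreal (near_const * massK * r powr dimK)"
proof -
  obtain n where n: "(1 / real l) ^ n < r"
    using real_arch_pow_inv[of r "1 / real l"] assms l3 by auto
  have fin: "finite (near_cells n a r)"
    using finite_V by (rule finite_subset[rotated]) (auto simp: near_cells_def)
  have "K \<inter> {y. mdist sup_metric a y < r} \<subseteq> (\<Union>v\<in>near_cells n a r. cell n v ` K)"
  proof
    fix x assume x: "x \<in> K \<inter> {y. mdist sup_metric a y < r}"
    then obtain v y where "v \<in> V n" "y \<in> K" "x = cell n v y" using K_eq_cells[of n] by blast
    then show "x \<in> (\<Union>v\<in>near_cells n a r. cell n v ` K)"
      using x by (auto simp: near_cells_def)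
  qed
  then have "emeasure H (K \<inter> {y. mdist sup_metric a y < r}) \<le> emeasure H (\<Union>v\<in>near_cells n a r. cell n v ` K)"
    using fin by (intro emeasure_mono) auto
  also have "\<dots> \<le> (\<Sum>v\<in>near_cells n a r. emeasure H (cell n v ` K))"
    using fin by (intro emeasure_subadditive_finite) auto
  also have "\<dots> = ennreal (real (card (near_cells n a r)) * (massK / real (card S) ^ n))"
    using massK_pos by (simp add: emeasure_cell ennreal_of_nat_eq_real_of_nat ennreal_mult[symmetric])
  also have "\<dots> \<le> ennreal (near_const * massK * r powr dimK)"
  proof (rule ennreal_leI)
    have "real (card (near_cells n a r)) * (massK / real (card S) ^ n)
        \<le> (near_const * r powr dimK * real (card S) ^ n) * (massK / real (card S) ^ n)"
      using n assms massK_pos by (intro mult_right_mono card_near_cells) (auto simp: power_divide)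
    also have "\<dots> = near_const * massK * r powr dimK" using card_S by simp
    finally show "real (card (near_cells n a r)) * (massK / real (card S) ^ n) \<le> near_const * massK * r powr dimK" .
  qed
  finally show ?thesis .
qed

text \<open>The cell of level \<open>m + 1\<close> through \<open>a\<close> fits into the ball; the
  one level lost in rounding \<open>r\<close> is the factor \<open>card S\<close>.\<close>

lemma K_ball_lower:
  assumes r: "0 < r" "r \<le> 1" and a: "a \<in> K"
  shows "ennreal (massK / real (card S) * r powr dimK) \<le> emeasure H (K \<inter> {y. mdist sup_metric a y < r})"
proof -
  obtain m where m: "1 / real l ^ Suc m < r" "r \<le> 1 / real l ^ m"
    using scale_index[OF r, of "real l"] l3 by auto
  obtain v y where v: "v \<in> V (Suc m)" "y \<in> K" "a = cell (Suc m) v y" using a K_eq_cells[of "Suc m"] by blast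
  have sub: "cell (Suc m) v ` K \<subseteq> K \<inter> {y. mdist sup_metric a y < r}"
  proof safe
    fix z assume z: "z \<in> K"
    then show "cell (Suc m) v z \<in> K" using v cell_in_K by blast
    have "mdist sup_metric a (cell (Suc m) v z) = 1 / real l ^ Suc m * mdist sup_metric y z"
      unfolding v(3) by (rule sup_dist_affine_scale) simp
    also have "\<dots> \<le> 1 / real l ^ Suc m" using K_sup_dist[OF v(2) z] by (simp add: divide_right_mono)
    finally show "mdist sup_metric a (cell (Suc m) v z) < r" using m by linarith
  qed
  have "massK / real (card S) * r powr dimK \<le> massK / real (card S) * (1 / real l ^ m) powr dimK"
    using m r massK_pos dimK_pos by (intro mult_left_mono powr_mono2) auto
  also have "\<dots> = massK / real (card S) ^ Suc m" by (simp add: cell_powr_dimK)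
  finally have "ennreal (massK / real (card S) * r powr dimK) \<le> emeasure H (cell (Suc m) v ` K)"
    unfolding emeasure_cell by (rule ennreal_leI)
  also have "\<dots> \<le> emeasure H (K \<inter> {y. mdist sup_metric a y < r})"
    using sub borel_open[OF open_sup_ball, of a r] by (intro emeasure_mono) (simp_all add: sets.Int)
  finally show ?thesis .
qed

end

section \<open>Gradients and test functions\<close>

definition has_grad :: "(real ^ 'n \<Rightarrow> real) \<Rightarrow> (real ^ 'n \<Rightarrow> real ^ 'n) \<Rightarrow> bool" where
  "has_grad u G \<longleftrightarrow> continuous_on UNIV G \<and> (\<forall>x. (u has_derivative (\<lambda>h. G x \<bullet> h)) (at x))"

definition open_cube :: "(real ^ 'n) set" where
  "open_cube = {x. \<forall>k. 0 < x $ k \<and> x $ k < 1}"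

text \<open>Function and gradient vanish on the faces as well, so such functions can be summed over
  cells and integer translates without matching anything where cubes touch.\<close>

definition cube_test :: "(real ^ 'n \<Rightarrow> real) \<Rightarrow> (real ^ 'n \<Rightarrow> real ^ 'n) \<Rightarrow> bool" where
  "cube_test u G \<longleftrightarrow> has_grad u G \<and> (\<forall>x. x \<notin> open_cube \<longrightarrow> u x = 0 \<and> G x = 0)"

lemma has_grad_continuous: "has_grad u G \<Longrightarrow> continuous_on UNIV G" "has_grad u G \<Longrightarrow> continuous_on UNIV u"
  unfolding has_grad_def
  by (auto intro: has_derivative_continuous_on simp: has_derivative_at_withinI)

lemma has_grad_add:
  assumes "has_grad u G" "has_grad v F"
  shows "has_grad (\<lambda>x. u x + v x) (\<lambda>x. G x + F x)"
  unfolding has_grad_def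
proof (intro conjI allI)
  fix x
  show "((\<lambda>x. u x + v x) has_derivative (\<lambda>h. (G x + F x) \<bullet> h)) (at x)"
    using assms unfolding has_grad_def
    by (intro has_derivative_eq_rhs[OF has_derivative_add]) (auto simp: fun_eq_iff inner_add_left)
qed (use assms in \<open>auto simp: has_grad_def intro!: continuous_intros\<close>)

lemma has_grad_scale:
  assumes "has_grad u G" shows "has_grad (\<lambda>x. c * u x) (\<lambda>x. c *\<^sub>R G x)"
  unfolding has_grad_def
proof (intro conjI allI)
  fix x
  show "((\<lambda>x. c * u x) has_derivative (\<lambda>h. (c *\<^sub>R G x) \<bullet> h)) (at x)"
    using assms unfolding has_grad_def
    by (intro has_derivative_eq_rhs[OF has_derivative_mult_right]) (auto simp: fun_eq_iff)
qed (use assms in \<open>auto simp: has_grad_def intro!: continuous_intros\<close>)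

lemma has_grad_zero: "has_grad (\<lambda>x. 0) (\<lambda>x. 0)"
  unfolding has_grad_def by (auto intro!: has_derivative_eq_rhs[OF has_derivative_const] simp: fun_eq_iff)

lemma has_grad_inner: "has_grad (\<lambda>x. a \<bullet> x) (\<lambda>x. a)"
  unfolding has_grad_def
  by (auto intro!: continuous_intros bounded_linear_imp_has_derivative bounded_linear_inner_right)

text \<open>\<open>L'\<close> is the transpose of \<open>L\<close>. One linear map \<open>L\<close>
  serves at every point, since \<open>T\<close> will be a scaling with translation, a reflection or
  a transposition.\<close>

lemma has_grad_compose:
  assumes "has_grad u G" "\<And>x. (T has_derivative L) (at x)" "\<And>a h. a \<bullet> L h = L' a \<bullet> h"
    and "continuous_on UNIV L'"
  shows "has_grad (\<lambda>x. u (T x)) (\<lambda>x. L' (G (T x)))"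
  unfolding has_grad_def
proof (intro conjI allI)
  have "continuous_on UNIV T"
    using assms(2) by (auto intro!: has_derivative_continuous_on simp: has_derivative_at_withinI)
  then have "continuous_on UNIV (\<lambda>x. G (T x))"
    using has_grad_continuous(1)[OF assms(1)] by (auto intro: continuous_on_compose2)
  then show "continuous_on UNIV (\<lambda>x. L' (G (T x)))"
    using assms(4) by (auto intro: continuous_on_compose2)
  fix x
  have "(u has_derivative (\<lambda>h. G (T x) \<bullet> h)) (at (T x))" using assms(1) by (simp add: has_grad_def)
  from has_derivative_compose[OF assms(2) this]
  show "((\<lambda>x. u (T x)) has_derivative (\<lambda>h. L' (G (T x)) \<bullet> h)) (at x)"
    by (simp add: assms(3))
qed

lemma has_grad_affine:
  assumes "has_grad u G"
  shows "has_grad (\<lambda>x. u (c *\<^sub>R x + w)) (\<lambda>x. c *\<^sub>R G (c *\<^sub>R x + w))"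
  by (rule has_grad_compose[OF assms, where L = "\<lambda>h. c *\<^sub>R h"])
    (auto intro!: derivative_eq_intros continuous_intros)

lemma cube_test_add:
  "cube_test u G \<Longrightarrow> cube_test v F \<Longrightarrow> cube_test (\<lambda>x. u x + v x) (\<lambda>x. G x + F x)"
  by (simp add: cube_test_def has_grad_add)

lemma cube_test_scale: "cube_test u G \<Longrightarrow> cube_test (\<lambda>x. c * u x) (\<lambda>x. c *\<^sub>R G x)"
  by (simp add: cube_test_def has_grad_scale)

lemma cube_test_zero: "cube_test (\<lambda>x. 0) (\<lambda>x. 0)"
  by (simp add: cube_test_def has_grad_zero)

lemma cube_test_sum:
  assumes "finite I" "\<And>i. i \<in> I \<Longrightarrow> cube_test (u i) (G i)"
  shows "cube_test (\<lambda>x. \<Sum>i\<in>I. u i x) (\<lambda>x. \<Sum>i\<in>I. G i x)"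
  using assms by (induction I rule: finite_induct) (auto simp: cube_test_zero intro: cube_test_add)

lemma open_cube_sub: "open_cube \<subseteq> unit_cube"
  by (auto simp: open_cube_def unit_cube_def less_imp_le)

lemma unit_cube_eq_cbox: "unit_cube = cbox (0 :: real ^ 'n) 1"
  by (auto simp: unit_cube_def mem_box_cart)

lemma cube_test_bounded:
  assumes "cube_test u G"
  obtains M where "0 < M" "\<And>x. \<bar>u x\<bar> \<le> M" "\<And>x. norm (G x) \<le> M"
proof -
  have comp: "compact (unit_cube :: (real ^ 'n) set)" by (simp add: unit_cube_eq_cbox)
  have "bounded (u ` unit_cube)" "bounded (G ` unit_cube)"
    using assms comp unfolding cube_test_def
    by (auto intro!: compact_imp_bounded compact_continuous_image
        intro: continuous_on_subset[OF has_grad_continuous(1)] continuous_on_subset[OF has_grad_continuous(2)])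
  then obtain A B where A: "\<And>x. x \<in> unit_cube \<Longrightarrow> \<bar>u x\<bar> \<le> A" and B: "\<And>x. x \<in> unit_cube \<Longrightarrow> norm (G x) \<le> B"
    by (auto simp: bounded_iff)
  have "\<bar>u x\<bar> \<le> \<bar>A\<bar> + \<bar>B\<bar> + 1" "norm (G x) \<le> \<bar>A\<bar> + \<bar>B\<bar> + 1" for x
  proof -
    have "x \<in> unit_cube \<or> u x = 0 \<and> G x = 0"
      using assms open_cube_sub unfolding cube_test_def by blast
    then show "\<bar>u x\<bar> \<le> \<bar>A\<bar> + \<bar>B\<bar> + 1" "norm (G x) \<le> \<bar>A\<bar> + \<bar>B\<bar> + 1"
      using A[of x] B[of x] by auto
  qed
  then show thesis using that[of "\<bar>A\<bar> + \<bar>B\<bar> + 1"] by auto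
qed

text \<open>A shift from the closed into the open cube moves every coordinate by less than
  \<open>1\<close>, so an integer shift of this kind is zero.\<close>

lemma int_shift_not_in_open_cube:
  assumes y: "y \<in> unit_cube" and v: "v \<in> int_vecs" "v' \<in> int_vecs" "v \<noteq> v'"
  shows "y + (v - v') \<notin> open_cube"
proof
  assume *: "y + (v - v') \<in> open_cube"
  have "v $ k = v' $ k" for k
  proof -
    have "v $ k - v' $ k \<in> \<int>" using v(1,2) by (auto simp: int_vecs_def)
    then obtain z where z: "v $ k - v' $ k = of_int z" by (auto elim: Ints_cases)
    moreover have "\<bar>v $ k - v' $ k\<bar> < 1"
    proof -
      have "0 < y $ k + (v $ k - v' $ k)" "y $ k + (v $ k - v' $ k) < 1"
        using * by (auto simp: open_cube_def)
      moreover have "0 \<le> y $ k" "y $ k \<le> 1" using y by (auto simp: unit_cube_def)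
      ultimately show ?thesis by linarith
    qed
    ultimately have "z = 0" by linarith
    then show ?thesis using z by simp
  qed
  then show False using v(3) by (simp add: vec_eq_iff)
qed

text \<open>With disjoint supports a sum obeys the bound of a single term, however many terms there
  are.\<close>

lemma norm_sum_one_nonzero:
  fixes f :: "'a \<Rightarrow> 'b :: real_normed_vector"
  assumes "finite I" "0 \<le> c" "\<And>i. i \<in> I \<Longrightarrow> norm (f i) \<le> c"
    and "\<And>i j. i \<in> I \<Longrightarrow> j \<in> I \<Longrightarrow> f i \<noteq> 0 \<Longrightarrow> f j \<noteq> 0 \<Longrightarrow> i = j"
  shows "norm (\<Sum>i\<in>I. f i) \<le> c"
proof (cases "\<exists>i\<in>I. f i \<noteq> 0")
  case True
  then obtain i where i: "i \<in> I" "f i \<noteq> 0" by blast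
  then have "(\<Sum>j\<in>I. f j) = (\<Sum>j\<in>{i}. f j)"
    using assms(1,4) by (intro sum.mono_neutral_right) auto
  then show ?thesis using assms(3)[OF i(1)] by simp
next
  case False
  then show ?thesis using assms(2) by simp
qed

lemma translated_tests_disjoint:
  assumes u: "\<And>v. cube_test (u v) (G v)" and I: "I \<subseteq> int_vecs" and v: "v \<in> I" "v' \<in> I"
    and nz: "u v (x - v) \<noteq> 0" "u v' (x - v') \<noteq> 0"
  shows "v = v'"
proof (rule ccontr)
  assume ne: "v \<noteq> v'"
  have 1: "x - v \<in> open_cube" using u[of v] nz(1) unfolding cube_test_def by metis
  have 2: "x - v' \<in> open_cube" using u[of v'] nz(2) unfolding cube_test_def by metis
  have "(x - v) + (v - v') \<notin> open_cube"
    using 1 open_cube_sub I v ne by (intro int_shift_not_in_open_cube) blast+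
  then show False using 2 by simp
qed


section \<open>A bump function\<close>

text \<open>Squaring the positive part gives a C^1 function with Lipschitz derivative, which is
  enough for a Taylor bound with quadratic error.\<close>

definition pos_sq :: "real \<Rightarrow> real" where "pos_sq s = (max 0 s)\<^sup>2"

lemma pos_sq_taylor: "\<bar>pos_sq b - pos_sq a - 2 * max 0 a * (b - a)\<bar> \<le> (b - a)\<^sup>2"
proof -
  consider "0 \<le> a" "0 \<le> b" | "0 \<le> a" "b < 0" | "a < 0" "0 \<le> b" | "a < 0" "b < 0" by linarith
  then show ?thesis
  proof cases
    case 1
    then have "pos_sq b - pos_sq a - 2 * max 0 a * (b - a) = (b - a)\<^sup>2"
      by (simp add: pos_sq_def power2_eq_square algebra_simps)
    then show ?thesis by simp
  next
    case 2
    then have "pos_sq b - pos_sq a - 2 * max 0 a * (b - a) = a\<^sup>2 - 2 * (a * b)"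
      by (simp add: pos_sq_def power2_eq_square algebra_simps)
    moreover have "a * b \<le> 0" using 2 by (simp add: mult_nonneg_nonpos)
    moreover have "(b - a)\<^sup>2 = a\<^sup>2 - 2 * (a * b) + b\<^sup>2" by (simp add: power2_eq_square algebra_simps)
    ultimately show ?thesis using zero_le_power2[of a] zero_le_power2[of b] by linarith
  next
    case 3
    then have "b\<^sup>2 \<le> (b - a)\<^sup>2" by (intro power_mono) auto
    then show ?thesis using 3 by (simp add: pos_sq_def)
  qed (simp add: pos_sq_def)
qed

lemma pos_sq_deriv: "(pos_sq has_real_derivative (2 * max 0 a)) (at a)"
  unfolding has_field_derivative_def has_derivative_at2
proof (intro conjI)
  show "bounded_linear ((*) (2 * max 0 a))" by (rule bounded_linear_mult_right)
  have "((\<lambda>b. \<bar>b - a\<bar>) \<longlongrightarrow> \<bar>a - a\<bar>) (at a)" by (intro tendsto_intros)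
  then have lim: "((\<lambda>b. \<bar>b - a\<bar>) \<longlongrightarrow> 0) (at a)" by simp
  have "norm ((1 / norm (b - a)) *\<^sub>R (pos_sq b - (pos_sq a + 2 * max 0 a * (b - a)))) \<le> \<bar>b - a\<bar>" if "b \<noteq> a" for b
  proof -
    have "\<bar>pos_sq b - (pos_sq a + 2 * max 0 a * (b - a))\<bar> \<le> \<bar>b - a\<bar> * \<bar>b - a\<bar>"
      using pos_sq_taylor[of b a] by (simp add: power2_eq_square algebra_simps)
    then have "\<bar>pos_sq b - (pos_sq a + 2 * max 0 a * (b - a))\<bar> / \<bar>b - a\<bar> \<le> \<bar>b - a\<bar>"
      using that by (subst pos_divide_le_eq) auto
    then show ?thesis by (simp add: abs_mult)
  qed
  then show "((\<lambda>b. (1 / norm (b - a)) *\<^sub>R (pos_sq b - (pos_sq a + 2 * max 0 a * (b - a)))) \<longlongrightarrow> 0) (at a)"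
    by (intro Lim_null_comparison[OF _ lim]) (auto simp: eventually_at_filter)
qed

definition bump :: "real \<Rightarrow> real ^ 'n \<Rightarrow> real" where
  "bump \<eta> x = pos_sq (\<eta>\<^sup>2 - x \<bullet> x)"

definition bump_grad :: "real \<Rightarrow> real ^ 'n \<Rightarrow> real ^ 'n" where
  "bump_grad \<eta> x = (- 4 * max 0 (\<eta>\<^sup>2 - x \<bullet> x)) *\<^sub>R x"

lemma has_grad_bump: "has_grad (bump \<eta>) (bump_grad \<eta>)"
  unfolding has_grad_def
proof (intro conjI allI)
  show "continuous_on UNIV (bump_grad \<eta>)"
    unfolding bump_grad_def by (intro continuous_intros)
  fix x :: "real ^ 'n"
  have "((\<lambda>x. \<eta>\<^sup>2 - x \<bullet> x) has_derivative (\<lambda>h. - (2 * (x \<bullet> h)))) (at x)"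
    by (auto intro!: derivative_eq_intros simp: inner_commute)
  from has_derivative_compose[OF this pos_sq_deriv[of "\<eta>\<^sup>2 - x \<bullet> x", unfolded has_field_derivative_def]]
  show "(bump \<eta> has_derivative (\<lambda>h. bump_grad \<eta> x \<bullet> h)) (at x)"
    unfolding bump_def bump_grad_def by (simp add: algebra_simps)
qed

lemma bump_eq_0:
  assumes "0 \<le> \<eta>" "\<eta> \<le> norm x" shows "bump \<eta> x = 0" "bump_grad \<eta> x = 0"
proof -
  have "\<eta>\<^sup>2 \<le> x \<bullet> x" using assms by (simp add: dot_square_norm power_mono)
  then show "bump \<eta> x = 0" "bump_grad \<eta> x = 0" by (auto simp: bump_def bump_grad_def pos_sq_def)
qed

lemma bump_nonneg: "0 \<le> bump \<eta> x"
  by (simp add: bump_def pos_sq_def)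

text \<open>The change \<open>b - a\<close> of the inner function is at most
  \<open>3 * R * norm h\<close>, and its square bounds the error of \<open>pos_sq\<close>. The part
  \<open>h \<bullet> h\<close> of \<open>b - a\<close>, which the gradient ignores, contributes the
  \<open>2\<close>.\<close>

lemma bump_taylor:
  assumes "0 \<le> \<eta>" "\<eta> \<le> 1" "norm x \<le> R" "norm h \<le> R"
  shows "\<bar>bump \<eta> (x + h) - bump \<eta> x - bump_grad \<eta> x \<bullet> h\<bar> \<le> (2 + 9 * R\<^sup>2) * (norm h)\<^sup>2"
proof -
  define a where "a = \<eta>\<^sup>2 - x \<bullet> x"
  define b where "b = \<eta>\<^sup>2 - (x + h) \<bullet> (x + h)"
  have ba: "b - a = - (2 * (x \<bullet> h) + h \<bullet> h)"
    by (simp add: a_def b_def inner_add_left inner_add_right inner_commute)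
  have "\<eta>\<^sup>2 \<le> 1" using assms by (simp add: power_le_one)
  then have "a \<le> 1" unfolding a_def using inner_ge_zero[of x] by linarith
  then have a1: "max 0 a \<le> 1" by simp
  have hh: "h \<bullet> h = (norm h)\<^sup>2" by (rule dot_square_norm)
  have "bump \<eta> (x + h) - bump \<eta> x - bump_grad \<eta> x \<bullet> h
      = (pos_sq b - pos_sq a - 2 * max 0 a * (b - a)) - 2 * max 0 a * (h \<bullet> h)"
    unfolding ba by (simp add: bump_def bump_grad_def a_def b_def algebra_simps)
  also have "\<bar>\<dots>\<bar> \<le> (b - a)\<^sup>2 + 2 * (norm h)\<^sup>2"
  proof -
    have "\<bar>2 * max 0 a * (h \<bullet> h)\<bar> \<le> 2 * (norm h)\<^sup>2"
      using a1 mult_right_mono[OF a1, of "(norm h)\<^sup>2"] by (simp add: abs_mult hh)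
    then show ?thesis using pos_sq_taylor[of b a] by linarith
  qed
  also have "(b - a)\<^sup>2 \<le> (3 * R * norm h)\<^sup>2"
  proof -
    have "\<bar>b - a\<bar> \<le> 2 * \<bar>x \<bullet> h\<bar> + h \<bullet> h" unfolding ba using inner_ge_zero[of h] by linarith
    also have "\<bar>x \<bullet> h\<bar> \<le> norm x * norm h" by (rule Cauchy_Schwarz_ineq2)
    also have "norm x * norm h \<le> R * norm h" using assms by (intro mult_right_mono) auto
    also have "h \<bullet> h \<le> R * norm h" unfolding hh power2_eq_square using assms by (intro mult_right_mono) auto
    finally have "\<bar>b - a\<bar> \<le> 3 * R * norm h" by simp
    then show ?thesis by (metis abs_ge_zero power2_abs power_mono)
  qed
  finally show ?thesis by (simp add: power_mult_distrib algebra_simps)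
qed

text \<open>Over \<open>n + 1\<close> equal steps the increments add up to at most
  \<open>C / (n + 1)\<close>.\<close>

lemma const_of_quadratic_bound:
  fixes F :: "real \<Rightarrow> real"
  assumes "\<And>s t. 0 \<le> s \<Longrightarrow> s \<le> 1 \<Longrightarrow> 0 \<le> t \<Longrightarrow> t \<le> 1 \<Longrightarrow> \<bar>F s - F t\<bar> \<le> C * (s - t)\<^sup>2"
  shows "F 0 = F 1"
proof -
  have bound: "\<bar>F 1 - F 0\<bar> \<le> C / real (Suc n)" for n
  proof -
    have "\<bar>F (real k / real (Suc n)) - F 0\<bar> \<le> real k * (C / (real (Suc n))\<^sup>2)" if "k \<le> Suc n" for k
      using that
    proof (induction k)
      case (Suc k)
      have "real (Suc k) / real (Suc n) - real k / real (Suc n) = 1 / real (Suc n)"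
        by (simp add: field_simps)
      then have "\<bar>F (real (Suc k) / real (Suc n)) - F (real k / real (Suc n))\<bar> \<le> C / (real (Suc n))\<^sup>2"
        using assms[of "real (Suc k) / real (Suc n)" "real k / real (Suc n)"] Suc.prems
        by (simp add: power_divide)
      moreover have "real (Suc k) * (C / (real (Suc n))\<^sup>2) = real k * (C / (real (Suc n))\<^sup>2) + C / (real (Suc n))\<^sup>2"
        by (simp only: of_nat_Suc distrib_right mult_1)
      ultimately show ?case using Suc.IH Suc.prems by linarith
    qed simp
    from this[of "Suc n"] show ?thesis by (simp add: power2_eq_square)
  qed
  have "(\<lambda>n. C / real (Suc n)) \<longlonglongrightarrow> 0" by (rule LIMSEQ_Suc[OF lim_const_over_n])
  then have "\<bar>F 1 - F 0\<bar> \<le> 0" using bound by (intro LIMSEQ_le_const) auto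
  then show ?thesis by simp
qed

text \<open>In the induction \<open>1 + x \<ge> 0\<close> allows multiplying the estimate, and
  \<open>\<bar>x\<bar> \<le> 1\<close> absorbs the cubic term.\<close>

lemma power_one_plus_le:
  fixes x :: real
  shows "\<exists>C\<ge>0. \<forall>x. \<bar>x\<bar> \<le> 1 \<longrightarrow> (1 + x) ^ q \<le> 1 + real q * x + C * x\<^sup>2"
proof (induction q)
  case (Suc q)
  then obtain C where C: "0 \<le> C" "\<And>x. \<bar>x\<bar> \<le> 1 \<Longrightarrow> (1 + x) ^ q \<le> 1 + real q * x + C * x\<^sup>2" by blast
  have "(1 + x) ^ Suc q \<le> 1 + real (Suc q) * x + (real q + 2 * C) * x\<^sup>2" if x: "\<bar>x\<bar> \<le> 1" for x :: real
  proof -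
    have "(1 + x) ^ Suc q \<le> (1 + x) * (1 + real q * x + C * x\<^sup>2)"
      using C(2)[OF x] x by (simp add: mult_left_mono)
    also have "\<dots> = 1 + real (Suc q) * x + real q * x\<^sup>2 + C * x\<^sup>2 * (1 + x)"
      by (simp add: algebra_simps power2_eq_square)
    also have "C * x\<^sup>2 * (1 + x) \<le> C * x\<^sup>2 * 2"
      using C x by (intro mult_left_mono) auto
    finally show ?thesis by (simp add: algebra_simps)
  qed
  then show ?case using C(1) by (intro exI[of _ "real q + 2 * C"]) auto
qed (auto intro: exI[of _ 0])

section \<open>Test functions with prescribed mean gradient\<close>

lemma distr_hausdorff_isometry:
  fixes f :: "real ^ 'n \<Rightarrow> real ^ 'n"
  assumes "similarity 1 sup_metric sup_metric f" "surj f" "0 \<le> s" "f \<in> borel_measurable borel"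
  shows "distr (hausdorff_measure s sup_metric) borel f = hausdorff_measure s sup_metric"
proof (rule measure_eqI)
  fix A assume "A \<in> sets (distr (hausdorff_measure s sup_metric) borel f)"
  then show "emeasure (distr (hausdorff_measure s sup_metric) borel f) A = emeasure (hausdorff_measure s sup_metric) A"
    using emeasure_hausdorff_vimage[OF assms, of A] assms(4) by (simp add: emeasure_distr)
qed simp

context carpet
begin

section \<open>Integrals of continuous functions over the carpet\<close>

lemma K_integrable:
  fixes f :: "real ^ 'n \<Rightarrow> 'b :: {banach, second_countable_topology}"
  assumes "continuous_on UNIV f"
  shows "set_integrable H K f"
proof -
  have "bounded (f ` K)"
    using assms K_compact by (intro compact_imp_bounded compact_continuous_image continuous_on_subset[OF assms]) auto
  then obtain B where B: "\<And>x. x \<in> K \<Longrightarrow> norm (f x) \<le> B" by (auto simp: bounded_iff)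
  have m: "f \<in> borel_measurable borel" using assms by (rule borel_measurable_continuous_onI)
  show ?thesis
    unfolding set_integrable_def
  proof (rule integrableI_bounded_set[where A = K and B = B])
    show "(\<lambda>x. indicat_real K x *\<^sub>R f x) \<in> borel_measurable H"
      using m by simp
  qed (use B massK in \<open>auto simp: indicator_def\<close>)
qed

lemma K_LINT_mono:
  fixes f g :: "real ^ 'n \<Rightarrow> real"
  assumes "continuous_on UNIV f" "continuous_on UNIV g" "\<And>x. x \<in> K \<Longrightarrow> f x \<le> g x"
  shows "(LINT x:K|H. f x) \<le> (LINT x:K|H. g x)"
  using assms by (intro set_integral_mono K_integrable) auto

lemma K_LINT_sum:
  fixes f :: "'i \<Rightarrow> real ^ 'n \<Rightarrow> real"
  assumes "\<And>i. i \<in> A \<Longrightarrow> continuous_on UNIV (f i)"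
  shows "(LINT x:K|H. (\<Sum>i\<in>A. f i x)) = (\<Sum>i\<in>A. LINT x:K|H. f i x)"
  unfolding set_lebesgue_integral_def scaleR_sum_right
  by (rule Bochner_Integration.integral_sum) (use K_integrable[OF assms] in \<open>simp add: set_integrable_def\<close>)

lemma K_LINT_diff:
  fixes f g :: "real ^ 'n \<Rightarrow> real"
  assumes "continuous_on UNIV f" "continuous_on UNIV g"
  shows "(LINT x:K|H. f x - g x) = (LINT x:K|H. f x) - (LINT x:K|H. g x)"
  using assms by (intro set_integral_diff(2) K_integrable)

lemma K_LINT_const [simp]: "(LINT x:K|H. (c :: real)) = c * massK"
proof -
  have "measure H K = massK" using massK massK_pos by (simp add: measure_def)
  then show ?thesis using massK by (simp add: set_lebesgue_integral_def)
qed

lemma K_LINT_isometry: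
  fixes g :: "real ^ 'n \<Rightarrow> real"
  assumes f: "similarity 1 sup_metric sup_metric f" "\<And>x. f (f x) = x" "continuous_on UNIV f" "f ` K = K"
    and g: "continuous_on UNIV g"
  shows "(LINT x:K|H. g (f x)) = (LINT x:K|H. g x)"
proof -
  have fm: "f \<in> borel_measurable borel" using f(3) by (rule borel_measurable_continuous_onI)
  have gm: "g \<in> borel_measurable borel" using g by (rule borel_measurable_continuous_onI)
  have "surj f" using f(2) by (rule surjI)
  then have d: "distr H borel f = H"
    using f(1) fm dimK_pos by (intro distr_hausdorff_isometry) auto
  have "f x \<in> K \<longleftrightarrow> x \<in> K" for x using f(2,4) by (metis image_eqI)
  then have ind: "indicat_real K (f x) = indicat_real K x" for x by (simp add: indicator_def)
  have "(LINT x:K|H. g x) = (LINT x|distr H borel f. indicat_real K x *\<^sub>R g x)"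
    by (simp add: d set_lebesgue_integral_def)
  also have "\<dots> = (LINT x|H. indicat_real K (f x) *\<^sub>R g (f x))"
    using fm gm by (intro integral_distr) auto
  finally show ?thesis by (simp add: ind set_lebesgue_integral_def)
qed

lemma nn_integral_K_eq_LINT:
  fixes f :: "real ^ 'n \<Rightarrow> real"
  assumes "continuous_on UNIV f" "\<And>x. 0 \<le> f x"
  shows "(\<integral>\<^sup>+x\<in>K. ennreal (f x) \<partial>H) = ennreal (LINT x:K|H. f x)"
proof -
  have "(\<integral>\<^sup>+x\<in>K. ennreal (f x) \<partial>H) = (\<integral>\<^sup>+x. ennreal (indicat_real K x *\<^sub>R f x) \<partial>H)"
    by (intro nn_integral_cong) (auto simp: indicator_def)
  also have "\<dots> = ennreal (LINT x:K|H. f x)"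
    unfolding set_lebesgue_integral_def
    using K_integrable[OF assms(1)] assms(2) by (intro nn_integral_eq_integral) (auto simp: set_integrable_def)
  finally show ?thesis .
qed

lemma K_norm_diff: "x \<in> unit_cube \<Longrightarrow> y \<in> unit_cube \<Longrightarrow> norm (x - y :: real ^ 'n) \<le> real CARD('n)"
proof -
  assume xy: "x \<in> unit_cube" "y \<in> unit_cube"
  have "\<bar>x $ k - y $ k\<bar> \<le> 1" for k
  proof -
    have "0 \<le> x $ k" "x $ k \<le> 1" "0 \<le> y $ k" "y $ k \<le> 1" using xy by (auto simp: unit_cube_def)
    then show ?thesis by linarith
  qed
  then have "mdist sup_metric x y \<le> 1" by (simp add: sup_dist_le_iff)
  then have "real CARD('n) * mdist sup_metric x y \<le> real CARD('n) * 1"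
    by (intro mult_left_mono) auto
  then show ?thesis
    using dist_le_sup_dist[of x y] unfolding dist_norm by linarith
qed

text \<open>If all mean gradients vanished, the mean of a bump function over \<open>K\<close> would not change when the
  bump is moved inside the cube; but it vanishes over a hole and not at a point of \<open>K\<close>.\<close>

lemma ex_nonzero_mean_gradient:
  "\<exists>u G k. cube_test u G \<and> (LINT x:K|H. G x $ k) \<noteq> 0"
proof (rule ccontr)
  assume contra: "\<not> ?thesis"
  \<comment> \<open>Half of the clearance \<open>1 / (2 * l)\<close>: a bump of this radius stays
    inside the cube along the whole path and misses \<open>K\<close> at the hole.\<close>
  define \<eta> where "\<eta> = 1 / (4 * real l)"
  have \<eta>: "0 < \<eta>" "\<eta> \<le> 1" "\<eta> < 1 / (2 * real l)" using l3 by (auto simp: \<eta>_def field_simps)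
  obtain y1 where y1: "\<And>k. 1 / (2 * real l) \<le> y1 $ k \<and> y1 $ k \<le> 1 - 1 / (2 * real l)"
    "\<And>x. x \<in> K \<Longrightarrow> 1 / (2 * real l) \<le> mdist sup_metric x y1"
    using hole by blast
  define y0 :: "real ^ 'n" where "y0 = (\<chi> k. 1 / real l)"
  have y0: "1 / (2 * real l) \<le> y0 $ k \<and> y0 $ k \<le> 1 - 1 / (2 * real l)" for k
    using l3 by (auto simp: y0_def field_simps)
  define w where "w = y0 - y1"
  define y where "y t = y1 + t *\<^sub>R w" for t
  have y_mid: "1 / (2 * real l) \<le> y t $ k \<and> y t $ k \<le> 1 - 1 / (2 * real l)" if "0 \<le> t" "t \<le> 1" for t k
  proof -
    have eq: "y t $ k = (1 - t) * y1 $ k + t * y0 $ k" by (simp add: y_def w_def algebra_simps)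
    have "(1 - t) * (1 / (2 * real l)) + t * (1 / (2 * real l)) \<le> y t $ k"
      unfolding eq using y0[of k] y1(1)[of k] that by (intro add_mono mult_left_mono) auto
    moreover have "y t $ k \<le> (1 - t) * (1 - 1 / (2 * real l)) + t * (1 - 1 / (2 * real l))"
      unfolding eq using y0[of k] y1(1)[of k] that by (intro add_mono mult_left_mono) auto
    moreover have "(1 - t) * a + t * a = a" for a by (simp add: algebra_simps)
    ultimately show ?thesis by (simp only:)
  qed
  have y_cube: "y t \<in> unit_cube" if "0 \<le> t" "t \<le> 1" for t
    using y_mid[OF that] \<eta> by (auto simp: unit_cube_def) (smt (verit))+
  have test: "cube_test (\<lambda>x. bump \<eta> (x - y t)) (\<lambda>x. bump_grad \<eta> (x - y t))" if t: "0 \<le> t" "t \<le> 1" for t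
    unfolding cube_test_def
  proof (intro conjI allI impI)
    show "has_grad (\<lambda>x. bump \<eta> (x - y t)) (\<lambda>x. bump_grad \<eta> (x - y t))"
      using has_grad_affine[OF has_grad_bump[of \<eta>], where c = 1 and w = "- y t"] by simp
    fix x :: "real ^ 'n" assume "x \<notin> open_cube"
    then obtain k where "x $ k \<le> 0 \<or> 1 \<le> x $ k" by (auto simp: open_cube_def not_less)
    then have "\<eta> \<le> \<bar>(x - y t) $ k\<bar>" using y_mid[OF t, of k] \<eta>(3) by auto
    then have "\<eta> \<le> norm (x - y t)" using component_le_norm_cart[of "x - y t" k] by linarith
    then show "bump \<eta> (x - y t) = 0" "bump_grad \<eta> (x - y t) = 0"
      using bump_eq_0[of \<eta> "x - y t"] \<eta>(1) by simp_all
  qed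
  define I where "I t = (LINT x:K|H. bump \<eta> (x - y t))" for t
  define R where "R = real CARD('n)"
  define C where "C = (2 + 9 * R\<^sup>2) * (norm w)\<^sup>2 * massK"
  have cont: "continuous_on UNIV (\<lambda>x. bump \<eta> (x - y t))" "continuous_on UNIV (\<lambda>x. bump_grad \<eta> (x - y t))" for t
  proof -
    have "has_grad (\<lambda>x. bump \<eta> (x - y t)) (\<lambda>x. bump_grad \<eta> (x - y t))"
      using has_grad_affine[OF has_grad_bump[of \<eta>], where c = 1 and w = "- y t"] by simp
    then show "continuous_on UNIV (\<lambda>x. bump \<eta> (x - y t))" "continuous_on UNIV (\<lambda>x. bump_grad \<eta> (x - y t))"
      by (rule has_grad_continuous)+
  qed
  have w_norm: "norm w \<le> R"
    using y_cube[of 0] y_cube[of 1] K_norm_diff[of "y 1" "y 0"] by (simp add: y_def w_def R_def)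
  \<comment> \<open>The first-order terms integrate to zero by assumption, so the mean of the moving
    bump changes only quadratically in the step.\<close>
  have "I 0 = I 1"
  proof (rule const_of_quadratic_bound)
    fix s t :: real assume st: "0 \<le> s" "s \<le> 1" "0 \<le> t" "t \<le> 1"
    define h where "h = - (s - t) *\<^sub>R w"
    have h: "norm h \<le> R" "(norm h)\<^sup>2 = (norm w)\<^sup>2 * (s - t)\<^sup>2"
    proof -
      have "norm h = \<bar>s - t\<bar> * norm w" unfolding h_def by (simp add: abs_minus_commute)
      also have "\<dots> \<le> 1 * norm w" using st by (intro mult_right_mono) auto
      finally show "norm h \<le> R" using w_norm by simp
      show "(norm h)\<^sup>2 = (norm w)\<^sup>2 * (s - t)\<^sup>2"
        unfolding h_def by (simp add: power_mult_distrib power2_commute)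
    qed
    have "(LINT x:K|H. bump_grad \<eta> (x - y t) $ k) = 0" for k
      using contra test[OF st(3,4)] by blast
    then have "(LINT x:K|H. (\<Sum>k\<in>UNIV. h $ k * bump_grad \<eta> (x - y t) $ k)) = 0"
      using cont(2)[of t]
      by (subst K_LINT_sum) (auto intro!: continuous_intros)
    then have g0: "(LINT x:K|H. bump_grad \<eta> (x - y t) \<bullet> h) = 0"
      by (simp add: inner_vec_def mult.commute)
    have step: "\<bar>bump \<eta> (x - y s) - bump \<eta> (x - y t) - bump_grad \<eta> (x - y t) \<bullet> h\<bar> \<le> (2 + 9 * R\<^sup>2) * (norm h)\<^sup>2"
      if "x \<in> K" for x
    proof -
      have eq: "x - y s = (x - y t) + h" by (simp add: y_def h_def algebra_simps)
      have "norm (x - y t) \<le> R"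
        using K_norm_diff[of x "y t"] that K_sub_cube y_cube[OF st(3,4)] by (auto simp: R_def)
      then show ?thesis unfolding eq using \<eta> h(1) by (intro bump_taylor) auto
    qed
    have ci: "continuous_on UNIV (\<lambda>x. bump_grad \<eta> (x - y t) \<bullet> h)"
      using cont(2)[of t] by (intro continuous_intros)
    have "I s - I t = (LINT x:K|H. bump \<eta> (x - y s) - bump \<eta> (x - y t) - bump_grad \<eta> (x - y t) \<bullet> h)"
      unfolding I_def using g0 cont(1)[of s] cont(1)[of t] ci
      by (simp add: K_LINT_diff continuous_on_diff)
    moreover have "(LINT x:K|H. bump \<eta> (x - y s) - bump \<eta> (x - y t) - bump_grad \<eta> (x - y t) \<bullet> h)
        \<le> (LINT x:K|H. (2 + 9 * R\<^sup>2) * (norm h)\<^sup>2)"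
      using step cont ci by (intro K_LINT_mono continuous_intros) (auto dest: abs_le_D1)
    moreover have "(LINT x:K|H. - ((2 + 9 * R\<^sup>2) * (norm h)\<^sup>2))
        \<le> (LINT x:K|H. bump \<eta> (x - y s) - bump \<eta> (x - y t) - bump_grad \<eta> (x - y t) \<bullet> h)"
      using step cont ci by (intro K_LINT_mono continuous_intros) (auto simp: abs_le_iff intro: minus_le_iff[THEN iffD1])
    ultimately have "\<bar>I s - I t\<bar> \<le> (2 + 9 * R\<^sup>2) * (norm h)\<^sup>2 * massK"
      unfolding K_LINT_const mult_minus_left abs_le_iff by linarith
    then show "\<bar>I s - I t\<bar> \<le> C * (s - t)\<^sup>2" by (simp add: C_def h(2) algebra_simps)
  qed
  moreover have "I 0 = 0"
  proof -
    have "I 0 = (LINT x:K|H. (0 :: real))"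
      unfolding I_def
    proof (rule set_lebesgue_integral_cong)
      show "\<forall>x. x \<in> K \<longrightarrow> bump \<eta> (x - y 0) = 0"
      proof (intro allI impI)
        fix x assume "x \<in> K"
        then have "\<eta> \<le> norm (x - y1)"
          using y1(2)[of x] \<eta>(3) sup_dist_le_dist[of x y1] by (simp add: dist_norm)
        then show "bump \<eta> (x - y 0) = 0" using bump_eq_0(1)[of \<eta> "x - y1"] \<eta>(1) by (simp add: y_def)
      qed
    qed simp
    then show ?thesis by simp
  qed
  moreover have "0 < I 1"
  proof -
    \<comment> \<open>In the maximum metric the ball of this radius lies in the Euclidean ball of
      radius \<open>\<eta> / 2\<close>, where the bump is bounded below by the constant
      \<open>c\<close>.\<close>
    define r where "r = \<eta> / (2 * R)"
    have R: "1 \<le> R" using finite_UNIV_card_ge_0[where 'a = 'n] by (simp add: R_def Suc_le_eq)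
    have r: "0 < r" "r \<le> 1"
    proof -
      show "0 < r" using \<eta> R by (simp add: r_def)
      show "r \<le> 1" unfolding r_def using \<eta> R by (subst pos_divide_le_eq) auto
    qed
    define B where "B = K \<inter> {x. mdist sup_metric y0 x < r}"
    have B: "B \<in> sets borel" unfolding B_def using borel_open[OF open_sup_ball, of y0 r] by simp
    define c where "c = (\<eta>\<^sup>2 - (\<eta>/2)\<^sup>2)\<^sup>2"
    have c: "0 < c" using \<eta> by (simp add: c_def power2_eq_square)
    have low: "c \<le> bump \<eta> (x - y 1)" if "x \<in> B" for x
    proof -
      have "norm (x - y0) \<le> R * mdist sup_metric y0 x"
        using dist_le_sup_dist[of y0 x] by (simp add: dist_norm norm_minus_commute R_def)
      also have "\<dots> \<le> R * r" using that R by (intro mult_left_mono) (auto simp: B_def)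
      also have "\<dots> = \<eta> / 2" using R by (simp add: r_def)
      finally have "(x - y0) \<bullet> (x - y0) \<le> (\<eta>/2)\<^sup>2"
        unfolding dot_square_norm by (intro power_mono) auto
      then have "0 \<le> \<eta>\<^sup>2 - (\<eta>/2)\<^sup>2" "\<eta>\<^sup>2 - (\<eta>/2)\<^sup>2 \<le> \<eta>\<^sup>2 - (x - y0) \<bullet> (x - y0)"
        using \<eta> by (auto simp: power2_eq_square)
      then have "c \<le> (max 0 (\<eta>\<^sup>2 - (x - y0) \<bullet> (x - y0)))\<^sup>2"
        unfolding c_def by (intro power_mono) auto
      then show ?thesis by (simp add: bump_def pos_sq_def y_def w_def)
    qed
    have "0 < ennreal (massK / real (card S) * r powr dimK)"
      using massK_pos card_S r by simp
    also have "\<dots> \<le> emeasure H B"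
      unfolding B_def by (rule K_ball_lower[OF r]) (simp add: y0_def corner_in_K)
    finally have Bpos: "0 < emeasure H B" .
    have "0 < ennreal c * emeasure H B"
      using c Bpos by (simp add: ennreal_zero_less_mult_iff)
    also have "\<dots> = (\<integral>\<^sup>+x\<in>B. ennreal c \<partial>H)" using B by (simp add: nn_integral_cmult_indicator)
    also have "\<dots> \<le> (\<integral>\<^sup>+x\<in>K. ennreal (bump \<eta> (x - y 1)) \<partial>H)"
      using low by (intro nn_integral_mono) (auto simp: indicator_def B_def intro: ennreal_leI)
    also have "\<dots> = ennreal (I 1)"
      unfolding I_def by (intro nn_integral_K_eq_LINT cont bump_nonneg)
    finally show ?thesis by (simp add: ennreal_less_zero_iff)
  qed
  ultimately show False by simp
qed

section \<open>Symmetrization of test functions\<close>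

lemma refl1_derivative: "(refl1 k has_derivative (\<lambda>h. \<chi> i. if i = k then - h $ i else h $ i)) (at x)"
proof -
  have lin: "linear (\<lambda>h :: real ^ 'n. \<chi> i. if i = k then - h $ i else h $ i)"
    by (rule linearI) (auto simp: vec_eq_iff)
  have "refl1 k = (\<lambda>x. (\<chi> i. if i = k then - x $ i else x $ i) + axis k 1)"
    by (rule ext) (auto simp: vec_eq_iff axis_def)
  moreover have "((\<lambda>x. (\<chi> i. if i = k then - x $ i else x $ i) + axis k 1) has_derivative
      (\<lambda>h. \<chi> i. if i = k then - h $ i else h $ i)) (at x)"
    using lin by (intro has_derivative_add_const linear_imp_has_derivative)
  ultimately show ?thesis by simp
qed

lemma swap1_derivative: "(swap1 a b has_derivative swap1 a b) (at x)"
  by (intro linear_imp_has_derivative linearI) (auto simp: vec_eq_iff)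

lemma similarity_refl1: "similarity 1 sup_metric sup_metric (refl1 k)"
proof -
  have "mdist sup_metric (refl1 k x) (refl1 k y) = mdist sup_metric x y" for x y
    unfolding mdist_sup_metric by (intro arg_cong[where f = Max] image_cong) auto
  then show ?thesis by (simp add: similarity_def)
qed

lemma similarity_swap1: "similarity 1 sup_metric sup_metric (swap1 a b)"
proof -
  have "mdist sup_metric (swap1 a b x) (swap1 a b y) \<le> mdist sup_metric x y" for x y
    by (simp add: sup_dist_le_iff component_le_sup_dist)
  from this this[of "swap1 a b x" "swap1 a b y" for x y]
  have "mdist sup_metric (swap1 a b x) (swap1 a b y) = mdist sup_metric x y" for x y
    by (metis antisym swap1_swap1)
  then show ?thesis by (simp add: similarity_def)
qed

lemma continuous_refl1: "continuous_on UNIV (refl1 k)" and continuous_swap1: "continuous_on UNIV (swap1 a b)"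
  by (rule continuous_at_imp_continuous_on, use has_derivative_continuous[OF refl1_derivative] in blast)
    (rule continuous_at_imp_continuous_on, use has_derivative_continuous[OF swap1_derivative] in blast)

text \<open>Composition with the reflection in coordinate \<open>k0\<close> reverses the mean of
  that component of the gradient and keeps the others. A multiple of the difference therefore
  isolates \<open>k0\<close>, and a transposition moves \<open>k0\<close> to
  \<open>i\<close>.\<close>

lemma ex_unit_mean_gradient:
  "\<exists>u G. cube_test u G \<and> (\<forall>k. (LINT x:K|H. G x $ k) = (if k = i then 1 else 0))"
proof -
  obtain u G k0 where u: "cube_test u G" and b0: "(LINT x:K|H. G x $ k0) \<noteq> 0"
    using ex_nonzero_mean_gradient by blast
  define b where "b = (LINT x:K|H. G x $ k0)"
  define L :: "real ^ 'n \<Rightarrow> real ^ 'n" where "L h = (\<chi> i. if i = k0 then - h $ i else h $ i)" for h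
  have Gc: "continuous_on UNIV G" using u by (auto simp: cube_test_def has_grad_continuous)
  have Lc: "continuous_on UNIV L"
  proof -
    have "linear L" unfolding L_def by (rule linearI) (auto simp: vec_eq_iff)
    then show ?thesis by (simp add: linear_continuous_on linear_conv_bounded_linear)
  qed
  define v where "v x = 1 / (2 * b) * (u x + (- 1) * u (refl1 k0 x))" for x :: "real ^ 'n"
  define F where "F x = (1 / (2 * b)) *\<^sub>R (G x + (- 1) *\<^sub>R L (G (refl1 k0 x)))" for x :: "real ^ 'n"
  have "cube_test (\<lambda>x. u (refl1 k0 x)) (\<lambda>x. L (G (refl1 k0 x)))"
    unfolding cube_test_def
  proof (intro conjI allI impI)
    show "has_grad (\<lambda>x. u (refl1 k0 x)) (\<lambda>x. L (G (refl1 k0 x)))"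
    proof (rule has_grad_compose[where T = "refl1 k0" and u = u and G = G and L = L and L' = L])
      show "has_grad u G" using u by (simp add: cube_test_def)
      show "(refl1 k0 has_derivative L) (at x)" for x
        using refl1_derivative[of k0 x] by (simp add: L_def[abs_def])
      show "a \<bullet> L h = L a \<bullet> h" for a h
        by (simp add: inner_vec_def L_def if_distrib cong: if_cong) (auto intro!: sum.cong)
    qed (rule Lc)
    fix x :: "real ^ 'n" assume "x \<notin> open_cube"
    then have "refl1 k0 x \<notin> open_cube" by (auto simp: open_cube_def split: if_splits)
    then show "u (refl1 k0 x) = 0" "L (G (refl1 k0 x)) = 0"
      using u by (auto simp: cube_test_def L_def vec_eq_iff)
  qed
  then have v: "cube_test v F"
    unfolding v_def F_def by (intro cube_test_scale cube_test_add u)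
  have F: "(LINT x:K|H. F x $ k) = (if k = k0 then 1 else 0)" for k
  proof -
    have Gk: "continuous_on UNIV (\<lambda>x. G x $ k)" using Gc by (intro continuous_intros)
    have Grk: "continuous_on UNIV (\<lambda>x. G (refl1 k0 x) $ k)"
      using continuous_on_compose2[OF Gk continuous_refl1] by simp
    have eq: "(LINT x:K|H. G (refl1 k0 x) $ k) = (LINT x:K|H. G x $ k)"
      by (rule K_LINT_isometry[OF similarity_refl1 refl1_refl1 continuous_refl1 refl1_K Gk])
    show ?thesis
    proof (cases "k = k0")
      case True
      have "F x $ k = (1 / (2 * b)) * (G x $ k + G (refl1 k0 x) $ k)" for x
        using True by (simp add: F_def L_def)
      then have "(LINT x:K|H. F x $ k) = (1 / (2 * b)) * ((LINT x:K|H. G x $ k) + (LINT x:K|H. G (refl1 k0 x) $ k))"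
        using set_integral_add(2)[OF K_integrable[OF Gk] K_integrable[OF Grk]] by simp
      then show ?thesis using True b0 eq by (simp add: b_def)
    next
      case False
      have "F x $ k = (1 / (2 * b)) * (G x $ k - G (refl1 k0 x) $ k)" for x
        using False by (simp add: F_def L_def)
      then have "(LINT x:K|H. F x $ k) = (1 / (2 * b)) * ((LINT x:K|H. G x $ k) - (LINT x:K|H. G (refl1 k0 x) $ k))"
        using set_integral_diff(2)[OF K_integrable[OF Gk] K_integrable[OF Grk]] by simp
      then show ?thesis using False eq by simp
    qed
  qed
  have Fc: "continuous_on UNIV F" using v by (auto simp: cube_test_def has_grad_continuous)
  have "cube_test (\<lambda>x. v (swap1 i k0 x)) (\<lambda>x. swap1 i k0 (F (swap1 i k0 x)))"
    unfolding cube_test_def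
  proof (intro conjI allI impI)
    show "has_grad (\<lambda>x. v (swap1 i k0 x)) (\<lambda>x. swap1 i k0 (F (swap1 i k0 x)))"
    proof (rule has_grad_compose[where T = "swap1 i k0" and u = v and G = F, OF _ swap1_derivative _ continuous_swap1])
      show "has_grad v F" using v by (simp add: cube_test_def)
      show "a \<bullet> swap1 i k0 h = swap1 i k0 a \<bullet> h" for a h
        unfolding inner_vec_def
        using sum.reindex_bij_betw[OF bij_transpose[of i k0], of "\<lambda>j. a $ j \<bullet> swap1 i k0 h $ j"] by simp
    qed
    fix x :: "real ^ 'n" assume "x \<notin> open_cube"
    then obtain j where j: "\<not> (0 < x $ j \<and> x $ j < 1)" by (auto simp: open_cube_def)
    have "swap1 i k0 x $ (Transposition.transpose i k0 j) = x $ j" by simp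
    then have "swap1 i k0 x \<notin> open_cube" using j unfolding open_cube_def by (metis (mono_tags, lifting) mem_Collect_eq)
    then show "v (swap1 i k0 x) = 0" "swap1 i k0 (F (swap1 i k0 x)) = 0"
      using v by (auto simp: cube_test_def vec_eq_iff)
  qed
  moreover have "(LINT x:K|H. swap1 i k0 (F (swap1 i k0 x)) $ k) = (if k = i then 1 else 0)" for k
  proof -
    have c: "continuous_on UNIV (\<lambda>x. F x $ Transposition.transpose i k0 k)" using Fc by (intro continuous_intros)
    have "(LINT x:K|H. swap1 i k0 (F (swap1 i k0 x)) $ k) = (LINT x:K|H. F x $ Transposition.transpose i k0 k)"
      using K_LINT_isometry[OF similarity_swap1 swap1_swap1 continuous_swap1 swap1_K c, of i k0] by simp
    then show ?thesis unfolding F by (auto simp: Transposition.transpose_def)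
  qed
  ultimately show ?thesis by blast
qed

end

section \<open>Functions close to linear ones with small energy\<close>

text \<open>A one-sided modulus of continuity: only \<open>s\<close> has to be bounded, since a
  smaller \<open>t\<close> makes the power smaller.\<close>

lemma power_close:
  fixes S \<epsilon> :: real
  assumes "0 < \<epsilon>" "0 \<le> S"
  shows "\<exists>\<tau>>0. \<forall>s t. 0 \<le> s \<longrightarrow> s \<le> S \<longrightarrow> 0 \<le> t \<longrightarrow> t \<le> s + \<tau> \<longrightarrow> t ^ m \<le> s ^ m + \<epsilon>"
proof -
  have "uniformly_continuous_on {0..S+1} (\<lambda>s :: real. s ^ m)"
    by (intro compact_uniformly_continuous continuous_intros) auto
  then obtain d where d: "0 < d" "\<And>s t. s \<in> {0..S+1} \<Longrightarrow> t \<in> {0..S+1} \<Longrightarrow> dist t s < d \<Longrightarrow> dist (t ^ m) (s ^ m) < \<epsilon>"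
    unfolding uniformly_continuous_on_def using assms(1) by metis
  have "t ^ m \<le> s ^ m + \<epsilon>" if "0 \<le> s" "s \<le> S" "0 \<le> t" "t \<le> s + min (d/2) 1" for s t
  proof (cases "t \<le> s")
    case True
    then have "t ^ m \<le> s ^ m" using that by (intro power_mono) auto
    then show ?thesis using assms by simp
  next
    case False
    then have "dist t s < d" using that d(1) by (auto simp: dist_real_def)
    then have "dist (t ^ m) (s ^ m) < \<epsilon>" using that False by (intro d(2)) auto
    then show ?thesis by (simp add: dist_real_def)
  qed
  then show ?thesis using d(1) by (intro exI[of _ "min (d/2) 1"]) auto
qed

context carpet
begin

lemma K_LINT_add:
  fixes f g :: "real ^ 'n \<Rightarrow> real"
  assumes "continuous_on UNIV f" "continuous_on UNIV g"
  shows "(LINT x:K|H. f x + g x) = (LINT x:K|H. f x) + (LINT x:K|H. g x)"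
  using assms by (intro set_integral_add(2) K_integrable)

lemma K_LINT_nonneg:
  fixes f :: "real ^ 'n \<Rightarrow> real"
  assumes "continuous_on UNIV f" "\<And>x. 0 \<le> f x"
  shows "0 \<le> (LINT x:K|H. f x)"
  using K_LINT_mono[of "\<lambda>_. 0" f] assms by simp

text \<open>For non-negative functions this is \<open>nn_integral_K_cells\<close>, where the
  overlaps of cells have been settled.\<close>

lemma K_LINT_cells:
  fixes f :: "real ^ 'n \<Rightarrow> real"
  assumes f: "continuous_on UNIV f" "\<And>x. 0 \<le> f x"
  shows "(LINT x:K|H. f x) = (\<Sum>v\<in>V n. 1 / real (card S) ^ n * (LINT x:K|H. f (cell n v x)))"
proof -
  have fc: "continuous_on UNIV (\<lambda>x. f (cell n v x))" for v
    by (rule continuous_on_compose2[OF f(1)]) (auto intro!: continuous_intros)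
  have nn: "0 \<le> (LINT x:K|H. f (cell n v x))" for v
    by (rule K_LINT_nonneg[OF fc]) (rule f(2))
  have m: "(\<lambda>x. ennreal (f x)) \<in> borel_measurable borel"
    using borel_measurable_continuous_onI[OF f(1)] by measurable
  have "ennreal (LINT x:K|H. f x) = (\<integral>\<^sup>+x\<in>K. ennreal (f x) \<partial>H)"
    using f by (intro nn_integral_K_eq_LINT[symmetric])
  also have "\<dots> = (\<Sum>v\<in>V n. ennreal (1 / real (card S) ^ n) * (\<integral>\<^sup>+x\<in>K. ennreal (f (cell n v x)) \<partial>H))"
    by (rule nn_integral_K_cells[OF m])
  also have "\<dots> = (\<Sum>v\<in>V n. ennreal (1 / real (card S) ^ n * (LINT x:K|H. f (cell n v x))))"
    using f(2) nn by (intro sum.cong refl) (simp add: nn_integral_K_eq_LINT[OF fc] ennreal_mult[symmetric])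
  also have "\<dots> = ennreal (\<Sum>v\<in>V n. 1 / real (card S) ^ n * (LINT x:K|H. f (cell n v x)))"
    using nn by (intro sum_ennreal) auto
  finally show ?thesis
    using nn f by (subst (asm) ennreal_inj) (auto intro!: sum_nonneg K_LINT_nonneg)
qed

text \<open>The linear function \<open>a \<bullet> x\<close> is perturbed by \<open>- t\<close>
  times a test function with mean gradient \<open>a\<close>. To first order the energy drops by
  \<open>2 * q * t * norm a ^ (2 * q)\<close>, with an error quadratic in \<open>t\<close>; by
  homogeneity \<open>t\<close> and \<theta> do not depend on \<open>a\<close>.\<close>

lemma energy_contraction:
  assumes q: "1 \<le> q"
  shows "\<exists>\<theta> M U W. 0 \<le> \<theta> \<and> \<theta> < 1 \<and> 0 < M \<and> (\<forall>a. cube_test (U a) (W a) \<and>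
    (\<forall>x. \<bar>U a x\<bar> \<le> M * norm a) \<and> (\<forall>x. norm (W a x) \<le> M * norm a) \<and>
    (LINT x:K|H. norm (a + W a x) ^ (2 * q)) \<le> \<theta> * norm a ^ (2 * q) * massK)"
proof -
  have "\<forall>i. \<exists>u G. cube_test u G \<and> (\<forall>k. (LINT x:K|H. G x $ k) = (if k = i then 1 else 0))"
    using ex_unit_mean_gradient by blast
  then obtain u G where uG: "\<And>i. cube_test (u i) (G i)"
    and mean: "\<And>i k. (LINT x:K|H. G i x $ k) = (if k = i then 1 else 0)" by metis
  have "\<forall>i. \<exists>m>0. \<forall>x. \<bar>u i x\<bar> \<le> m \<and> norm (G i x) \<le> m"
    using cube_test_bounded[OF uG] by metis
  then obtain m where m: "\<And>i. 0 < m i" "\<And>i x. \<bar>u i x\<bar> \<le> m i" "\<And>i x. norm (G i x) \<le> m i" by metis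
  define M where "M = 1 + (\<Sum>i\<in>UNIV. m i)"
  have M: "1 \<le> M" using m(1) by (simp add: M_def sum_nonneg less_imp_le)
  \<comment> \<open>Combining the unit mean gradients with the entries of \<open>a\<close> yields
    the mean gradient \<open>a\<close>, so \<open>a \<bullet> w a x\<close> has integral
    \<open>(norm a)\<^sup>2\<close>.\<close>
  define w where "w a x = (\<Sum>i\<in>UNIV. a $ i *\<^sub>R G i x)" for a x :: "real ^ 'n"
  define z where "z a x = (\<Sum>i\<in>UNIV. a $ i * u i x)" for a x :: "real ^ 'n"
  have wz: "cube_test (z a) (w a)" for a
    unfolding z_def[abs_def] w_def[abs_def] by (intro cube_test_sum cube_test_scale uG) auto
  have sumle: "(\<Sum>i\<in>UNIV. \<bar>a $ i\<bar> * m i) \<le> M * norm a" for a :: "real ^ 'n"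
  proof -
    have "(\<Sum>i\<in>UNIV. \<bar>a $ i\<bar> * m i) \<le> (\<Sum>i\<in>UNIV. norm a * m i)"
      using m(1) by (intro sum_mono mult_right_mono component_le_norm_cart) (auto simp: less_imp_le)
    also have "\<dots> = norm a * (\<Sum>i\<in>UNIV. m i)" by (simp add: sum_distrib_left)
    also have "\<dots> \<le> norm a * M" by (intro mult_left_mono) (auto simp: M_def)
    finally show ?thesis by (simp add: mult.commute)
  qed
  have w_le: "norm (w a x) \<le> M * norm a" for a x
  proof -
    have "norm (w a x) \<le> (\<Sum>i\<in>UNIV. norm (a $ i *\<^sub>R G i x))" unfolding w_def by (rule norm_sum)
    also have "\<dots> \<le> (\<Sum>i\<in>UNIV. \<bar>a $ i\<bar> * m i)" using m(3) by (intro sum_mono) (auto intro: mult_left_mono)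
    finally show ?thesis using sumle[of a] by linarith
  qed
  have z_le: "\<bar>z a x\<bar> \<le> M * norm a" for a x
  proof -
    have "\<bar>z a x\<bar> \<le> (\<Sum>i\<in>UNIV. \<bar>a $ i * u i x\<bar>)" unfolding z_def by (rule sum_abs)
    also have "\<dots> \<le> (\<Sum>i\<in>UNIV. \<bar>a $ i\<bar> * m i)" using m(2) by (intro sum_mono) (auto simp: abs_mult intro: mult_left_mono)
    finally show ?thesis using sumle[of a] by linarith
  qed
  have wc: "continuous_on UNIV (w a)" for a
    using wz[of a] by (auto simp: cube_test_def has_grad_continuous)
  have Gc: "continuous_on UNIV (G i)" for i
    using uG[of i] by (auto simp: cube_test_def has_grad_continuous)
  have mean_w: "(LINT x:K|H. a \<bullet> w a x) = (norm a)\<^sup>2" for a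
  proof -
    have "(LINT x:K|H. a \<bullet> w a x) = (LINT x:K|H. \<Sum>k\<in>UNIV. \<Sum>i\<in>UNIV. (a $ k * a $ i) * G i x $ k)"
      by (simp add: w_def inner_vec_def sum_component sum_distrib_left mult.assoc)
    also have "\<dots> = (\<Sum>k\<in>UNIV. LINT x:K|H. \<Sum>i\<in>UNIV. (a $ k * a $ i) * G i x $ k)"
      using Gc by (intro K_LINT_sum continuous_intros)
    also have "\<dots> = (\<Sum>k\<in>UNIV. \<Sum>i\<in>UNIV. LINT x:K|H. (a $ k * a $ i) * G i x $ k)"
      using Gc by (intro sum.cong refl K_LINT_sum continuous_intros)
    also have "\<dots> = (\<Sum>k\<in>UNIV. a $ k * a $ k)"
      by (simp add: mean if_distrib cong: if_cong)
    also have "\<dots> = a \<bullet> a" by (simp add: inner_vec_def)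
    finally show ?thesis by (simp add: dot_square_norm)
  qed
  obtain C where C: "0 \<le> C" "\<And>x. \<bar>x\<bar> \<le> 1 \<Longrightarrow> (1 + x) ^ q \<le> 1 + real q * x + C * x\<^sup>2"
    using power_one_plus_le[of q] by blast
  have rq: "1 \<le> real q" using q by simp
  \<comment> \<open>The constant of the quadratic error: \<open>q * M\<^sup>2\<close> comes from the
    square of \<open>w\<close>, and \<open>9 * C * M\<^sup>2\<close> from
    \<open>\<xi>\<^sup>2 \<le> (3 * t * M)\<^sup>2\<close> below.\<close>
  define A where "A = (real q + 9 * C) * M\<^sup>2"
  have A: "0 < A" using rq C M by (simp add: A_def)
  \<comment> \<open>The three bounds keep \<xi> in the range of the power estimate, let the
    quadratic error consume at most half of the linear gain \<open>2 * q * t\<close>, and make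
    \<theta> non-negative.\<close>
  define t where "t = min (1 / (3 * M)) (min (real q / (A * massK)) (massK / real q))"
  have t: "0 < t" "3 * t * M \<le> 1" "t * (A * massK) \<le> real q" "real q * t \<le> massK"
  proof -
    show "0 < t" using M A massK_pos rq by (simp add: t_def)
    have "t \<le> 1 / (3 * M)" "t \<le> real q / (A * massK)" "t \<le> massK / real q" by (simp_all add: t_def)
    then show "3 * t * M \<le> 1" "t * (A * massK) \<le> real q" "real q * t \<le> massK"
      using M A massK_pos rq by (simp_all add: pos_le_divide_eq algebra_simps)
  qed
  define \<theta> where "\<theta> = 1 - real q * t / massK"
  have \<theta>: "0 \<le> \<theta>" "\<theta> < 1" using t massK_pos rq by (auto simp: \<theta>_def)
  define U where "U a x = (- t) * z a x" for a x
  define W where "W a x = (- t) *\<^sub>R w a x" for a x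
  have t1: "t \<le> 1"
  proof -
    have "t * 1 \<le> t * (3 * M)" using t(1) M by (intro mult_left_mono) auto
    then show ?thesis using t(2) by (simp add: algebra_simps)
  qed
  have UW: "cube_test (U a) (W a)" for a
    unfolding U_def[abs_def] W_def[abs_def] by (rule cube_test_scale[OF wz])
  have U_le: "\<bar>U a x\<bar> \<le> M * norm a" for a x
    using mult_mono[OF t1 z_le[of a x]] t(1) by (simp add: U_def abs_mult)
  have W_le: "norm (W a x) \<le> M * norm a" for a x
    using mult_mono[OF t1 w_le[of a x]] t(1) by (simp add: W_def)
  have energy: "(LINT x:K|H. norm (a + W a x) ^ (2 * q)) \<le> \<theta> * norm a ^ (2 * q) * massK" for a
  proof (cases "a = 0")
    case True
    then have "norm (a + W a x) ^ (2 * q) = 0" for x using W_le[of a x] q by (simp add: zero_power)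
    then show ?thesis using True q by (simp add: zero_power)
  next
    case False
    define n where "n = norm a"
    have n: "0 < n" using False by (simp add: n_def)
    have pt: "norm (a + W a x) ^ (2 * q) \<le>
        n ^ (2 * q) * (1 + A * t\<^sup>2) - (n ^ (2 * q) * (2 * real q * t / n\<^sup>2)) * (a \<bullet> w a x)" for x
    proof -
      define \<alpha> where "\<alpha> = (a \<bullet> w a x) / n\<^sup>2"
      define \<beta> where "\<beta> = (w a x \<bullet> w a x) / n\<^sup>2"
      \<comment> \<open>The relative change of the squared norm of the gradient.\<close>
      define \<xi> where "\<xi> = - 2 * t * \<alpha> + t\<^sup>2 * \<beta>"
      have "\<bar>a \<bullet> w a x\<bar> \<le> n * (M * n)"
        unfolding n_def by (rule order_trans[OF Cauchy_Schwarz_ineq2 mult_left_mono[OF w_le]]) simp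
      then have \<alpha>: "\<bar>\<alpha>\<bar> \<le> M" using n by (simp add: \<alpha>_def abs_divide divide_le_eq power2_eq_square algebra_simps)
      have "w a x \<bullet> w a x \<le> (M * n)\<^sup>2"
        unfolding dot_square_norm using w_le[of a x] by (intro power_mono) (auto simp: n_def)
      then have \<beta>: "\<beta> \<le> M\<^sup>2" using n by (simp add: \<beta>_def divide_le_eq power_mult_distrib)
      have \<beta>0: "0 \<le> \<beta>" by (simp add: \<beta>_def)
      have tM: "t\<^sup>2 * \<beta> \<le> t * M"
      proof -
        have "t\<^sup>2 * \<beta> \<le> t\<^sup>2 * M\<^sup>2" using \<beta> by (intro mult_left_mono) auto
        also have "\<dots> = (t * M) * (t * M)" by (simp add: power2_eq_square)
        also have "\<dots> \<le> 1 * (t * M)" using t M by (intro mult_right_mono) auto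
        finally show ?thesis by simp
      qed
      have "\<bar>2 * t * \<alpha>\<bar> \<le> 2 * t * M" using \<alpha> t(1) by (simp add: abs_mult)
      moreover have "0 \<le> t\<^sup>2 * \<beta>" using \<beta>0 by simp
      ultimately have \<xi>: "\<bar>\<xi>\<bar> \<le> 3 * t * M" unfolding \<xi>_def using tM by linarith
      have "(norm (a + W a x))\<^sup>2 = n\<^sup>2 - 2 * t * (a \<bullet> w a x) + t\<^sup>2 * (w a x \<bullet> w a x)"
        unfolding power2_norm_eq_inner W_def n_def
        by (simp add: inner_add_left inner_add_right inner_commute power2_eq_square algebra_simps)
      also have "\<dots> = n\<^sup>2 - 2 * t * (n\<^sup>2 * \<alpha>) + t\<^sup>2 * (n\<^sup>2 * \<beta>)"
        using n by (simp add: \<alpha>_def \<beta>_def)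
      also have "\<dots> = n\<^sup>2 * (1 + \<xi>)"
        by (simp add: \<xi>_def algebra_simps)
      finally have "norm (a + W a x) ^ (2 * q) = n ^ (2 * q) * (1 + \<xi>) ^ q"
        by (simp add: power_mult power_mult_distrib)
      also have "(1 + \<xi>) ^ q \<le> 1 + A * t\<^sup>2 - 2 * real q * t * \<alpha>"
      proof -
        have 1: "(1 + \<xi>) ^ q \<le> 1 + real q * \<xi> + C * \<xi>\<^sup>2" using \<xi> t(2) by (intro C) auto
        have "\<xi>\<^sup>2 \<le> (3 * t * M)\<^sup>2" using \<xi> by (metis abs_ge_zero power2_abs power_mono)
        then have 2: "C * \<xi>\<^sup>2 \<le> C * (3 * t * M)\<^sup>2" using C(1) by (rule mult_left_mono)
        have 3: "real q * \<xi> \<le> real q * (- 2 * t * \<alpha> + t\<^sup>2 * M\<^sup>2)"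
          unfolding \<xi>_def using \<beta> by (intro mult_left_mono[of _ _ "real q"] add_left_mono mult_left_mono[of _ _ "t\<^sup>2"]) auto
        have "1 + real q * (- 2 * t * \<alpha> + t\<^sup>2 * M\<^sup>2) + C * (3 * t * M)\<^sup>2 = 1 + A * t\<^sup>2 - 2 * real q * t * \<alpha>"
          by (simp add: A_def algebra_simps power_mult_distrib)
        then show ?thesis using 1 2 3 by linarith
      qed
      finally show ?thesis using n by (simp add: \<alpha>_def algebra_simps)
    qed
    have Wc: "continuous_on UNIV (W a)" using UW[of a] by (auto simp: cube_test_def has_grad_continuous)
    have "(LINT x:K|H. norm (a + W a x) ^ (2 * q)) \<le> (LINT x:K|H.
        n ^ (2 * q) * (1 + A * t\<^sup>2) - (n ^ (2 * q) * (2 * real q * t / n\<^sup>2)) * (a \<bullet> w a x))"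
      using pt Wc wc[of a] by (intro K_LINT_mono continuous_intros)
    also have "\<dots> = n ^ (2 * q) * (1 + A * t\<^sup>2) * massK - (n ^ (2 * q) * (2 * real q * t / n\<^sup>2)) * n\<^sup>2"
      using wc[of a] False by (subst K_LINT_diff) (auto intro!: continuous_intros simp: mean_w n_def)
    also have "\<dots> = n ^ (2 * q) * (massK + t * (t * (A * massK)) - 2 * real q * t)"
      using n by (simp add: field_simps power2_eq_square)
    also have "\<dots> \<le> n ^ (2 * q) * (massK + t * real q - 2 * real q * t)"
      using t n by (intro mult_left_mono diff_right_mono add_left_mono) auto
    also have "\<dots> = \<theta> * n ^ (2 * q) * massK" using massK_pos by (simp add: \<theta>_def field_simps)
    finally show ?thesis by (simp add: n_def)
  qed
  show ?thesis
    using \<theta> M UW U_le W_le energy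
    by (intro exI[of _ \<theta>] exI[of _ M] exI[of _ U] exI[of _ W]) auto
qed

text \<open>The factor \<open>1 / l^n\<close> cancels the derivative of the scaling: gradients keep
  their size and values become small. An address in \<open>V n\<close> keeps the small cube inside
  the unit cube.\<close>

lemma rescaled_cube_test:
  assumes "cube_test u G" "v \<in> V n"
  shows "cube_test (\<lambda>x. (1 / real l ^ n) * u (real l ^ n *\<^sub>R x - v)) (\<lambda>x. G (real l ^ n *\<^sub>R x - v))"
  unfolding cube_test_def
proof (intro conjI allI impI)
  have "has_grad u G" using assms(1) by (simp add: cube_test_def)
  from has_grad_scale[OF has_grad_affine[OF this, where c = "real l ^ n" and w = "- v"], of "1 / real l ^ n"]
  show "has_grad (\<lambda>x. (1 / real l ^ n) * u (real l ^ n *\<^sub>R x - v)) (\<lambda>x. G (real l ^ n *\<^sub>R x - v))"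
    by simp
  fix x :: "real ^ 'n" assume x: "x \<notin> open_cube"
  have "real l ^ n *\<^sub>R x - v \<notin> open_cube"
  proof
    assume *: "real l ^ n *\<^sub>R x - v \<in> open_cube"
    have "0 < x $ k \<and> x $ k < 1" for k
    proof -
      have "0 < real l ^ n * x $ k - v $ k" "real l ^ n * x $ k - v $ k < 1"
        using * by (auto simp: open_cube_def)
      then have "0 < real l ^ n * x $ k" "real l ^ n * x $ k < real l ^ n"
        using V_bounds[OF assms(2), of k] by linarith+
      then show ?thesis by (simp add: zero_less_mult_iff)
    qed
    then show False using x by (simp add: open_cube_def)
  qed
  then show "(1 / real l ^ n) * u (real l ^ n *\<^sub>R x - v) = 0" "G (real l ^ n *\<^sub>R x - v) = 0"
    using assms(1) by (auto simp: cube_test_def)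
qed

lemma cell_in_cube:
  assumes "v \<in> V n" "y \<in> unit_cube" shows "cell n v y \<in> unit_cube"
proof -
  have "0 \<le> cell n v y $ k \<and> cell n v y $ k \<le> 1" for k
  proof -
    have "0 \<le> y $ k" "y $ k \<le> 1" using assms(2) by (auto simp: unit_cube_def)
    then show ?thesis using V_bounds[OF assms(1), of k] by (auto simp: field_simps)
  qed
  then show ?thesis by (simp add: unit_cube_def)
qed

text \<open>On a fine level the gradient \<open>e + G\<close> is almost constant on each cell, so
  the perturbation belonging to this constant vector is inserted there; supported in an open
  subcube, it leaves the other cells alone.\<close>

lemma energy_step:
  assumes \<theta>: "0 \<le> \<theta>" "\<theta> < 1" and M: "0 < M"
    and UW: "\<And>a. cube_test (U a) (W a)" and U_le: "\<And>a x. \<bar>U a x\<bar> \<le> M * norm a"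
    and W_le: "\<And>a x. norm (W a x) \<le> M * norm a"
    and contr: "\<And>a. (LINT x:K|H. norm (a + W a x) ^ (2 * q)) \<le> \<theta> * norm a ^ (2 * q) * massK"
    and PG: "cube_test P G" and \<epsilon>: "0 < \<epsilon>"
  shows "\<exists>P' G'. cube_test P' G' \<and> (\<forall>x. \<bar>P' x - P x\<bar> \<le> \<epsilon>) \<and>
    (LINT x:K|H. norm (e + G' x) ^ (2 * q)) \<le> \<theta> * (LINT x:K|H. norm (e + G x) ^ (2 * q)) + \<epsilon>"
proof -
  define m where "m = 2 * q"
  obtain MG where MG: "0 < MG" "\<And>x. norm (G x) \<le> MG"
    using cube_test_bounded[OF PG] by metis
  define B where "B = norm e + MG"
  have B: "0 < B" using MG(1) by (simp add: B_def add_nonneg_pos)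
  have eG: "norm (e + G x) \<le> B" for x
    using norm_triangle_ineq[of e "G x"] MG(2)[of x] by (simp add: B_def)
  \<comment> \<open>In each cell the gradient is frozen and later released; either replacement costs
    at most \<open>\<epsilon>1 * massK = \<epsilon> / 2\<close>.\<close>
  define \<epsilon>1 where "\<epsilon>1 = \<epsilon> / (2 * massK)"
  have \<epsilon>1: "0 < \<epsilon>1" using \<epsilon> massK_pos by (simp add: \<epsilon>1_def)
  have SB: "0 \<le> (1 + M) * B" using M B by simp
  obtain \<tau> where \<tau>: "0 < \<tau>" "\<And>s t. 0 \<le> s \<Longrightarrow> s \<le> (1 + M) * B \<Longrightarrow> 0 \<le> t \<Longrightarrow> t \<le> s + \<tau> \<Longrightarrow> t ^ m \<le> s ^ m + \<epsilon>1"
    using power_close[OF \<epsilon>1 SB, of m] by blast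
  have Gc: "continuous_on UNIV G" using PG by (auto simp: cube_test_def has_grad_continuous)
  have "uniformly_continuous_on unit_cube G"
    by (intro compact_uniformly_continuous continuous_on_subset[OF Gc]) (auto simp: unit_cube_eq_cbox)
  then obtain d where d: "0 < d" "\<And>x y. x \<in> unit_cube \<Longrightarrow> y \<in> unit_cube \<Longrightarrow> dist y x < d \<Longrightarrow> dist (G y) (G x) < \<tau>"
    unfolding uniformly_continuous_on_def using \<tau>(1) by metis
  define D where "D = real CARD('n)"
  have D: "0 < D" using finite_UNIV_card_ge_0[where 'a = 'n] by (simp add: D_def)
  \<comment> \<open>The first bound makes points of a small cube closer than \<open>d\<close> to its
    corner, the second makes the added functions at most \<epsilon>.\<close>
  obtain n where n: "(1 / real l) ^ n < min (d / D) (\<epsilon> / (M * B))"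
    using real_arch_pow_inv[of "min (d / D) (\<epsilon> / (M * B))" "1 / real l"] d(1) D \<epsilon> M B l3 by auto
  have n1: "1 / real l ^ n * D < d" "1 / real l ^ n * (M * B) \<le> \<epsilon>"
    using n D M B by (simp_all add: power_divide field_simps less_imp_le)
  \<comment> \<open>The gradient frozen at the corner of the small cube.\<close>
  define b where "b v = e + G (cell n v 0)" for v
  have b_le: "norm (b v) \<le> B" for v unfolding b_def by (rule eG)
  define P' where "P' x = P x + (\<Sum>v\<in>V n. (1 / real l ^ n) * U (b v) (real l ^ n *\<^sub>R x - v))" for x
  define G' where "G' x = G x + (\<Sum>v\<in>V n. W (b v) (real l ^ n *\<^sub>R x - v))" for x
  have PG': "cube_test P' G'"
    unfolding P'_def[abs_def] G'_def[abs_def]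
    by (intro cube_test_add PG cube_test_sum finite_V rescaled_cube_test UW)
  have diff: "\<bar>P' x - P x\<bar> \<le> \<epsilon>" for x
  proof -
    have "norm (\<Sum>v\<in>V n. (1 / real l ^ n) * U (b v) (real l ^ n *\<^sub>R x - v)) \<le> \<epsilon>"
    proof (rule norm_sum_one_nonzero[OF finite_V])
      fix v assume "v \<in> V n"
      have "\<bar>U (b v) (real l ^ n *\<^sub>R x - v)\<bar> \<le> M * B"
        using U_le[of "b v" "real l ^ n *\<^sub>R x - v"] mult_left_mono[OF b_le[of v], of M] M by linarith
      then have "1 / real l ^ n * \<bar>U (b v) (real l ^ n *\<^sub>R x - v)\<bar> \<le> 1 / real l ^ n * (M * B)"
        by (intro mult_left_mono) auto
      then show "norm ((1 / real l ^ n) * U (b v) (real l ^ n *\<^sub>R x - v)) \<le> \<epsilon>"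
        using n1(2) by (simp add: abs_mult)
    next
      fix v v' assume "v \<in> V n" "v' \<in> V n" "(1 / real l ^ n) * U (b v) (real l ^ n *\<^sub>R x - v) \<noteq> 0"
        "(1 / real l ^ n) * U (b v') (real l ^ n *\<^sub>R x - v') \<noteq> 0"
      then show "v = v'"
        using translated_tests_disjoint[of "\<lambda>v. U (b v)" "\<lambda>v. W (b v)" "V n", OF UW V_int_vecs] by auto
    qed (use \<epsilon> in auto)
    then show ?thesis by (simp add: P'_def)
  qed
  have G'_cell: "G' (cell n v y) = G (cell n v y) + W (b v) y" if v: "v \<in> V n" and y: "y \<in> K" for v y
  proof -
    have eq: "real l ^ n *\<^sub>R cell n v y - v' = y + (v - v')" for v'
      by (simp add: affine_scale_def)
    have "W (b v') (real l ^ n *\<^sub>R cell n v y - v') = 0" if "v' \<in> V n - {v}" for v'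
    proof -
      have "y + (v - v') \<notin> open_cube"
        using int_shift_not_in_open_cube[of y v v'] y v that K_sub_cube V_int_vecs by blast
      then show ?thesis unfolding eq using UW[of "b v'"] by (simp add: cube_test_def)
    qed
    then have "(\<Sum>v'\<in>V n. W (b v') (real l ^ n *\<^sub>R cell n v y - v')) = W (b v) (real l ^ n *\<^sub>R cell n v y - v)"
      using v finite_V by (subst sum.remove[OF finite_V v]) simp
    then show ?thesis unfolding G'_def by (simp only: eq) simp
  qed
  have near: "norm (G (cell n v y) - G (cell n v 0)) \<le> \<tau>" if v: "v \<in> V n" and y: "y \<in> K" for v y
  proof -
    have 0: "(0 :: real ^ 'n) \<in> unit_cube" by (simp add: unit_cube_def)
    have y': "y \<in> unit_cube" using y K_sub_cube by blast
    have "dist (cell n v y) (cell n v 0) = 1 / real l ^ n * norm y"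
      by (simp add: affine_scale_def dist_norm algebra_simps)
    also have "\<dots> \<le> 1 / real l ^ n * D"
      using K_norm_diff[OF y' 0] by (intro mult_left_mono) (auto simp: D_def)
    finally have "dist (cell n v y) (cell n v 0) < d" using n1(1) by linarith
    then show ?thesis
      using d(2)[OF cell_in_cube[OF v 0] cell_in_cube[OF v y']] by (simp add: dist_norm less_imp_le)
  qed
  have cc: "continuous_on UNIV (\<lambda>y. F (cell n v y))" if "continuous_on UNIV F" for v and F :: "real ^ 'n \<Rightarrow> real ^ 'n"
    by (rule continuous_on_compose2[OF that]) (auto intro!: continuous_intros)
  have Wc: "continuous_on UNIV (W a)" for a using UW[of a] by (auto simp: cube_test_def has_grad_continuous)
  have G'c: "continuous_on UNIV G'" using PG' by (auto simp: cube_test_def has_grad_continuous)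
  have cell_est: "(LINT y:K|H. norm (e + G' (cell n v y)) ^ m)
      \<le> \<theta> * (LINT y:K|H. norm (e + G (cell n v y)) ^ m) + \<epsilon>" if v: "v \<in> V n" for v
  proof -
    have "(LINT y:K|H. norm (e + G' (cell n v y)) ^ m) \<le> (LINT y:K|H. norm (b v + W (b v) y) ^ m + \<epsilon>1)"
    proof (intro K_LINT_mono continuous_intros cc G'c Wc)
      fix y assume y: "y \<in> K"
      have "e + G' (cell n v y) = (b v + W (b v) y) + (G (cell n v y) - G (cell n v 0))"
        by (simp add: G'_cell[OF v y] b_def)
      then have "norm (e + G' (cell n v y)) \<le> norm (b v + W (b v) y) + norm (G (cell n v y) - G (cell n v 0))"
        using norm_triangle_ineq[of "b v + W (b v) y" "G (cell n v y) - G (cell n v 0)"] by (simp only:)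
      then have "norm (e + G' (cell n v y)) \<le> norm (b v + W (b v) y) + \<tau>"
        using near[OF v y] by linarith
      moreover have "norm (b v + W (b v) y) \<le> (1 + M) * B"
      proof -
        have "norm (b v + W (b v) y) \<le> norm (b v) + M * norm (b v)"
          using norm_triangle_ineq[of "b v" "W (b v) y"] W_le[of "b v" y] by linarith
        also have "\<dots> \<le> B + M * B" using b_le[of v] M by (intro add_mono mult_left_mono) auto
        finally show ?thesis by (simp add: algebra_simps)
      qed
      ultimately show "norm (e + G' (cell n v y)) ^ m \<le> norm (b v + W (b v) y) ^ m + \<epsilon>1"
        by (intro \<tau>(2)) auto
    qed
    also have "\<dots> = (LINT y:K|H. norm (b v + W (b v) y) ^ m) + \<epsilon>1 * massK"
      by (subst K_LINT_add) (auto intro!: continuous_intros Wc)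
    also have "\<dots> \<le> \<theta> * norm (b v) ^ m * massK + \<epsilon>1 * massK"
      using contr[of "b v"] by (simp add: m_def)
    finally have 1: "(LINT y:K|H. norm (e + G' (cell n v y)) ^ m) \<le> \<theta> * (norm (b v) ^ m * massK) + \<epsilon>1 * massK"
      by (simp only: mult.assoc)
    have 2: "norm (b v) ^ m * massK \<le> (LINT y:K|H. norm (e + G (cell n v y)) ^ m) + \<epsilon>1 * massK"
    proof -
      have "norm (b v) ^ m * massK = (LINT y:K|H. norm (b v) ^ m)" by simp
      also have "\<dots> \<le> (LINT y:K|H. norm (e + G (cell n v y)) ^ m + \<epsilon>1)"
      proof (intro K_LINT_mono continuous_intros cc Gc)
        fix y assume y: "y \<in> K"
        have "b v = (e + G (cell n v y)) - (G (cell n v y) - G (cell n v 0))" by (simp add: b_def)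
        then have "norm (b v) \<le> norm (e + G (cell n v y)) + norm (G (cell n v y) - G (cell n v 0))"
          using norm_triangle_ineq4[of "e + G (cell n v y)" "G (cell n v y) - G (cell n v 0)"] by (simp only:)
        then have "norm (b v) \<le> norm (e + G (cell n v y)) + \<tau>"
          using near[OF v y] by linarith
        moreover have "B \<le> (1 + M) * B" using M B by simp
        ultimately show "norm (b v) ^ m \<le> norm (e + G (cell n v y)) ^ m + \<epsilon>1"
          using eG[of "cell n v y"] by (intro \<tau>(2)) auto
      qed
      also have "\<dots> = (LINT y:K|H. norm (e + G (cell n v y)) ^ m) + \<epsilon>1 * massK"
        by (subst K_LINT_add) (auto intro!: continuous_intros cc Gc)
      finally show ?thesis .
    qed
    have "(LINT y:K|H. norm (e + G' (cell n v y)) ^ m)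
        \<le> \<theta> * ((LINT y:K|H. norm (e + G (cell n v y)) ^ m) + \<epsilon>1 * massK) + \<epsilon>1 * massK"
      by (rule order_trans[OF 1 add_right_mono[OF mult_left_mono[OF 2 \<theta>(1)]]])
    moreover have "\<epsilon>1 * massK = \<epsilon> / 2" using massK_pos by (simp add: \<epsilon>1_def)
    moreover have "\<theta> * (\<epsilon> / 2) \<le> \<epsilon> / 2" using \<theta> \<epsilon> by simp
    ultimately show ?thesis by (simp add: distrib_left)
  qed
  have "(LINT x:K|H. norm (e + G' x) ^ m) = (\<Sum>v\<in>V n. 1 / real (card S) ^ n * (LINT y:K|H. norm (e + G' (cell n v y)) ^ m))"
    by (intro K_LINT_cells continuous_intros G'c) auto
  also have "\<dots> \<le> (\<Sum>v\<in>V n. 1 / real (card S) ^ n * (\<theta> * (LINT y:K|H. norm (e + G (cell n v y)) ^ m) + \<epsilon>))"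
    by (intro sum_mono mult_left_mono cell_est) auto
  also have "\<dots> = \<theta> * (\<Sum>v\<in>V n. 1 / real (card S) ^ n * (LINT y:K|H. norm (e + G (cell n v y)) ^ m))
      + (\<Sum>v\<in>V n. 1 / real (card S) ^ n * \<epsilon>)"
    by (simp only: sum_distrib_left sum.distrib[symmetric]) (simp add: algebra_simps)
  also have "(\<Sum>v\<in>V n. 1 / real (card S) ^ n * (LINT y:K|H. norm (e + G (cell n v y)) ^ m)) = (LINT x:K|H. norm (e + G x) ^ m)"
    by (intro K_LINT_cells[symmetric] continuous_intros Gc) auto
  also have "(\<Sum>v\<in>V n. 1 / real (card S) ^ n * \<epsilon>) = \<epsilon>" using card_S by (simp add: card_V)
  finally show ?thesis using PG' diff by (auto simp: m_def)
qed

text \<open>Each step multiplies the energy by \<theta>. With \<delta>/2 for the new step and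
  \<delta>/2 for all earlier ones, the accumulated errors stay below \<delta>, because \<theta> <
  1.\<close>

lemma small_energy:
  assumes q: "1 \<le> q" and \<epsilon>: "0 < \<epsilon>"
  shows "\<exists>P G. cube_test P G \<and> (\<forall>x. \<bar>P x\<bar> \<le> \<epsilon>) \<and> (LINT x:K|H. norm (e + G x) ^ (2 * q)) \<le> \<epsilon>"
proof -
  obtain \<theta> M U W where \<theta>: "0 \<le> \<theta>" "\<theta> < 1" and M: "0 < M"
    and UW: "\<And>a. cube_test (U a) (W a)" and U_le: "\<And>a x. \<bar>U a x\<bar> \<le> M * norm a"
    and W_le: "\<And>a x. norm (W a x) \<le> M * norm a"
    and contr: "\<And>a. (LINT x:K|H. norm (a + W a x) ^ (2 * q)) \<le> \<theta> * norm a ^ (2 * q) * massK"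
    using energy_contraction[OF q] by metis
  define E where "E = norm e ^ (2 * q) * massK"
  have it: "\<exists>P G. cube_test P G \<and> (\<forall>x. \<bar>P x\<bar> \<le> \<delta>) \<and>
      (LINT x:K|H. norm (e + G x) ^ (2 * q)) \<le> \<theta> ^ n * E + \<delta>" if "0 < \<delta>" for n \<delta>
    using that
  proof (induction n arbitrary: \<delta>)
    case 0
    then show ?case
      by (intro exI[of _ "\<lambda>x. 0"] conjI cube_test_zero) (auto simp: E_def)
  next
    case (Suc n)
    obtain P G where PG: "cube_test P G" "\<And>x. \<bar>P x\<bar> \<le> \<delta>/2"
      "(LINT x:K|H. norm (e + G x) ^ (2 * q)) \<le> \<theta> ^ n * E + \<delta>/2"
      using Suc.IH[of "\<delta>/2"] Suc.prems by auto
    obtain P' G' where PG': "cube_test P' G'" "\<And>x. \<bar>P' x - P x\<bar> \<le> \<delta>/2"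
      "(LINT x:K|H. norm (e + G' x) ^ (2 * q)) \<le> \<theta> * (LINT x:K|H. norm (e + G x) ^ (2 * q)) + \<delta>/2"
      using energy_step[where e = e and \<epsilon> = "\<delta>/2", OF \<theta> M UW U_le W_le contr PG(1)] Suc.prems by auto
    have "\<bar>P' x\<bar> \<le> \<delta>" for x using PG(2)[of x] PG'(2)[of x] by linarith
    moreover have "\<theta> * (LINT x:K|H. norm (e + G x) ^ (2 * q)) \<le> \<theta> * (\<theta> ^ n * E + \<delta>/2)"
      using PG(3) \<theta> by (intro mult_left_mono)
    moreover have "\<theta> * (\<delta>/2) \<le> \<delta>/2" using \<theta> Suc.prems by simp
    ultimately show ?case using PG'(1,3)
      by (intro exI[of _ P'] exI[of _ G']) (auto simp: algebra_simps)
  qed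
  have "(\<lambda>n. \<theta> ^ n * E) \<longlonglongrightarrow> 0 * E"
    using \<theta> by (intro tendsto_intros LIMSEQ_realpow_zero) auto
  then have "\<forall>\<^sub>F n in sequentially. \<theta> ^ n * E < \<epsilon>/2"
    by (rule order_tendstoD(2)) (use \<epsilon> in simp)
  then obtain n where n: "\<theta> ^ n * E < \<epsilon>/2" by (auto simp: eventually_sequentially)
  obtain P G where PG: "cube_test P G" "\<And>x. \<bar>P x\<bar> \<le> \<epsilon>/2"
      "(LINT x:K|H. norm (e + G x) ^ (2 * q)) \<le> \<theta> ^ n * E + \<epsilon>/2"
    using it[of "\<epsilon>/2" n] \<epsilon> by auto
  have "\<bar>P x\<bar> \<le> \<epsilon>" for x using PG(2)[of x] \<epsilon> by linarith
  then show ?thesis using PG(1,3) n by (intro exI[of _ P] exI[of _ G]) auto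
qed

text \<open>With \<open>p \<le> 2 * q\<close>, a norm below \<delta> contributes at most
  \<open>\<delta> powr p\<close>, and above \<delta> the power \<open>s powr p\<close> is at most a
  constant times \<open>s ^ (2 * q)\<close>.\<close>

lemma small_energy_powr:
  assumes p: "1 \<le> p" and \<epsilon>: "0 < \<epsilon>"
  shows "\<exists>P G. cube_test P G \<and> (\<forall>x. \<bar>P x\<bar> \<le> \<epsilon>) \<and> (\<integral>\<^sup>+x\<in>K. ennreal (norm (e + G x) powr p) \<partial>H) \<le> ennreal \<epsilon>"
proof -
  define q where "q = nat \<lceil>p\<rceil>"
  have q: "1 \<le> q" "p \<le> real (2 * q)" using p by (auto simp: q_def) linarith+
  define \<delta> where "\<delta> = (\<epsilon> / (2 * massK)) powr (1 / p)"
  have \<delta>: "0 < \<delta>" "\<delta> powr p * massK = \<epsilon> / 2"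
    using \<epsilon> massK_pos p by (auto simp: \<delta>_def powr_powr)
  define c where "c = \<delta> powr (p - real (2 * q))"
  have c: "0 < c" using \<delta> by (simp add: c_def)
  have pt: "s powr p \<le> \<delta> powr p + c * s ^ (2 * q)" if "0 \<le> s" for s
  proof (cases "s \<le> \<delta>")
    case True
    then have "s powr p \<le> \<delta> powr p" using that p by (intro powr_mono2) auto
    then show ?thesis using c that by (simp add: add_increasing2)
  next
    case False
    then have s: "0 < s" "\<delta> < s" using \<delta> by auto
    have "s powr p = s powr (p - real (2 * q)) * s powr real (2 * q)"
      by (simp add: powr_add[symmetric])
    also have "\<dots> \<le> c * s powr real (2 * q)"
      unfolding c_def using s \<delta> q by (intro mult_right_mono powr_mono2') auto
    also have "s powr real (2 * q) = s ^ (2 * q)" using s(1) by (rule powr_realpow)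
    finally show ?thesis by (simp add: add_increasing)
  qed
  obtain P G where PG: "cube_test P G" "\<And>x. \<bar>P x\<bar> \<le> min \<epsilon> (\<epsilon> / (2 * c))"
      "(LINT x:K|H. norm (e + G x) ^ (2 * q)) \<le> min \<epsilon> (\<epsilon> / (2 * c))"
    using small_energy[OF q(1), of "min \<epsilon> (\<epsilon> / (2 * c))" e] \<epsilon> c by auto
  have Gc: "continuous_on UNIV G" using PG(1) by (auto simp: cube_test_def has_grad_continuous)
  have "(\<integral>\<^sup>+x\<in>K. ennreal (norm (e + G x) powr p) \<partial>H) \<le> (\<integral>\<^sup>+x\<in>K. ennreal (\<delta> powr p + c * norm (e + G x) ^ (2 * q)) \<partial>H)"
    using pt by (intro nn_integral_mono mult_right_mono ennreal_leI) auto
  also have "\<dots> = ennreal (LINT x:K|H. \<delta> powr p + c * norm (e + G x) ^ (2 * q))"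
    using c by (intro nn_integral_K_eq_LINT continuous_intros Gc) auto
  also have "(LINT x:K|H. \<delta> powr p + c * norm (e + G x) ^ (2 * q)) = \<epsilon>/2 + c * (LINT x:K|H. norm (e + G x) ^ (2 * q))"
    by (subst K_LINT_add) (auto intro!: continuous_intros Gc simp: \<delta>(2))
  also have "ennreal \<dots> \<le> ennreal \<epsilon>"
  proof (rule ennreal_leI)
    have "c * (LINT x:K|H. norm (e + G x) ^ (2 * q)) \<le> c * (\<epsilon> / (2 * c))"
      using PG(3) c by (intro mult_left_mono) auto
    then show "\<epsilon>/2 + c * (LINT x:K|H. norm (e + G x) ^ (2 * q)) \<le> \<epsilon>" using c by simp
  qed
  finally show ?thesis using PG(1,2) by (intro exI[of _ P] exI[of _ G]) auto
qed

end

section \<open>Arc length\<close>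

text \<open>The sum inside \<open>curve_length\<close>, isolated so that it can be treated by
  recursion on the list; the truncated subtraction makes it \<open>0\<close> for the empty
  list.\<close>

definition chain_length :: "'a metric \<Rightarrow> (real \<Rightarrow> 'a) \<Rightarrow> real list \<Rightarrow> ennreal" where
  "chain_length X \<gamma> ts = (\<Sum>i<length ts - 1. ennreal (mdist X (\<gamma> (ts ! i)) (\<gamma> (ts ! Suc i))))"

lemma chain_length_simps [simp]:
  "chain_length X \<gamma> [] = 0"
  "chain_length X \<gamma> [x] = 0"
  "chain_length X \<gamma> (x # y # zs) = ennreal (mdist X (\<gamma> x) (\<gamma> y)) + chain_length X \<gamma> (y # zs)"
  by (simp_all add: chain_length_def sum.lessThan_Suc_shift del: sum.lessThan_Suc sum_ennreal)

lemma curve_length_eq: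
  "curve_length X \<gamma> J = (SUP ts\<in>{ts. sorted ts \<and> set ts \<subseteq> J}. chain_length X \<gamma> ts)"
  by (simp add: curve_length_def chain_length_def)

lemma chain_length_append:
  "chain_length X \<gamma> (xs @ [c]) + chain_length X \<gamma> (c # ys) = chain_length X \<gamma> (xs @ c # ys)"
proof (induction xs)
  case (Cons x xs)
  then show ?case by (cases xs) (simp_all add: add.assoc)
qed simp

lemma chain_length_Cons_le: "chain_length X \<gamma> ys \<le> chain_length X \<gamma> (c # ys)"
  by (cases ys) simp_all

lemma chain_length_snoc_le: "chain_length X \<gamma> xs \<le> chain_length X \<gamma> (xs @ [c])"
proof (induction xs)
  case (Cons x xs)
  then show ?case by (cases xs) (simp_all add: add_left_mono)
qed simp

lemma chain_length_insert_le:
  assumes "\<gamma> ` (set xs \<union> set ys \<union> {c}) \<subseteq> mspace X"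
  shows "chain_length X \<gamma> (xs @ ys) \<le> chain_length X \<gamma> (xs @ c # ys)"
  using assms
proof (induction xs)
  case Nil
  then show ?case by (simp add: chain_length_Cons_le)
next
  case (Cons x xs)
  show ?case
  proof (cases xs)
    case Nil
    show ?thesis
    proof (cases ys)
      case (Cons y zs)
      have "mdist X (\<gamma> x) (\<gamma> y) \<le> mdist X (\<gamma> x) (\<gamma> c) + mdist X (\<gamma> c) (\<gamma> y)"
        using Cons Cons.prems Nil by (intro mdist_triangle) auto
      then have "ennreal (mdist X (\<gamma> x) (\<gamma> y)) \<le> ennreal (mdist X (\<gamma> x) (\<gamma> c)) + ennreal (mdist X (\<gamma> c) (\<gamma> y))"
        by (simp add: ennreal_plus[symmetric] ennreal_leI del: ennreal_plus)
      then show ?thesis using Cons Nil by (simp add: add.assoc[symmetric] add_right_mono)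
    qed (simp add: Nil)
  next
    case (Cons z zs)
    then show ?thesis using Cons.IH Cons.prems by (simp add: add_left_mono)
  qed
qed

lemma curve_length_mono: "I \<subseteq> J \<Longrightarrow> curve_length X \<gamma> I \<le> curve_length X \<gamma> J"
  unfolding curve_length_eq by (rule SUP_subset_mono) auto

lemma curve_length_upper:
  "sorted ts \<Longrightarrow> set ts \<subseteq> J \<Longrightarrow> chain_length X \<gamma> ts \<le> curve_length X \<gamma> J"
  unfolding curve_length_eq by (rule SUP_upper) auto

text \<open>Inserting \<open>c\<close> into a partition does not shorten its chain, and a chain
  through \<open>c\<close> splits there.\<close>

lemma curve_length_add:
  assumes \<gamma>: "\<gamma> ` {a..b} \<subseteq> mspace X" and c: "a \<le> c" "c \<le> b"
  shows "curve_length X \<gamma> {a..c} + curve_length X \<gamma> {c..b} = curve_length X \<gamma> {a..b}"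
proof (rule antisym)
  have ne: "{ts. sorted ts \<and> set ts \<subseteq> J} \<noteq> {}" for J :: "real set"
    by (auto intro!: exI[of _ "[]"])
  have "chain_length X \<gamma> xs + chain_length X \<gamma> ys \<le> curve_length X \<gamma> {a..b}"
    if xs: "sorted xs" "set xs \<subseteq> {a..c}" and ys: "sorted ys" "set ys \<subseteq> {c..b}" for xs ys
  proof -
    have "chain_length X \<gamma> xs + chain_length X \<gamma> ys \<le> chain_length X \<gamma> (xs @ [c]) + chain_length X \<gamma> (c # ys)"
      by (intro add_mono chain_length_snoc_le chain_length_Cons_le)
    also have "\<dots> = chain_length X \<gamma> (xs @ c # ys)" by (rule chain_length_append)
    also have "\<dots> \<le> curve_length X \<gamma> {a..b}"
      using xs ys c by (intro curve_length_upper) (force simp: sorted_append)+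
    finally show ?thesis .
  qed
  then show "curve_length X \<gamma> {a..c} + curve_length X \<gamma> {c..b} \<le> curve_length X \<gamma> {a..b}"
    unfolding curve_length_eq[of X \<gamma> "{a..c}"] curve_length_eq[of X \<gamma> "{c..b}"]
    by (simp only: ennreal_SUP_add_left[OF ne, symmetric] ennreal_SUP_add_right[OF ne])
      (auto intro!: SUP_least)
  show "curve_length X \<gamma> {a..b} \<le> curve_length X \<gamma> {a..c} + curve_length X \<gamma> {c..b}"
    unfolding curve_length_eq[of X \<gamma> "{a..b}"]
  proof (rule SUP_least)
    fix ts assume "ts \<in> {ts. sorted ts \<and> set ts \<subseteq> {a..b}}"
    then have ts: "sorted ts" "set ts \<subseteq> {a..b}" by auto
    define xs where "xs = takeWhile (\<lambda>t. t \<le> c) ts"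
    define ys where "ys = dropWhile (\<lambda>t. t \<le> c) ts"
    have eq: "ts = xs @ ys" by (simp add: xs_def ys_def)
    have xs: "set xs \<subseteq> {a..c}"
    proof
      fix x assume "x \<in> set xs"
      then have "x \<in> set ts \<and> x \<le> c" unfolding xs_def by (rule set_takeWhileD)
      then show "x \<in> {a..c}" using ts(2) by auto
    qed
    have so: "sorted xs" "sorted ys" using ts(1) unfolding eq by (auto simp: sorted_append)
    have ys: "set ys \<subseteq> {c..b}"
    proof
      fix y assume y: "y \<in> set ys"
      then have "ys \<noteq> []" by auto
      then have "c < hd ys" unfolding ys_def using hd_dropWhile[of "\<lambda>t. t \<le> c" ts] by auto
      moreover have "hd ys \<le> y" using so(2) y \<open>ys \<noteq> []\<close> by (cases ys) auto
      ultimately show "y \<in> {c..b}" using y ts(2) unfolding eq by auto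
    qed
    have "chain_length X \<gamma> ts \<le> chain_length X \<gamma> (xs @ c # ys)"
      unfolding eq using ts(2) eq c \<gamma> by (intro chain_length_insert_le) (auto simp: subset_iff)
    also have "\<dots> = chain_length X \<gamma> (xs @ [c]) + chain_length X \<gamma> (c # ys)"
      by (rule chain_length_append[symmetric])
    also have "\<dots> \<le> curve_length X \<gamma> {a..c} + curve_length X \<gamma> {c..b}"
      using xs ys so c by (intro add_mono curve_length_upper) (force simp: sorted_append)+
    finally show "chain_length X \<gamma> ts \<le> curve_length X \<gamma> {a..c} + curve_length X \<gamma> {c..b}" .
  qed
qed

lemma chain_length_map:
  "chain_length X \<gamma> (map f ts) = ennreal (\<Sum>i<length ts - 1. mdist X (\<gamma> (f (ts ! i))) (\<gamma> (f (ts ! Suc i))))"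
  unfolding chain_length_def by (simp add: sum_nonneg)

text \<open>A fixed partition nearly attains the length on \<open>J t0\<close>; clamping its points
  into \<open>J t\<close> by \<open>f t\<close> gives a partition of \<open>J t\<close> whose chain
  depends continuously on \<open>t\<close>. The choices \<open>min\<close> and \<open>max\<close>
  for \<open>f\<close> treat initial and final segments alike.\<close>

lemma curve_length_lsc:
  assumes \<gamma>: "continuous_map (top_of_set {a..b}) (mtopology_of X) \<gamma>"
    and f: "\<And>t. t \<in> {a..b} \<Longrightarrow> mono (f t)" "\<And>t u. t \<in> {a..b} \<Longrightarrow> u \<in> {a..b} \<Longrightarrow> f t u \<in> J t"
      "\<And>t. t \<in> {a..b} \<Longrightarrow> J t \<subseteq> {a..b}" "\<And>u. continuous_on {a..b} (\<lambda>t. f t u)"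
      "\<And>u. u \<in> J t0 \<Longrightarrow> f t0 u = u"
    and fin: "curve_length X \<gamma> {a..b} < \<infinity>" and t0: "t0 \<in> {a..b}" and \<epsilon>: "0 < \<epsilon>"
  shows "\<exists>\<delta>>0. \<forall>t\<in>{a..b}. \<bar>t - t0\<bar> < \<delta> \<longrightarrow>
    enn2real (curve_length X \<gamma> (J t0)) - \<epsilon> < enn2real (curve_length X \<gamma> (J t))"
proof -
  have fin': "curve_length X \<gamma> (J t) < top" if "t \<in> {a..b}" for t
    using curve_length_mono[OF f(3)[OF that], of X \<gamma>] fin by (simp add: order_le_less_trans)
  define L where "L = enn2real (curve_length X \<gamma> (J t0))"
  have L: "curve_length X \<gamma> (J t0) = ennreal L" using fin'[OF t0] by (simp add: L_def)
  \<comment> \<open>A negative \<open>L - \<epsilon>\<close> is treated apart, since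
    \<open>ennreal\<close> would turn it into \<open>0\<close>.\<close>
  have "\<exists>ts. sorted ts \<and> set ts \<subseteq> J t0 \<and> ennreal (L - \<epsilon>) < chain_length X \<gamma> ts \<or> L - \<epsilon> < 0"
  proof (cases "L - \<epsilon> < 0")
    case False
    then have "ennreal (L - \<epsilon>) < curve_length X \<gamma> (J t0)"
      unfolding L using \<epsilon> by (intro ennreal_lessI) auto
    then show ?thesis unfolding curve_length_eq less_SUP_iff by auto
  qed auto
  then consider "L - \<epsilon> < 0" | ts where "sorted ts" "set ts \<subseteq> J t0" "ennreal (L - \<epsilon>) < chain_length X \<gamma> ts" "0 \<le> L - \<epsilon>"
    by (meson not_le)
  then show ?thesis
  proof cases
    case 1
    have "L - \<epsilon> < enn2real x" for x using 1 enn2real_nonneg[of x] by linarith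
    then show ?thesis by (intro exI[of _ 1]) (simp add: L_def)
  next
    case 2
    define \<Phi> where "\<Phi> t = (\<Sum>i<length ts - 1. mdist X (\<gamma> (f t (ts ! i))) (\<gamma> (f t (ts ! Suc i))))" for t
    have tsJ: "ts ! i \<in> J t0" "ts ! i \<in> {a..b}" if "i < length ts" for i
      using 2(2) that f(3)[OF t0] by (auto simp: subset_iff)
    have cf: "continuous_map (top_of_set {a..b}) (mtopology_of X) (\<lambda>t. \<gamma> (f t u))" if u: "u \<in> {a..b}" for u
    proof -
      have "continuous_map (top_of_set {a..b}) (top_of_set {a..b}) (\<lambda>t. f t u)"
        using f(4)[of u] f(2)[OF _ u] f(3) by (fastforce simp: continuous_map_in_subtopology)
      from continuous_map_compose[OF this \<gamma>] show ?thesis by (simp only: comp_def)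
    qed
    have "continuous_on {a..b} (\<lambda>t. mdist X (\<gamma> (f t u)) (\<gamma> (f t v)))" if "u \<in> {a..b}" "v \<in> {a..b}" for u v
      using continuous_map_mdist[OF cf[OF that(1)] cf[OF that(2)]] by simp
    then have "continuous_on {a..b} \<Phi>"
      unfolding \<Phi>_def[abs_def] using tsJ(2) by (intro continuous_on_sum) simp
    moreover have "\<Phi> t0 = (\<Sum>i<length ts - 1. mdist X (\<gamma> (ts ! i)) (\<gamma> (ts ! Suc i)))"
      unfolding \<Phi>_def using tsJ(1) f(5) by (intro sum.cong refl) simp
    then have "ennreal (\<Phi> t0) = chain_length X \<gamma> ts"
      using chain_length_map[of X \<gamma> "\<lambda>x. x" ts] by simp
    then have "L - \<epsilon> < \<Phi> t0" using 2(3,4) by (metis ennreal_less_iff)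
    then have pos: "0 < \<Phi> t0 - (L - \<epsilon>)" by simp
    ultimately obtain \<delta> where \<delta>: "0 < \<delta>" "\<And>t. t \<in> {a..b} \<Longrightarrow> dist t t0 < \<delta> \<Longrightarrow> dist (\<Phi> t) (\<Phi> t0) < \<Phi> t0 - (L - \<epsilon>)"
      using t0 unfolding continuous_on_iff by metis
    show ?thesis
    proof (intro exI[of _ \<delta>] conjI \<delta>(1) ballI impI)
      fix t assume t: "t \<in> {a..b}" "\<bar>t - t0\<bar> < \<delta>"
      then have "L - \<epsilon> < \<Phi> t" using \<delta>(2)[of t] by (simp add: dist_real_def abs_less_iff)
      moreover have "ennreal (\<Phi> t) \<le> curve_length X \<gamma> (J t)"
      proof -
        have "sorted (map (f t) ts)" using f(1)[OF t(1)] 2(1) by (rule sorted_map_mono[rotated, OF mono_imp_mono_on])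
        moreover have "set (map (f t) ts) \<subseteq> J t"
          using f(2)[OF t(1)] f(3)[OF t0] 2(2) by auto
        ultimately have "chain_length X \<gamma> (map (f t) ts) \<le> curve_length X \<gamma> (J t)"
          by (rule curve_length_upper)
        then show ?thesis by (simp add: chain_length_map \<Phi>_def)
      qed
      then have "\<Phi> t \<le> enn2real (curve_length X \<gamma> (J t))"
        using ennreal_le_iff[of "enn2real (curve_length X \<gamma> (J t))" "\<Phi> t"] fin'[OF t(1)] by simp
      ultimately show "enn2real (curve_length X \<gamma> (J t0)) - \<epsilon> < enn2real (curve_length X \<gamma> (J t))"
        by (simp add: L_def)
    qed
  qed
qed

text \<open>The lengths up to \<open>t\<close> and from \<open>t\<close> on are both lower
  semicontinuous and have a constant sum, so both are continuous.\<close>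

lemma continuous_on_curve_length:
  assumes \<gamma>: "continuous_map (top_of_set {a..b}) (mtopology_of X) \<gamma>"
    and fin: "curve_length X \<gamma> {a..b} < \<infinity>"
  shows "continuous_on {a..b} (\<lambda>t. enn2real (curve_length X \<gamma> {a..t}))"
  unfolding continuous_on_iff
proof (intro ballI allI impI)
  fix t0 \<epsilon> :: real assume t0: "t0 \<in> {a..b}" and \<epsilon>: "0 < \<epsilon>"
  define s where "s t = enn2real (curve_length X \<gamma> {a..t})" for t
  define r where "r t = enn2real (curve_length X \<gamma> {t..b})" for t
  have im: "\<gamma> ` {a..b} \<subseteq> mspace X" using continuous_map_image_subset_topspace[OF \<gamma>] by simp
  have sum: "s t + r t = enn2real (curve_length X \<gamma> {a..b})" if "t \<in> {a..b}" for t
  proof -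
    have "curve_length X \<gamma> {a..t} < top" "curve_length X \<gamma> {t..b} < top"
      using that fin curve_length_mono[of "{a..t}" "{a..b}" X \<gamma>] curve_length_mono[of "{t..b}" "{a..b}" X \<gamma>]
      by (auto simp: order_le_less_trans)
    then show ?thesis
      using curve_length_add[OF im, of t] that by (simp add: s_def r_def enn2real_plus[symmetric])
  qed
  have "\<exists>\<delta>>0. \<forall>t\<in>{a..b}. \<bar>t - t0\<bar> < \<delta> \<longrightarrow> s t0 - \<epsilon> < s t"
    unfolding s_def
    by (rule curve_length_lsc[OF \<gamma>, where f = min and J = "\<lambda>t. {a..t}"])
      (use t0 \<epsilon> fin in \<open>auto intro!: continuous_intros monoI\<close>)
  then obtain d1 where d1: "0 < d1" "\<And>t. t \<in> {a..b} \<Longrightarrow> \<bar>t - t0\<bar> < d1 \<Longrightarrow> s t0 - \<epsilon> < s t" by blast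
  have "\<exists>\<delta>>0. \<forall>t\<in>{a..b}. \<bar>t - t0\<bar> < \<delta> \<longrightarrow> r t0 - \<epsilon> < r t"
    unfolding r_def
    by (rule curve_length_lsc[OF \<gamma>, where f = max and J = "\<lambda>t. {t..b}"])
      (use t0 \<epsilon> fin in \<open>auto intro!: continuous_intros monoI\<close>)
  then obtain d2 where d2: "0 < d2" "\<And>t. t \<in> {a..b} \<Longrightarrow> \<bar>t - t0\<bar> < d2 \<Longrightarrow> r t0 - \<epsilon> < r t" by blast
  show "\<exists>d>0. \<forall>t\<in>{a..b}. dist t t0 < d \<longrightarrow> dist (s t) (s t0) < \<epsilon>"
  proof (intro exI[of _ "min d1 d2"] conjI ballI impI)
    fix t assume t: "t \<in> {a..b}" "dist t t0 < min d1 d2"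
    then have "s t0 - \<epsilon> < s t" "r t0 - \<epsilon> < r t"
      using d1(2)[of t] d2(2)[of t] by (auto simp: dist_real_def)
    then show "dist (s t) (s t0) < \<epsilon>" using sum[OF t(1)] sum[OF t0] by (simp add: dist_real_def)
  qed (use d1 d2 in auto)
qed

text \<open>Parameters of equal arc length give the same point, so a function as required by the
  choice in \<open>arclength_param\<close> exists; continuity of the arc length makes it attain all
  values in \<open>[0, L]\<close>.\<close>

lemma arclength_param_props:
  assumes \<gamma>: "continuous_map (top_of_set {a..b}) (mtopology_of X) \<gamma>"
    and fin: "curve_length X \<gamma> {a..b} < \<infinity>" and ab: "a \<le> b"
  defines "L \<equiv> enn2real (curve_length X \<gamma> {a..b})"
  defines "g \<equiv> arclength_param X \<gamma> a b"
  shows "g ` {0..L} \<subseteq> \<gamma> ` {a..b}" "g 0 = \<gamma> a" "g L = \<gamma> b"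
    "\<And>u v. u \<in> {0..L} \<Longrightarrow> v \<in> {0..L} \<Longrightarrow> mdist X (g u) (g v) \<le> \<bar>u - v\<bar>"
proof -
  define s where "s t = enn2real (curve_length X \<gamma> {a..t})" for t
  have im: "\<gamma> ` {a..b} \<subseteq> mspace X" using continuous_map_image_subset_topspace[OF \<gamma>] by simp
  have fin': "curve_length X \<gamma> {x..y} < top" if "a \<le> x" "y \<le> b" for x y
    using that fin curve_length_mono[of "{x..y}" "{a..b}" X \<gamma>] by (auto simp: order_le_less_trans)
  have step: "mdist X (\<gamma> t) (\<gamma> t') \<le> s t' - s t" if t: "a \<le> t" "t \<le> t'" "t' \<le> b" for t t'
  proof -
    have "curve_length X \<gamma> {a..t} + curve_length X \<gamma> {t..t'} = curve_length X \<gamma> {a..t'}"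
      using im t by (intro curve_length_add) auto
    moreover have "ennreal (mdist X (\<gamma> t) (\<gamma> t')) \<le> curve_length X \<gamma> {t..t'}"
      using curve_length_upper[of "[t, t']" "{t..t'}" X \<gamma>] t by simp
    then have "mdist X (\<gamma> t) (\<gamma> t') \<le> enn2real (curve_length X \<gamma> {t..t'})"
      using fin'[of t t'] t by (metis enn2real_ennreal enn2real_mono mdist_nonneg)
    moreover have "curve_length X \<gamma> {a..t} < top" "curve_length X \<gamma> {t..t'} < top"
      using fin'[of a t] fin'[of t t'] t by auto
    ultimately show ?thesis
      unfolding s_def using enn2real_plus[of "curve_length X \<gamma> {a..t}" "curve_length X \<gamma> {t..t'}"] by simp
  qed
  have eq: "\<gamma> t = \<gamma> t'" if t: "t \<in> {a..b}" "t' \<in> {a..b}" "s t = s t'" for t t'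
  proof -
    have "mdist X (\<gamma> t) (\<gamma> t') = 0"
    proof (cases "t \<le> t'")
      case True
      then show ?thesis using step[of t t'] t mdist_nonneg[of X "\<gamma> t" "\<gamma> t'"] by simp
    next
      case False
      then show ?thesis
        using step[of t' t] t mdist_nonneg[of X "\<gamma> t'" "\<gamma> t"] by (simp add: mdist_commute)
    qed
    moreover have "\<gamma> t \<in> mspace X" "\<gamma> t' \<in> mspace X" using im t by blast+
    ultimately show ?thesis using mdist_zero by metis
  qed
  define g0 where "g0 u = \<gamma> (SOME t. t \<in> {a..b} \<and> s t = u)" for u
  have "g0 (s t) = \<gamma> t" if "t \<in> {a..b}" for t
  proof -
    have "(SOME t'. t' \<in> {a..b} \<and> s t' = s t) \<in> {a..b} \<and> s (SOME t'. t' \<in> {a..b} \<and> s t' = s t) = s t"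
      by (rule someI[of _ t]) (use that in simp)
    then show ?thesis unfolding g0_def using that by (intro eq) auto
  qed
  then have ex: "\<exists>g. \<forall>t\<in>{a..b}. g (s t) = \<gamma> t" by blast
  have g: "g (s t) = \<gamma> t" if "t \<in> {a..b}" for t
    using someI_ex[OF ex] that unfolding g_def arclength_param_def s_def by blast
  have s0: "s a = 0"
  proof -
    have "chain_length X \<gamma> ts = 0" if "set ts \<subseteq> {a}" for ts
    proof -
      have "ts ! i = a" if "i < length ts" for i
        using nth_mem[OF that] \<open>set ts \<subseteq> {a}\<close> by auto
      moreover have "mdist X (\<gamma> a) (\<gamma> a) = 0" using im ab by (auto intro!: mdist_zero[THEN iffD2])
      ultimately show ?thesis unfolding chain_length_def by (intro sum.neutral) auto
    qed
    then have "curve_length X \<gamma> {a..a} \<le> 0"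
      unfolding curve_length_eq by (intro SUP_least) auto
    then show ?thesis by (simp add: s_def)
  qed
  have sL: "s b = L" by (simp add: s_def L_def)
  have surj: "\<exists>t\<in>{a..b}. s t = u" if "u \<in> {0..L}" for u
  proof -
    have "\<exists>x\<ge>a. x \<le> b \<and> s x = u"
      using that ab s0 sL continuous_on_curve_length[OF \<gamma> fin]
      by (intro IVT') (auto simp: s_def[abs_def])
    then show ?thesis by auto
  qed
  show "g ` {0..L} \<subseteq> \<gamma> ` {a..b}"
  proof
    fix z assume "z \<in> g ` {0..L}"
    then obtain u where "u \<in> {0..L}" "z = g u" by blast
    then obtain t where "t \<in> {a..b}" "s t = u" using surj by blast
    then show "z \<in> \<gamma> ` {a..b}" using g[of t] \<open>z = g u\<close> by auto
  qed
  show "g 0 = \<gamma> a" using g[of a] s0 ab by simp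
  show "g L = \<gamma> b" using g[of b] sL ab by simp
  fix u v assume uv: "u \<in> {0..L}" "v \<in> {0..L}"
  obtain t t' where t: "t \<in> {a..b}" "s t = u" "t' \<in> {a..b}" "s t' = v" using surj uv by metis
  have gu: "g u = \<gamma> t" "g v = \<gamma> t'" using g t by auto
  show "mdist X (g u) (g v) \<le> \<bar>u - v\<bar>"
  proof (cases "t \<le> t'")
    case True
    then show ?thesis using step[of t t'] t gu by auto
  next
    case False
    then show ?thesis using step[of t' t] t gu by (auto simp: mdist_commute)
  qed
qed


section \<open>Upper gradients along curves\<close>

text \<open>As \<open>f\<close> is merely Lipschitz, differentiating the composition is avoided:
  near each parameter the differentiability of \<open>U\<close> and the continuity of the integrand
  give the estimate up to \<epsilon>, and bisection makes it global.\<close>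

lemma lipschitz_upper_gradient:
  fixes f :: "real \<Rightarrow> real ^ 'n"
  assumes U: "has_grad U G" and C: "0 \<le> C" and L: "0 \<le> L"
    and f: "\<And>u v. u \<in> {0..L} \<Longrightarrow> v \<in> {0..L} \<Longrightarrow> norm (f u - f v) \<le> C * \<bar>u - v\<bar>"
  shows "ennreal \<bar>U (f L) - U (f 0)\<bar> \<le> (\<integral>\<^sup>+u\<in>{0..L}. ennreal (C * norm (G (f u))) \<partial>lborel)"
proof -
  define \<phi> where "\<phi> u = C * norm (G (f u))" for u
  have fc: "continuous_on {0..L} f"
  proof (rule continuous_on_subset[OF lipschitz_on_continuous_on[of C], of "{0..L}"])
    show "C-lipschitz_on {0..L} f"
      using C f by (intro lipschitz_onI) (auto simp: dist_norm dist_real_def)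
  qed auto
  have \<phi>c: "continuous_on {0..L} \<phi>"
    unfolding \<phi>_def[abs_def]
    by (intro continuous_intros continuous_on_compose2[OF has_grad_continuous(1)[OF U] fc]) auto
  have int: "\<phi> integrable_on {a..b}" if "0 \<le> a" "b \<le> L" for a b
    using \<phi>c that by (intro integrable_continuous_real continuous_on_subset[OF \<phi>c]) auto
  have bound: "\<bar>U (f L) - U (f 0)\<bar> \<le> integral {0..L} \<phi> + \<epsilon> * L" if \<epsilon>: "0 < \<epsilon>" for \<epsilon>
  proof -
    define P where "P a b \<longleftrightarrow> (0 \<le> a \<and> b \<le> L \<longrightarrow> \<bar>U (f b) - U (f a)\<bar> \<le> integral {a..b} \<phi> + \<epsilon> * (b - a))" for a b
    have "P 0 L" using L
    proof (induction rule: Bolzano)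
      case (trans a b c)
      show ?case unfolding P_def
      proof (intro impI)
        assume ac: "0 \<le> a \<and> c \<le> L"
        have "\<bar>U (f b) - U (f a)\<bar> \<le> integral {a..b} \<phi> + \<epsilon> * (b - a)"
          "\<bar>U (f c) - U (f b)\<bar> \<le> integral {b..c} \<phi> + \<epsilon> * (c - b)"
          using trans ac by (auto simp: P_def)
        moreover have "integral {a..b} \<phi> + integral {b..c} \<phi> = integral {a..c} \<phi>"
          using trans ac int by (intro Henstock_Kurzweil_Integration.integral_combine) auto
        ultimately show "\<bar>U (f c) - U (f a)\<bar> \<le> integral {a..c} \<phi> + \<epsilon> * (c - a)"
          by (simp add: algebra_simps)
      qed
    next
      case (local x)
      \<comment> \<open>Half of \<epsilon> pays for the differentiability error, after
        multiplication by \<open>C\<close>, and half for the oscillation of the integrand;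
        \<open>C + 1\<close> avoids a division by zero.\<close>
      define \<epsilon>' where "\<epsilon>' = \<epsilon> / (2 * (C + 1))"
      have \<epsilon>': "0 < \<epsilon>'" "C * \<epsilon>' \<le> \<epsilon> / 2" using \<epsilon> C by (auto simp: \<epsilon>'_def field_simps)
      have "(U has_derivative (\<lambda>h. G (f x) \<bullet> h)) (at (f x))" using U by (simp add: has_grad_def)
      then obtain d1 where d1: "0 < d1" "\<And>y. norm (y - f x) < d1 \<Longrightarrow>
          norm (U y - U (f x) - G (f x) \<bullet> (y - f x)) \<le> \<epsilon>' * norm (y - f x)"
        unfolding has_derivative_at_alt using \<epsilon>'(1) by blast
      obtain d2 where d2: "0 < d2" "\<And>y. y \<in> {0..L} \<Longrightarrow> dist y x < d2 \<Longrightarrow> dist (\<phi> y) (\<phi> x) < \<epsilon> / 2"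
        using \<phi>c local \<epsilon> unfolding continuous_on_iff by (metis atLeastAtMost_iff half_gt_zero)
      define d where "d = min (d1 / (C + 1)) d2"
      have d: "0 < d" using d1 d2 C by (simp add: d_def)
      have Cd: "C * t < d1" if "0 \<le> t" "t < d" for t
      proof -
        have "C * t \<le> (C + 1) * t" using that by (simp add: algebra_simps)
        also have "\<dots> < d1" using that C by (simp add: d_def field_simps)
        finally show ?thesis .
      qed
      have loc: "\<bar>U (f y) - U (f x)\<bar> \<le> (\<phi> x + \<epsilon> / 2) * \<bar>y - x\<bar>" if y: "y \<in> {0..L}" "\<bar>y - x\<bar> < d" for y
      proof -
        have fy: "norm (f y - f x) \<le> C * \<bar>y - x\<bar>" using f[OF y(1)] local by auto
        then have "norm (f y - f x) < d1" using Cd[of "\<bar>y - x\<bar>"] y by simp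
        then have "norm (U (f y) - U (f x) - G (f x) \<bullet> (f y - f x)) \<le> \<epsilon>' * norm (f y - f x)" by (rule d1(2))
        moreover have "\<bar>G (f x) \<bullet> (f y - f x)\<bar> \<le> norm (G (f x)) * norm (f y - f x)"
          by (rule Cauchy_Schwarz_ineq2)
        ultimately have "\<bar>U (f y) - U (f x)\<bar> \<le> (norm (G (f x)) + \<epsilon>') * norm (f y - f x)"
          by (simp add: distrib_right)
        also have "\<dots> \<le> (norm (G (f x)) + \<epsilon>') * (C * \<bar>y - x\<bar>)"
          using fy \<epsilon>'(1) by (intro mult_left_mono) auto
        also have "\<dots> = (\<phi> x + C * \<epsilon>') * \<bar>y - x\<bar>" by (simp add: \<phi>_def algebra_simps)
        also have "\<dots> \<le> (\<phi> x + \<epsilon> / 2) * \<bar>y - x\<bar>" using \<epsilon>'(2) by (intro mult_right_mono) auto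
        finally show ?thesis .
      qed
      have "P a b" if ab: "a \<le> x" "x \<le> b" "b - a < d" for a b
        unfolding P_def
      proof (intro impI)
        assume AB: "0 \<le> a \<and> b \<le> L"
        have "\<bar>U (f b) - U (f x)\<bar> \<le> (\<phi> x + \<epsilon> / 2) * (b - x)" using loc[of b] ab AB by auto
        moreover have "\<bar>U (f a) - U (f x)\<bar> \<le> (\<phi> x + \<epsilon> / 2) * (x - a)" using loc[of a] ab AB by auto
        moreover have "c * (b - x) + c * (x - a) = c * (b - a)" for c
          by (simp add: algebra_simps)
        note this[of "\<phi> x + \<epsilon> / 2"]
        ultimately have "\<bar>U (f b) - U (f a)\<bar> \<le> (\<phi> x + \<epsilon> / 2) * (b - a)"
          by linarith
        moreover have "integral {a..b} (\<lambda>_. \<phi> x - \<epsilon> / 2) \<le> integral {a..b} \<phi>"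
        proof (rule integral_le)
          fix u assume u: "u \<in> {a..b}"
          then have "dist (\<phi> u) (\<phi> x) < \<epsilon> / 2"
            using ab AB by (intro d2(2)) (auto simp: dist_real_def d_def abs_less_iff)
          then show "\<phi> x - \<epsilon> / 2 \<le> \<phi> u" unfolding dist_real_def by linarith
        qed (use int AB in auto)
        then have "(\<phi> x - \<epsilon> / 2) * (b - a) \<le> integral {a..b} \<phi>" using ab by (simp add: mult.commute)
        moreover have "(r + e / 2) * c = (r - e / 2) * c + e * c" for r e c :: real
          by (simp add: field_simps)
        note this[of "\<phi> x" \<epsilon> "b - a"]
        ultimately show "\<bar>U (f b) - U (f a)\<bar> \<le> integral {a..b} \<phi> + \<epsilon> * (b - a)"
          by linarith
      qed
      then show ?case using d by blast
    qed
    then show ?thesis by (simp add: P_def)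
  qed
  have le: "\<bar>U (f L) - U (f 0)\<bar> \<le> integral {0..L} \<phi>"
  proof (rule field_le_epsilon)
    fix e :: real assume e: "0 < e"
    have "\<bar>U (f L) - U (f 0)\<bar> \<le> integral {0..L} \<phi> + e / (L + 1) * L"
      using e L by (intro bound) auto
    also have "e / (L + 1) * L \<le> e" using e L by (simp add: field_simps)
    finally show "\<bar>U (f L) - U (f 0)\<bar> \<le> integral {0..L} \<phi> + e" by simp
  qed
  have si: "set_integrable lborel {0..L} \<phi>" using \<phi>c by (rule borel_integrable_atLeastAtMost')
  have "(\<integral>\<^sup>+u\<in>{0..L}. ennreal (\<phi> u) \<partial>lborel) = (\<integral>\<^sup>+u. ennreal (indicat_real {0..L} u *\<^sub>R \<phi> u) \<partial>lborel)"
    by (intro nn_integral_cong) (auto simp: indicator_def)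
  also have "\<dots> = ennreal (LINT u:{0..L}|lborel. \<phi> u)"
    unfolding set_lebesgue_integral_def
    using si C by (intro nn_integral_eq_integral) (auto simp: set_integrable_def \<phi>_def)
  also have "(LINT u:{0..L}|lborel. \<phi> u) = integral {0..L} \<phi>"
    by (rule set_borel_integral_eq_integral(2)[OF si])
  finally show ?thesis using le by (simp add: \<phi>_def ennreal_leI)
qed

text \<open>The factor on the right is a Lipschitz constant of the image curve in arc length:
  \<open>c\<close> from the similarity, the dimension from passing to the Euclidean norm. Only
  values of \<rho> on the segment enter, so \<rho> may be cut off elsewhere.\<close>

lemma line_integral_ge:
  fixes h :: "'z \<Rightarrow> real ^ 'n"
  assumes h: "similarity c Z sup_metric h" and U: "has_grad U G"
    and curve: "(I, \<gamma>) \<in> curves Z" "locally_rectifiable Z (I, \<gamma>)"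
    and ab: "a \<le> b" "{a..b} \<subseteq> I" and \<kappa>: "0 \<le> \<kappa>"
    and \<rho>: "\<And>t. t \<in> {a..b} \<Longrightarrow> ennreal (\<kappa> * norm (G (h (\<gamma> t)))) \<le> \<rho> (\<gamma> t)"
  shows "ennreal (\<kappa> * \<bar>U (h (\<gamma> b)) - U (h (\<gamma> a))\<bar>)
    \<le> ennreal (real CARD('n) * c) * line_integral Z \<rho> (I, \<gamma>)"
proof -
  define L where "L = enn2real (curve_length Z \<gamma> {a..b})"
  define g where "g = arclength_param Z \<gamma> a b"
  define C where "C = real CARD('n) * c"
  have c: "0 < c" using h by (simp add: similarity_def)
  have \<gamma>: "continuous_map (top_of_set {a..b}) (mtopology_of Z) \<gamma>"
    using curve(1) ab(2) by (auto simp: curves_def intro: continuous_map_from_subtopology_mono)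
  have im: "\<gamma> ` {a..b} \<subseteq> mspace Z" using continuous_map_image_subset_topspace[OF \<gamma>] by simp
  have fin: "curve_length Z \<gamma> {a..b} < \<infinity>" using curve(2) ab(2) by (simp add: locally_rectifiable_def)
  note g = arclength_param_props[OF \<gamma> fin ab(1), folded L_def g_def]
  have gZ: "g u \<in> mspace Z" if "u \<in> {0..L}" for u using g(1) im that by blast
  have lip: "norm (h (g u) - h (g v)) \<le> C * \<bar>u - v\<bar>" if uv: "u \<in> {0..L}" "v \<in> {0..L}" for u v
  proof -
    have "norm (h (g u) - h (g v)) \<le> real CARD('n) * mdist sup_metric (h (g u)) (h (g v))"
      using dist_le_sup_dist by (simp add: dist_norm[symmetric])
    also have "mdist sup_metric (h (g u)) (h (g v)) = c * mdist Z (g u) (g v)"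
      using h gZ uv by (simp add: similarity_def)
    also have "real CARD('n) * (c * mdist Z (g u) (g v)) \<le> real CARD('n) * (c * \<bar>u - v\<bar>)"
      using g(4)[OF uv] c by (intro mult_left_mono) auto
    finally show ?thesis by (simp add: C_def mult.assoc)
  qed
  have L: "0 \<le> L" by (simp add: L_def)
  have C: "0 \<le> C" using c by (simp add: C_def)
  have "ennreal \<bar>U (h (g L)) - U (h (g 0))\<bar> \<le> (\<integral>\<^sup>+u\<in>{0..L}. ennreal (C * norm (G (h (g u)))) \<partial>lborel)"
    using lipschitz_upper_gradient[OF U C L, of "\<lambda>u. h (g u)"] lip by simp
  then have "ennreal \<kappa> * ennreal \<bar>U (h (\<gamma> b)) - U (h (\<gamma> a))\<bar>
      \<le> ennreal \<kappa> * (\<integral>\<^sup>+u\<in>{0..L}. ennreal (C * norm (G (h (g u)))) \<partial>lborel)"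
    unfolding g by (rule mult_left_mono) simp
  also have "\<dots> = ennreal C * (\<integral>\<^sup>+u\<in>{0..L}. ennreal (\<kappa> * norm (G (h (g u)))) \<partial>lborel)"
  proof -
    have hg: "continuous_on {0..L} (\<lambda>u. h (g u))"
      using lip C by (intro lipschitz_on_continuous_on[of C] lipschitz_onI) (auto simp: dist_norm dist_real_def)
    have cont: "continuous_on {0..L} (\<lambda>u. norm (G (h (g u))))"
      by (intro continuous_intros continuous_on_compose2[OF has_grad_continuous(1)[OF U] hg]) auto
    then have m: "(\<lambda>u. indicat_real {0..L} u *\<^sub>R norm (G (h (g u)))) \<in> borel_measurable lborel"
      using borel_integrable_atLeastAtMost'[of 0 L "\<lambda>u. norm (G (h (g u)))"]
      by (auto simp: set_integrable_def)
    have eq: "(\<integral>\<^sup>+u\<in>{0..L}. ennreal (k * norm (G (h (g u)))) \<partial>lborel)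
        = ennreal k * (\<integral>\<^sup>+u. ennreal (indicat_real {0..L} u *\<^sub>R norm (G (h (g u)))) \<partial>lborel)" if "0 \<le> k" for k
    proof -
      have "(\<integral>\<^sup>+u\<in>{0..L}. ennreal (k * norm (G (h (g u)))) \<partial>lborel)
        = (\<integral>\<^sup>+u. ennreal k * ennreal (indicat_real {0..L} u *\<^sub>R norm (G (h (g u)))) \<partial>lborel)"
        using that by (intro nn_integral_cong) (auto simp: indicator_def ennreal_mult)
      then show ?thesis using m by (simp add: nn_integral_cmult)
    qed
    show ?thesis unfolding eq[OF C] eq[OF \<kappa>] by (simp add: mult.left_commute)
  qed
  also have "(\<integral>\<^sup>+u\<in>{0..L}. ennreal (\<kappa> * norm (G (h (g u)))) \<partial>lborel) \<le> segment_integral Z \<rho> \<gamma> a b"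
    unfolding segment_integral_def L_def[symmetric] g_def[symmetric]
  proof (rule nn_integral_mono)
    fix u :: real
    show "ennreal (\<kappa> * norm (G (h (g u)))) * indicator {0..L} u \<le> \<rho> (g u) * indicator {0..L} u"
    proof (cases "u \<in> {0..L}")
      case True
      then obtain t where "t \<in> {a..b}" "g u = \<gamma> t" using g(1) by blast
      then show ?thesis using \<rho>[of t] True by simp
    qed simp
  qed
  also have "segment_integral Z \<rho> \<gamma> a b \<le> line_integral Z \<rho> (I, \<gamma>)"
    unfolding line_integral_def prod.case using ab by (intro SUP_upper2[of "(a, b)"]) auto
  finally show ?thesis using \<kappa> by (simp add: C_def ennreal_mult mult_left_mono)
qed

section \<open>Ultrafilters\<close>

definition ultra :: "'a filter \<Rightarrow> bool" where
  "ultra U \<longleftrightarrow> U \<noteq> bot \<and> (\<forall>P. eventually P U \<or> eventually (\<lambda>x. \<not> P x) U)"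

text \<open>By Zorn's lemma there is a minimal proper filter below \<open>F\<close>. It decides
  every predicate \<open>Q\<close>, because its meet with \<open>Q\<close> is either trivial or the
  filter itself.\<close>

lemma ex_ultra_le:
  assumes "F \<noteq> (bot :: 'a filter)"
  shows "\<exists>U\<le>F. ultra U"
proof -
  define A where "A = {G. G \<noteq> bot \<and> G \<le> F}"
  define P where "P G G' \<longleftrightarrow> G' \<le> G" for G G' :: "'a filter"
  have "partial_order_on A (relation_of P A)"
    by (rule partial_order_on_relation_ofI) (auto simp: P_def)
  then have "\<exists>m\<in>A. \<forall>a\<in>A. P m a \<longrightarrow> a = m"
  proof (rule predicate_Zorn)
    fix C assume C: "C \<in> Chains (relation_of P A)"
    then have CA: "C \<subseteq> A" by (rule Chains_relation_of)
    have tot: "G \<le> G' \<or> G' \<le> G" if "G \<in> C" "G' \<in> C" for G G'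
      using C that by (auto simp: Chains_def relation_of_def P_def)
    show "\<exists>u\<in>A. \<forall>a\<in>C. P a u"
    proof (cases "C = {}")
      case True
      then show ?thesis using assms by (auto simp: A_def)
    next
      case False
      have "\<not> eventually (\<lambda>_. False) (Inf C)"
      proof
        assume "eventually (\<lambda>_. False) (Inf C)"
        then obtain b where "b \<in> C" "eventually (\<lambda>_. False) b"
          using eventually_Inf_base[OF False] tot by (metis inf.absorb1 inf.absorb2 order_refl)
        then show False using CA by (auto simp: A_def trivial_limit_def)
      qed
      then have "Inf C \<noteq> bot" by (auto simp: trivial_limit_def)
      moreover have "Inf C \<le> F"
      proof -
        obtain b where "b \<in> C" using False by blast
        then have "Inf C \<le> b" by (rule Inf_lower)
        also have "b \<le> F" using \<open>b \<in> C\<close> CA by (auto simp: A_def)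
        finally show ?thesis .
      qed
      ultimately show ?thesis by (auto simp: A_def P_def intro!: bexI[of _ "Inf C"] Inf_lower)
    qed
  qed
  then obtain U where U: "U \<in> A" "\<And>G. G \<in> A \<Longrightarrow> G \<le> U \<Longrightarrow> G = U" by (auto simp: P_def)
  have "eventually Q U \<or> eventually (\<lambda>x. \<not> Q x) U" for Q
  proof (cases "inf U (principal {x. Q x}) = bot")
    case True
    then have "eventually (\<lambda>_. False) (inf U (principal {x. Q x}))" by simp
    then show ?thesis by (simp add: eventually_inf_principal)
  next
    case False
    then have "inf U (principal {x. Q x}) = U"
      using U(1) by (intro U(2)) (auto simp: A_def intro: le_infI1)
    moreover have "eventually Q (inf U (principal {x. Q x}))" by (simp add: eventually_inf_principal)
    ultimately show ?thesis by simp
  qed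
  then show ?thesis using U(1) by (auto simp: A_def ultra_def)
qed

lemma ultra_not: "ultra U \<Longrightarrow> \<not> eventually P U \<Longrightarrow> eventually (\<lambda>x. \<not> P x) U"
  by (auto simp: ultra_def)

lemma ultra_finite_ex:
  assumes "ultra U" "finite T" "eventually (\<lambda>n. \<exists>j\<in>T. P j n) U"
  shows "\<exists>j\<in>T. eventually (P j) U"
proof (rule ccontr)
  assume "\<not> ?thesis"
  then have "eventually (\<lambda>n. \<forall>j\<in>T. \<not> P j n) U"
    using assms by (intro eventually_ball_finite) (auto intro: ultra_not)
  with assms(3) have "eventually (\<lambda>n. False) U" by eventually_elim auto
  then show False using assms(1) by (simp add: ultra_def trivial_limit_def)
qed

text \<open>Compactness gives a cluster point, and an ultrafilter converges to each of its cluster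
  points.\<close>

lemma ultra_tendsto_compact:
  fixes f :: "'a \<Rightarrow> 'b :: topological_space"
  assumes U: "ultra U" and C: "compact C" "eventually (\<lambda>n. f n \<in> C) U"
  shows "\<exists>x\<in>C. (f \<longlongrightarrow> x) U"
proof -
  have "filtermap f U \<noteq> bot" using U by (simp add: ultra_def filtermap_bot_iff)
  moreover have "eventually (\<lambda>x. x \<in> C) (filtermap f U)" using C(2) by (simp add: eventually_filtermap)
  ultimately obtain x where x: "x \<in> C" "inf (nhds x) (filtermap f U) \<noteq> bot"
    using C(1) unfolding compact_filter by blast
  have "(f \<longlongrightarrow> x) U"
  proof (rule topological_tendstoI, rule ccontr)
    fix S assume S: "open S" "x \<in> S" "\<not> eventually (\<lambda>n. f n \<in> S) U"
    then have "eventually (\<lambda>n. f n \<notin> S) U" using U by (intro ultra_not)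
    then have 1: "eventually (\<lambda>y. y \<notin> S) (filtermap f U)" by (simp add: eventually_filtermap)
    have 2: "eventually (\<lambda>y. y \<in> S) (nhds x)" using S by (auto simp: eventually_nhds)
    have "eventually (\<lambda>_. False) (inf (nhds x) (filtermap f U))"
      unfolding eventually_inf using 1 2 by blast
    then show False using x(2) by (simp add: trivial_limit_def)
  qed
  then show ?thesis using x(1) by blast
qed

lemma eventually_ultra_ex: "ultra U \<Longrightarrow> eventually P U \<Longrightarrow> \<exists>n. P n"
  unfolding ultra_def using eventually_happens' by blast


section \<open>Approximation in the Hausdorff sense\<close>

lemma hausdorff_approx:
  assumes lim: "(\<lambda>n. SUP z\<in>A n. esetdist M z (B n)) \<longlonglongrightarrow> 0"
    and w: "\<And>n. w n \<in> A n" and B: "\<And>n. B n \<noteq> {}"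
  shows "\<exists>b. (\<forall>n. b n \<in> B n) \<and> (\<lambda>n. mdist M (w n) (b n)) \<longlonglongrightarrow> 0"
proof -
  \<comment> \<open>The distance to a set need not be attained; the slack \<open>1 / (n + 1)\<close>
    vanishes in the limit.\<close>
  have "\<exists>y\<in>B n. ennreal (mdist M (w n) y) < esetdist M (w n) (B n) + ennreal (1 / real (Suc n))" for n
  proof -
    obtain y where "y \<in> B n" using B by blast
    then have "esetdist M (w n) (B n) \<le> ennreal (mdist M (w n) y)"
      unfolding esetdist_def by (rule INF_lower)
    then have "esetdist M (w n) (B n) < top" by (simp add: order_le_less_trans)
    then have "esetdist M (w n) (B n) < esetdist M (w n) (B n) + ennreal (1 / real (Suc n))"
      by (simp add: ennreal_zero_less_mult_iff)
    then show ?thesis unfolding esetdist_def INF_less_iff by auto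
  qed
  then obtain b where b: "\<And>n. b n \<in> B n"
    "\<And>n. ennreal (mdist M (w n) (b n)) < esetdist M (w n) (B n) + ennreal (1 / real (Suc n))"
    by metis
  have le: "ennreal (mdist M (w n) (b n)) \<le> (SUP z\<in>A n. esetdist M z (B n)) + ennreal (1 / real (Suc n))" for n
    using b(2)[of n] SUP_upper[OF w[of n], of "\<lambda>z. esetdist M z (B n)"]
    by (meson add_right_mono less_imp_le order_trans)
  have "(\<lambda>n. 1 / real (Suc n)) \<longlonglongrightarrow> 0" by (rule LIMSEQ_Suc[OF lim_const_over_n])
  then have "(\<lambda>n. ennreal (1 / real (Suc n))) \<longlonglongrightarrow> ennreal 0" by (intro tendsto_intros) auto
  from tendsto_add[OF lim this]
  have lim': "(\<lambda>n. (SUP z\<in>A n. esetdist M z (B n)) + ennreal (1 / real (Suc n))) \<longlonglongrightarrow> 0" by simp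
  have "(\<lambda>n. ennreal (mdist M (w n) (b n))) \<longlonglongrightarrow> 0"
    by (rule tendsto_sandwich[OF always_eventually always_eventually tendsto_const lim']) (use le in auto)
  then have "(\<lambda>n. ennreal (mdist M (w n) (b n))) \<longlonglongrightarrow> ennreal 0" by simp
  then have "(\<lambda>n. mdist M (w n) (b n)) \<longlonglongrightarrow> 0"
    by (subst (asm) tendsto_ennreal_iff) auto
  then show ?thesis using b(1) by blast
qed

lemma tendsto_sup_dist:
  fixes f g :: "'a \<Rightarrow> real ^ 'n"
  assumes "(f \<longlongrightarrow> x) F" "(g \<longlongrightarrow> y) F"
  shows "((\<lambda>n. mdist sup_metric (f n) (g n)) \<longlongrightarrow> mdist sup_metric x y) F"
proof -
  have "((\<lambda>n. dist (f n) x + dist (g n) y) \<longlongrightarrow> dist x x + dist y y) F"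
    using assms by (intro tendsto_intros)
  then have lim: "((\<lambda>n. dist (f n) x + dist (g n) y) \<longlongrightarrow> 0) F" by simp
  have "\<bar>mdist sup_metric a b - mdist sup_metric x y\<bar> \<le> dist a x + dist b y" for a b :: "real ^ 'n"
  proof -
    have t: "mdist sup_metric p q \<le> mdist sup_metric p r + mdist sup_metric r q" for p q r :: "real ^ 'n"
      by (rule mdist_triangle) auto
    have "mdist sup_metric a b \<le> mdist sup_metric a x + (mdist sup_metric x y + mdist sup_metric y b)"
      using t[of a b x] t[of x b y] by linarith
    moreover have "mdist sup_metric x y \<le> mdist sup_metric x a + (mdist sup_metric a b + mdist sup_metric b y)"
      using t[of x y a] t[of a y b] by linarith
    moreover have "mdist sup_metric x a = mdist sup_metric a x" "mdist sup_metric y b = mdist sup_metric b y"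
      by (simp_all add: mdist_commute)
    ultimately show ?thesis using sup_dist_le_dist[of a x] sup_dist_le_dist[of b y] by linarith
  qed
  then have "((\<lambda>n. mdist sup_metric (f n) (g n) - mdist sup_metric x y) \<longlongrightarrow> 0) F"
    by (intro Lim_null_comparison[OF _ lim]) auto
  then show ?thesis by (simp add: LIM_zero_iff)
qed

lemma sup_dist_triangle: "mdist sup_metric (p :: real ^ 'n) q \<le> mdist sup_metric p r + mdist sup_metric r q"
  by (rule mdist_triangle) auto

text \<open>The inverse of a similarity preserves Cauchy sequences, so completeness of
  \<open>Z\<close> makes the image closed.\<close>

lemma closed_similarity_image:
  fixes h :: "'z \<Rightarrow> real ^ 'n"
  assumes h: "similarity c Z sup_metric h" and Z: "mcomplete_of Z"
  shows "closed (h ` mspace Z)"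
  unfolding closed_sequential_limits
proof (intro allI impI, elim conjE)
  interpret Metric_space "mspace Z" "mdist Z" by simp
  have c: "0 < c" and hd: "\<And>x y. x \<in> mspace Z \<Longrightarrow> y \<in> mspace Z \<Longrightarrow> mdist sup_metric (h x) (h y) = c * mdist Z x y"
    using h by (auto simp: similarity_def)
  fix f y assume f: "\<forall>n. f n \<in> h ` mspace Z" "f \<longlonglongrightarrow> y"
  then have "\<forall>n. \<exists>x. x \<in> mspace Z \<and> f n = h x" by blast
  then obtain s where s: "\<And>n. s n \<in> mspace Z" "\<And>n. f n = h (s n)" by metis
  have "MCauchy s"
    unfolding MCauchy_def
  proof (intro conjI allI impI)
    show "range s \<subseteq> mspace Z" using s(1) by auto
    fix \<epsilon> :: real assume \<epsilon>: "0 < \<epsilon>"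
    have "Cauchy f" using f(2) by (rule LIMSEQ_imp_Cauchy)
    then obtain N where N: "\<And>m n. N \<le> m \<Longrightarrow> N \<le> n \<Longrightarrow> dist (f m) (f n) < c * \<epsilon>"
      using c \<epsilon> unfolding Cauchy_def by (meson mult_pos_pos)
    show "\<exists>N. \<forall>n n'. N \<le> n \<longrightarrow> N \<le> n' \<longrightarrow> mdist Z (s n) (s n') < \<epsilon>"
    proof (intro exI allI impI)
      fix n n' assume "N \<le> n" "N \<le> n'"
      then have "c * mdist Z (s n) (s n') < c * \<epsilon>"
        using N[of n n'] hd[OF s(1) s(1), of n n'] sup_dist_le_dist[of "f n" "f n'"] by (simp add: s(2))
      then show "mdist Z (s n) (s n') < \<epsilon>" using c by simp
    qed
  qed
  then obtain z where z: "limitin mtopology s z sequentially"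
    using Z unfolding mcomplete_of_def mcomplete_def by blast
  then have zZ: "z \<in> mspace Z" and lim: "(\<lambda>n. mdist Z (s n) z) \<longlonglongrightarrow> 0"
    by (auto simp: limitin_metric_dist_null)
  have "(\<lambda>n. mdist sup_metric (f n) (h z)) \<longlonglongrightarrow> mdist sup_metric y (h z)"
    using f(2) by (intro tendsto_sup_dist tendsto_const)
  moreover have "(\<lambda>n. mdist sup_metric (f n) (h z)) \<longlonglongrightarrow> c * 0"
    unfolding s(2) hd[OF s(1) zZ] by (intro tendsto_intros lim)
  ultimately have "mdist sup_metric y (h z) = 0" using LIMSEQ_unique by fastforce
  then have "y = h z" by (simp add: mdist_zero)
  then show "y \<in> h ` mspace Z" using zZ by blast
qed

lemma bounded_int_vecs_finite: "finite {v \<in> int_vecs. mdist sup_metric a v \<le> r}"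
proof -
  obtain m :: nat where m: "2 * r \<le> real m" using real_arch_simple by blast
  have "finite {v \<in> int_vecs. mdist sup_metric a v \<le> r} \<and> card {v \<in> int_vecs. mdist sup_metric a v \<le> r} \<le> (m + 1) ^ CARD('a)"
  proof (rule card_int_vecs_box[where a = "a - (\<chi> k. r)"])
    fix v k assume "v \<in> {v \<in> int_vecs. mdist sup_metric a v \<le> r}"
    then have "\<bar>a $ k - v $ k\<bar> \<le> r" using component_le_sup_dist[of a k v] by auto
    then show "(a - (\<chi> k. r)) $ k \<le> v $ k \<and> v $ k \<le> (a - (\<chi> k. r)) $ k + real m" using m by auto
  qed auto
  then show ?thesis ..
qed


section \<open>Weak tangents of a carpet\<close>

context carpet
begin

section \<open>Blow-ups of the carpet\<close>

lemma translate_K_near: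
  assumes "x \<in> (\<lambda>x. x + j) ` K" "mdist sup_metric a x \<le> r"
  shows "mdist sup_metric a j \<le> r + 1"
proof -
  obtain y where y: "y \<in> K" "x = y + j" using assms(1) by blast
  have "\<bar>x $ k - j $ k\<bar> \<le> 1" for k using K_nth[OF y(1), of k] by (simp add: y(2))
  then have "mdist sup_metric x j \<le> 1" by (simp add: sup_dist_le_iff)
  then show ?thesis using sup_dist_triangle[of a j x] assms(2) by linarith
qed

text \<open>The inverse of \<open>cell k v\<close>: it carries the cells of level \<open>k\<close>
  to integer translates of \<open>K\<close>, and the cell at \<open>v\<close> to \<open>K\<close>
  itself.\<close>

definition blow_up :: "nat \<Rightarrow> real ^ 'n \<Rightarrow> real ^ 'n \<Rightarrow> real ^ 'n" where
  "blow_up k v = affine_scale (real l ^ k) (- ((1 / real l ^ k) *\<^sub>R v))"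

lemma blow_up_cell: "blow_up k v (cell k w y) = y + (w - v)"
  by (simp add: blow_up_def vec_eq_iff field_simps)

lemma cell_blow_up: "cell k v (blow_up k v x) = x"
  by (simp add: blow_up_def vec_eq_iff field_simps)

lemma blow_up_K: "blow_up k v ` K = (\<Union>j\<in>(\<lambda>w. w - v) ` V k. (\<lambda>x. x + j) ` K)"
proof -
  have "blow_up k v ` K = blow_up k v ` (\<Union>w\<in>V k. cell k w ` K)"
    by (subst (1) K_eq_cells[of k]) (rule refl)
  also have "\<dots> = (\<Union>w\<in>V k. (\<lambda>x. x + (w - v)) ` K)"
    by (simp only: image_UN image_image blow_up_cell)
  also have "\<dots> = (\<Union>j\<in>(\<lambda>w. w - v) ` V k. (\<lambda>x. x + j) ` K)" by simp
  finally show ?thesis .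
qed

lemma blow_up_sup_dist: "mdist sup_metric (blow_up k v x) (blow_up k v y) = real l ^ k * mdist sup_metric x y"
  unfolding blow_up_def by (rule sup_dist_affine_scale) simp

lemma emeasure_blow_up_ball:
  "emeasure H (blow_up k v ` K \<inter> {y. mdist sup_metric a y < r})
    = ennreal (real (card S) ^ k) * emeasure H (K \<inter> {y. mdist sup_metric (cell k v a) y < r / real l ^ k})"
proof -
  have lk: "0 < real l ^ k" by simp
  have sim: "similarity (real l ^ k) sup_metric sup_metric (blow_up k v)"
    unfolding blow_up_def using lk by (rule similarity_affine_scale)
  have surj: "surj (blow_up k v)" unfolding blow_up_def by (rule surj_affine_scale) simp
  have inj: "inj (blow_up k v)" by (rule inj_on_inverseI[of _ "cell k v"]) (rule cell_blow_up)
  have a: "a = blow_up k v (cell k v a)" by (simp add: blow_up_cell)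
  have vim: "blow_up k v -` (blow_up k v ` K \<inter> {y. mdist sup_metric a y < r})
      = K \<inter> {y. mdist sup_metric (cell k v a) y < r / real l ^ k}"
  proof -
    have "mdist sup_metric a (blow_up k v y) = real l ^ k * mdist sup_metric (cell k v a) y" for y
      by (subst a) (rule blow_up_sup_dist)
    then show ?thesis using inj lk by (auto simp: pos_less_divide_eq mult.commute dest: injD)
  qed
  have "compact (blow_up k v ` K)"
    unfolding blow_up_def by (intro compact_continuous_image K_compact continuous_intros continuous_on_id)
  then have "blow_up k v ` K \<inter> {y. mdist sup_metric a y < r} \<in> sets borel"
    using borel_open[OF open_sup_ball, of a r] by (intro sets.Int borel_compact[of "blow_up k v ` K"])
  from emeasure_hausdorff_vimage[OF sim surj _ _ this, of dimK]
  have "ennreal ((real l ^ k) powr dimK) * emeasure H (K \<inter> {y. mdist sup_metric (cell k v a) y < r / real l ^ k})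
      = emeasure H (blow_up k v ` K \<inter> {y. mdist sup_metric a y < r})"
    using dimK_pos unfolding vim by (simp add: blow_up_def)
  moreover have "(real l ^ k) powr dimK = real (card S) ^ k"
    using cell_powr_dimK[of k] by (simp add: powr_divide)
  ultimately show ?thesis by simp
qed

text \<open>The powers of \<open>l\<close> and of \<open>card S\<close> cancel by the choice of
  \<open>dimK\<close>, so the constant does not depend on \<open>k\<close>.\<close>

lemma blow_up_ball_upper:
  assumes "0 < r"
  shows "emeasure H (blow_up k v ` K \<inter> {y. mdist sup_metric a y < r}) \<le> ennreal (near_const * massK * r powr dimK)"
proof -
  have "emeasure H (blow_up k v ` K \<inter> {y. mdist sup_metric a y < r})
      \<le> ennreal (real (card S) ^ k) * ennreal (near_const * massK * (r / real l ^ k) powr dimK)"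
    unfolding emeasure_blow_up_ball using assms by (intro mult_left_mono K_ball_upper) auto
  also have "(r / real l ^ k) powr dimK = r powr dimK * (1 / real l ^ k) powr dimK"
    using assms by (simp add: powr_mult[symmetric])
  finally show ?thesis
    using near_const_pos massK_pos card_S by (simp add: cell_powr_dimK ennreal_mult[symmetric])
qed

text \<open>The bound \<open>r \<le> l^k\<close> is the condition \<open>r \<le> 1\<close> of
  \<open>K_ball_lower\<close>, seen after the blow-up.\<close>

lemma blow_up_ball_lower:
  assumes "0 < r" "r \<le> real l ^ k" "a \<in> blow_up k v ` K"
  shows "ennreal (massK / real (card S) * r powr dimK) \<le> emeasure H (blow_up k v ` K \<inter> {y. mdist sup_metric a y < r})"
proof -
  have "cell k v a \<in> K" using assms(3) cell_blow_up by auto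
  then have "ennreal (real (card S) ^ k) * ennreal (massK / real (card S) * (r / real l ^ k) powr dimK)
      \<le> emeasure H (blow_up k v ` K \<inter> {y. mdist sup_metric a y < r})"
    unfolding emeasure_blow_up_ball using assms(1,2) by (intro mult_left_mono K_ball_lower) auto
  moreover have "(r / real l ^ k) powr dimK = r powr dimK * (1 / real l ^ k) powr dimK"
    using assms by (simp add: powr_mult[symmetric])
  ultimately show ?thesis
    using massK_pos card_S by (simp add: cell_powr_dimK ennreal_mult[symmetric])
qed

end

lemma sup_dist_self [simp]: "mdist sup_metric x (x :: real ^ 'n) = 0"
  by (rule mdist_zero[THEN iffD2]) auto

context carpet
begin

text \<open>Points of \<open>Z\<close> are approximated in the ambient space by points of
  \<open>K\<close>, whose blow-ups stay bounded and converge along an ultrafilter; this defines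
  \<open>h\<close>. The bounds on balls need no limit of measures, because in a bounded region the
  image of \<open>Z\<close> coincides with one of the blow-ups. A pair of points at distance greater
  than \<open>r\<close> expresses that \<open>r\<close> is below the diameter.\<close>

lemma weak_tangent_structure:
  assumes wt: "weak_tangent TYPE('m) (submetric sup_metric K) (Z :: 'z metric)"
  shows "\<exists>c h J. similarity c Z sup_metric h \<and> J \<subseteq> int_vecs \<and>
    h ` mspace Z = (\<Union>j\<in>J. (\<lambda>x. x + j) ` K) \<and> closed (h ` mspace Z) \<and>
    (\<forall>a r. 0 < r \<longrightarrow> emeasure H (h ` mspace Z \<inter> {y. mdist sup_metric a y < r}) \<le> ennreal (near_const * massK * r powr dimK)) \<and>
    (\<forall>a\<in>h ` mspace Z. \<forall>r>0. (\<exists>x\<in>h ` mspace Z. \<exists>y\<in>h ` mspace Z. r < mdist sup_metric x y) \<longrightarrow>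
      ennreal (massK / real (card S) * r powr dimK) \<le> emeasure H (h ` mspace Z \<inter> {y. mdist sup_metric a y < r}))"
proof -
  obtain z0 x r where Z: "mcomplete_of Z" "z0 \<in> mspace Z"
    and xr: "\<And>n. x n \<in> mspace (submetric sup_metric K)" "\<And>n. 0 < r n"
      "\<And>n. ennreal (r n) < ediam (submetric sup_metric K) (mspace (submetric sup_metric K))"
    and aw: "attouch_wets TYPE('m) (\<lambda>n. scale_metric (1 / r n) (submetric sup_metric K)) x Z z0"
    using wt unfolding weak_tangent_def pointed_weak_tangent_def by metis
  define X where "X n = scale_metric (1 / r n) (submetric sup_metric K)" for n
  have XK: "mspace (X n) = K" and Xd: "mdist (X n) a b = mdist sup_metric a b / r n" for n a b
    using xr(2)[of n] by (simp_all add: X_def mspace_scale_metric mdist_scale_metric)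
  have xK: "x n \<in> K" for n using xr(1)[of n] by simp
  obtain M :: "'m metric" and p f g where M: "p \<in> mspace M"
    and fM: "\<And>j. isometric_embedding (X j) M (f j)" and fp: "\<And>j. f j (x j) = p"
    and gM: "isometric_embedding Z M g" and gp: "g z0 = p"
    and lim: "local_hausdorff_limit M (\<lambda>j. f j ` K) (g ` mspace Z)"
    using aw unfolding attouch_wets_def X_def[symmetric] XK by metis
  have f_in: "f n a \<in> mspace M" if "a \<in> K" for n a
    using fM[of n] that by (auto simp: isometric_embedding_def XK)
  have f_iso: "mdist M (f n a) (f n b) = mdist sup_metric a b / r n" if "a \<in> K" "b \<in> K" for n a b
    using fM[of n] that by (auto simp: isometric_embedding_def XK Xd)
  have g_in: "g z \<in> mspace M" if "z \<in> mspace Z" for z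
    using gM that by (auto simp: isometric_embedding_def)
  have g_iso: "mdist M (g z) (g w) = mdist Z z w" if "z \<in> mspace Z" "w \<in> mspace Z" for z w
    using gM that by (auto simp: isometric_embedding_def)
  interpret MM: Metric_space "mspace M" "mdist M" by simp
  have ball: "a \<in> mball_of M p R \<longleftrightarrow> a \<in> mspace M \<and> mdist M p a < R" for a R
    using M by (auto simp: mball_of_def)
  have lim1: "(\<lambda>n. SUP z\<in>f n ` K \<inter> mball_of M p R. esetdist M z (g ` mspace Z)) \<longlonglongrightarrow> 0"
    and lim2: "(\<lambda>n. SUP z\<in>g ` mspace Z \<inter> mball_of M p R. esetdist M z (f n ` K)) \<longlonglongrightarrow> 0" if "0 < R" for R
    using lim M that unfolding local_hausdorff_limit_def by blast+
  have r1: "r n \<le> 1" for n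
  proof -
    have "ediam (submetric sup_metric K) (mspace (submetric sup_metric K)) \<le> ennreal 1"
      unfolding ediam_def using K_sup_dist by (auto intro!: SUP_least ennreal_leI)
    then have "ennreal (r n) < ennreal 1" using xr(3)[of n] by (rule order_less_le_trans[rotated])
    then show ?thesis using xr(2)[of n] by (simp add: ennreal_less_iff)
  qed
  have "\<exists>k. 1 \<le> real l ^ k * r n \<and> real l ^ k * r n \<le> real l" for n
  proof -
    obtain m where "1 / real l ^ Suc m < r n" "r n \<le> 1 / real l ^ m"
      using scale_index[OF xr(2) r1, of "real l"] l3 by auto
    then show ?thesis
      by (intro exI[of _ "Suc m"]) (simp add: pos_divide_less_eq pos_le_divide_eq mult.commute mult.assoc)
  qed
  then obtain k where k: "\<And>n. 1 \<le> real l ^ k n * r n" "\<And>n. real l ^ k n * r n \<le> real l" by metis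
  \<comment> \<open>The quotient of the scale \<open>l ^ k n\<close> by the given scale
    \<open>1 / r n\<close>; it stays in \<open>[1, l]\<close>, and its limit along the ultrafilter
    is the ratio of the similarity.\<close>
  define cc where "cc n = real l ^ k n * r n" for n
  have cc: "1 \<le> cc n" "cc n \<le> real l" for n using k by (simp_all add: cc_def)
  have "\<exists>v\<in>V (k n). \<exists>y\<in>K. x n = cell (k n) v y" for n
    using xK[of n] K_eq_cells[of "k n"] by blast
  then obtain v y0 where v: "\<And>n. v n \<in> V (k n)" and y0: "\<And>n. y0 n \<in> K" "\<And>n. x n = cell (k n) (v n) (y0 n)"
    by metis
  define zoom where "zoom n = blow_up (k n) (v n)" for n
  \<comment> \<open>Positions of the cells of level \<open>k n\<close> relative to the one chosen
    for \<open>x n\<close>.\<close>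
  define JJ where "JJ n = (\<lambda>w. w - v n) ` V (k n)" for n
  have zoom_K: "zoom n ` K = (\<Union>j\<in>JJ n. (\<lambda>x. x + j) ` K)" for n
    unfolding zoom_def JJ_def by (rule blow_up_K)
  have zoom_x: "zoom n (x n) = y0 n" for n unfolding zoom_def y0(2) by (simp add: blow_up_cell)
  have zoom_d: "mdist sup_metric (zoom n a) (zoom n b) = cc n * mdist M (f n a) (f n b)" if "a \<in> K" "b \<in> K" for n a b
    using xr(2)[of n] by (simp add: f_iso[OF that] cc_def zoom_def blow_up_sup_dist)
  have JJ_int: "JJ n \<subseteq> int_vecs" for n
    unfolding JJ_def using V_int_vecs v by (blast intro: int_vecs_diff)
  obtain U where U: "U \<le> sequentially" "ultra U"
    using ex_ultra_le[of "sequentially"] by auto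
  have Une: "U \<noteq> bot" using U(2) by (simp add: ultra_def)
  have toU: "(s \<longlongrightarrow> a) U" if "s \<longlonglongrightarrow> a" for s :: "nat \<Rightarrow> real" and a
    using U(1) that by (rule tendsto_mono)
  have "\<forall>\<^sub>F n in U. cc n \<in> {1..real l}" using cc by simp
  then obtain c where c: "c \<in> {1..real l}" "(cc \<longlongrightarrow> c) U"
    using ultra_tendsto_compact[OF U(2), of "{1..real l}" cc] by auto
  have cpos: "0 < c" using c by simp

  have "\<exists>b. (\<forall>n. b n \<in> K) \<and> (\<lambda>n. mdist M (g z) (f n (b n))) \<longlonglongrightarrow> 0" if z: "z \<in> mspace Z" for z
  proof -
    define R where "R = mdist M p (g z) + 1"
    have R: "0 < R" by (simp add: R_def add_nonneg_pos)
    have "g z \<in> g ` mspace Z \<inter> mball_of M p R" using z g_in[OF z] M by (auto simp: ball R_def)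
    then obtain b where b: "\<And>n. b n \<in> f n ` K" "(\<lambda>n. mdist M (g z) (b n)) \<longlonglongrightarrow> 0"
      using hausdorff_approx[OF lim2[OF R], of "\<lambda>_. g z"] K_ne by blast
    then have "\<forall>n. \<exists>a. a \<in> K \<and> b n = f n a" by blast
    then obtain a where "\<And>n. a n \<in> K" "\<And>n. b n = f n (a n)" by metis
    then show ?thesis using b(2) by auto
  qed
  then obtain ap where ap: "\<And>z n. z \<in> mspace Z \<Longrightarrow> ap z n \<in> K"
    "\<And>z. z \<in> mspace Z \<Longrightarrow> (\<lambda>n. mdist M (g z) (f n (ap z n))) \<longlonglongrightarrow> 0"
    by metis
  have dist_le: "mdist M (f n a) p \<le> R \<Longrightarrow> zoom n a \<in> cball 0 (real CARD('n) * (real l * R + 1))"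
    if a: "a \<in> K" and R: "0 \<le> R" for n a R
  proof -
    assume le: "mdist M (f n a) p \<le> R"
    have "mdist sup_metric (zoom n a) (y0 n) = cc n * mdist M (f n a) p"
      using zoom_d[OF a xK, of n n] by (simp add: zoom_x fp)
    also have "\<dots> \<le> real l * R" using cc[of n] le R by (intro mult_mono) auto
    finally have 1: "mdist sup_metric (zoom n a) (y0 n) \<le> real l * R" .
    have 2: "mdist sup_metric (y0 n) 0 \<le> 1"
      using K_nth[OF y0(1)[of n]] by (simp add: sup_dist_le_iff)
    have "dist (zoom n a) 0 \<le> real CARD('n) * mdist sup_metric (zoom n a) 0" by (rule dist_le_sup_dist)
    also have "\<dots> \<le> real CARD('n) * (real l * R + 1)"
      using sup_dist_triangle[of "zoom n a" 0 "y0 n"] 1 2 by (intro mult_left_mono) auto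
    finally show ?thesis by (simp add: dist_commute)
  qed
  have "\<exists>y. ((\<lambda>n. zoom n (ap z n)) \<longlongrightarrow> y) U" if z: "z \<in> mspace Z" for z
  proof -
    define R where "R = 1 + mdist M (g z) p"
    have "\<forall>\<^sub>F n in U. mdist M (g z) (f n (ap z n)) < 1"
      using toU[OF ap(2)[OF z]] by (rule order_tendstoD(2)) simp
    then have "\<forall>\<^sub>F n in U. zoom n (ap z n) \<in> cball 0 (real CARD('n) * (real l * R + 1))"
    proof eventually_elim
      case (elim n)
      have "mdist M (f n (ap z n)) p \<le> mdist M (f n (ap z n)) (g z) + mdist M (g z) p"
        using ap(1)[OF z] f_in g_in[OF z] M by (intro mdist_triangle) auto
      then have "mdist M (f n (ap z n)) p \<le> R" using elim by (simp add: R_def mdist_commute)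
      then show ?case using ap(1)[OF z] by (intro dist_le) (auto simp: R_def)
    qed
    from ultra_tendsto_compact[OF U(2) compact_cball this] show ?thesis by blast
  qed
  then obtain h where h: "\<And>z. z \<in> mspace Z \<Longrightarrow> ((\<lambda>n. zoom n (ap z n)) \<longlongrightarrow> h z) U" by metis
  have h_sim: "mdist sup_metric (h z) (h w) = c * mdist Z z w" if z: "z \<in> mspace Z" and w: "w \<in> mspace Z" for z w
  proof -
    have "((\<lambda>n. mdist M (g z) (f n (ap z n)) + mdist M (g w) (f n (ap w n))) \<longlongrightarrow> 0 + 0) U"
      by (intro tendsto_add toU ap(2) z w)
    then have l0: "((\<lambda>n. mdist M (g z) (f n (ap z n)) + mdist M (g w) (f n (ap w n))) \<longlongrightarrow> 0) U" by simp
    have "\<bar>mdist M (f n (ap z n)) (f n (ap w n)) - mdist Z z w\<bar> \<le> mdist M (g z) (f n (ap z n)) + mdist M (g w) (f n (ap w n))" for n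
    proof -
      have t: "mdist M a b \<le> mdist M a d + mdist M d b" if "a \<in> mspace M" "b \<in> mspace M" "d \<in> mspace M" for a b d
        using that by (intro mdist_triangle)
      note in' = g_in[OF z] g_in[OF w] f_in[OF ap(1)[OF z], of n n] f_in[OF ap(1)[OF w], of n n]
      show ?thesis
        using t[OF in'(3) in'(4) in'(1)] t[OF in'(1) in'(4) in'(2)] t[OF in'(1) in'(2) in'(3)] t[OF in'(3) in'(2) in'(4)]
          g_iso[OF z w] by (simp add: mdist_commute abs_le_iff)
    qed
    then have "((\<lambda>n. mdist M (f n (ap z n)) (f n (ap w n)) - mdist Z z w) \<longlongrightarrow> 0) U"
      by (intro Lim_null_comparison[OF _ l0]) simp
    then have "((\<lambda>n. mdist M (f n (ap z n)) (f n (ap w n))) \<longlongrightarrow> mdist Z z w) U" by (simp add: LIM_zero_iff)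
    then have "((\<lambda>n. cc n * mdist M (f n (ap z n)) (f n (ap w n))) \<longlongrightarrow> c * mdist Z z w) U"
      by (intro tendsto_intros c)
    then have "((\<lambda>n. mdist sup_metric (zoom n (ap z n)) (zoom n (ap w n))) \<longlongrightarrow> c * mdist Z z w) U"
      by (simp add: zoom_d ap(1) z w)
    then show ?thesis
      using tendsto_unique[OF Une tendsto_sup_dist[OF h[OF z] h[OF w]]] by blast
  qed
  have sim: "similarity c Z sup_metric h" using cpos h_sim by (simp add: similarity_def)
  define Y where "Y = h ` mspace Z"
  have Y_closed: "closed Y" unfolding Y_def by (rule closed_similarity_image[OF sim Z(1)])
  define J where "J = {j. \<forall>\<^sub>F n in U. j \<in> JJ n}"
  have J_int: "J \<subseteq> int_vecs"
  proof
    fix j assume "j \<in> J"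
    then have "\<exists>n. j \<in> JJ n" by (intro eventually_ultra_ex[OF U(2)]) (simp add: J_def)
    then obtain n where "j \<in> JJ n" by blast
    then show "j \<in> int_vecs" using JJ_int by blast
  qed
  have J_iff: "\<forall>\<^sub>F n in U. j \<in> JJ n \<longleftrightarrow> j \<in> J" for j
  proof (cases "j \<in> J")
    case True
    then have "\<forall>\<^sub>F n in U. j \<in> JJ n" by (simp add: J_def)
    then show ?thesis by eventually_elim (simp add: True)
  next
    case False
    then have "\<forall>\<^sub>F n in U. j \<notin> JJ n" using ultra_not[OF U(2)] by (auto simp: J_def)
    then show ?thesis by eventually_elim (simp add: False)
  qed
  have transl_closed: "closed ((\<lambda>x. x + j) ` K)" for j
    by (intro compact_imp_closed compact_continuous_image K_compact continuous_intros)
  have Y_eq: "Y = (\<Union>j\<in>J. (\<lambda>x. x + j) ` K)"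
  proof (intro equalityI subsetI)
    fix y assume "y \<in> Y"
    then obtain z where z: "z \<in> mspace Z" "y = h z" by (auto simp: Y_def)
    \<comment> \<open>Only finitely many translates come near \<open>y\<close>, so the ultrafilter
      selects one that contains the approximating points. One unit is the distance of these points
      from \<open>y\<close>, the other the diameter of \<open>K\<close>.\<close>
    define T where "T = {j \<in> int_vecs. mdist sup_metric y j \<le> 1 + 1}"
    have T: "finite T" unfolding T_def by (rule bounded_int_vecs_finite)
    have "((\<lambda>n. mdist sup_metric y (zoom n (ap z n))) \<longlongrightarrow> mdist sup_metric y (h z)) U"
      by (intro tendsto_sup_dist tendsto_const h z)
    then have "\<forall>\<^sub>F n in U. mdist sup_metric y (zoom n (ap z n)) < 1"
      by (rule order_tendstoD(2)) (simp add: z(2))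
    then have "\<forall>\<^sub>F n in U. \<exists>j\<in>T. j \<in> JJ n \<and> zoom n (ap z n) \<in> (\<lambda>x. x + j) ` K"
    proof eventually_elim
      case (elim n)
      have "zoom n (ap z n) \<in> zoom n ` K" using ap(1)[OF z(1)] by blast
      then obtain j where j: "j \<in> JJ n" "zoom n (ap z n) \<in> (\<lambda>x. x + j) ` K" unfolding zoom_K by blast
      then have "mdist sup_metric y j \<le> 1 + 1" using elim by (intro translate_K_near) auto
      then show ?case using j JJ_int by (auto simp: T_def)
    qed
    from ultra_finite_ex[OF U(2) T this]
    obtain j where "j \<in> T" and ev: "\<forall>\<^sub>F n in U. j \<in> JJ n \<and> zoom n (ap z n) \<in> (\<lambda>x. x + j) ` K"
      by blast
    have "j \<in> J" unfolding J_def using ev by (auto elim: eventually_mono)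
    moreover have "h z \<in> (\<lambda>x. x + j) ` K"
      by (rule Lim_in_closed_set[OF transl_closed _ Une h[OF z(1)]]) (use ev in \<open>auto elim: eventually_mono\<close>)
    ultimately show "y \<in> (\<Union>j\<in>J. (\<lambda>x. x + j) ` K)" using z(2) by blast
  next
    fix y assume "y \<in> (\<Union>j\<in>J. (\<lambda>x. x + j) ` K)"
    then obtain j q where j: "j \<in> J" and q: "q \<in> K" "y = q + j" by blast
    \<comment> \<open>The point of \<open>K\<close> with blow-up exactly \<open>y\<close>, whenever
      the translate by \<open>j\<close> is present; otherwise \<open>x n\<close> is a default that
      keeps the sequence in a fixed ball.\<close>
    define b where "b n = (if j \<in> JJ n then cell (k n) (j + v n) q else x n)" for n
    have bK: "b n \<in> K" for n
    proof (cases "j \<in> JJ n")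
      case True
      then have "j + v n \<in> V (k n)" by (auto simp: JJ_def)
      then show ?thesis using True q cell_in_K by (simp add: b_def)
    qed (simp add: b_def xK)
    have zoom_b: "zoom n (b n) = y" if "j \<in> JJ n" for n
      using that by (simp add: b_def zoom_def blow_up_cell q(2))
    have evJ: "\<forall>\<^sub>F n in U. j \<in> JJ n" using j by (simp add: J_def)
    define R where "R = 2 + mdist sup_metric j 0"
    have R: "0 < R" by (simp add: R_def add_pos_nonneg)
    have b_ball: "mdist M p (f n (b n)) < R" for n
    proof (cases "j \<in> JJ n")
      case True
      have "mdist M p (f n (b n)) = mdist M (f n (x n)) (f n (b n))" by (simp add: fp)
      also have "\<dots> \<le> cc n * mdist M (f n (x n)) (f n (b n))"
        using cc(1)[of n] mult_right_mono[OF cc(1)[of n], of "mdist M (f n (x n)) (f n (b n))"] by simp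
      also have "\<dots> = mdist sup_metric (y0 n) y"
        using zoom_d[OF xK bK, of n n n] zoom_b[OF True] by (simp add: zoom_x)
      also have "\<dots> \<le> mdist sup_metric (y0 n) q + mdist sup_metric q y" by (rule sup_dist_triangle)
      also have "\<dots> \<le> 1 + mdist sup_metric j 0"
      proof -
        have "mdist sup_metric q y = mdist sup_metric (0 + q) (j + q)" by (simp add: q(2) add.commute)
        also have "\<dots> = mdist sup_metric 0 j" by (rule sup_dist_add_right)
        finally show ?thesis using K_sup_dist[OF y0(1) q(1), of n] by (simp add: mdist_commute)
      qed
      finally show ?thesis by (simp add: R_def)
    next
      case False
      then show ?thesis using R M by (simp add: b_def fp)
    qed
    have "f n (b n) \<in> f n ` K \<inter> mball_of M p R" for n
      using bK f_in b_ball M by (auto simp: ball)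
    then obtain s where s: "\<And>n. s n \<in> g ` mspace Z" "(\<lambda>n. mdist M (f n (b n)) (s n)) \<longlonglongrightarrow> 0"
      using hausdorff_approx[OF lim1[OF R], of "\<lambda>n. f n (b n)"] Z(2) by blast
    then have "\<forall>n. \<exists>z. z \<in> mspace Z \<and> s n = g z" by blast
    then obtain z where z: "\<And>n. z n \<in> mspace Z" "\<And>n. s n = g (z n)" by metis
    have "\<forall>\<^sub>F n in U. mdist M (f n (b n)) (s n) < 1"
      using toU[OF s(2)] by (rule order_tendstoD(2)) simp
    then have "\<forall>\<^sub>F n in U. h (z n) \<in> cball (h z0) (real CARD('n) * (c * (R + 1)))"
    proof eventually_elim
      case (elim n)
      have "mdist Z z0 (z n) = mdist M p (s n)" using g_iso[OF Z(2) z(1), of n] by (simp add: gp z(2))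
      also have "\<dots> \<le> mdist M p (f n (b n)) + mdist M (f n (b n)) (s n)"
        using M bK f_in g_in z by (intro mdist_triangle) auto
      also have "\<dots> \<le> R + 1" using b_ball[of n] elim by simp
      finally have "mdist sup_metric (h z0) (h (z n)) \<le> c * (R + 1)"
        using h_sim[OF Z(2) z(1)] cpos by simp
      then have "real CARD('n) * mdist sup_metric (h z0) (h (z n)) \<le> real CARD('n) * (c * (R + 1))"
        by (intro mult_left_mono) auto
      then have "dist (h z0) (h (z n)) \<le> real CARD('n) * (c * (R + 1))"
        using dist_le_sup_dist[of "h z0" "h (z n)"] by linarith
      then show ?case by simp
    qed
    from ultra_tendsto_compact[OF U(2) compact_cball this]
    obtain y' where y': "((\<lambda>n. h (z n)) \<longlongrightarrow> y') U" by blast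
    \<comment> \<open>Closedness of \<open>Y\<close> makes the limit a value of \<open>h\<close>;
      since \<open>h\<close> is a similarity, the points \<open>z n\<close> then converge in
      \<open>Z\<close> itself.\<close>
    have "y' \<in> Y"
      by (rule Lim_in_closed_set[OF Y_closed _ Une y']) (simp add: Y_def z(1))
    then obtain z' where z': "z' \<in> mspace Z" "y' = h z'" by (auto simp: Y_def)
    have "((\<lambda>n. mdist sup_metric (h (z n)) (h z')) \<longlongrightarrow> mdist sup_metric y' (h z')) U"
      by (intro tendsto_sup_dist y' tendsto_const)
    then have "((\<lambda>n. (1 / c) * (c * mdist Z (z n) z')) \<longlongrightarrow> (1 / c) * 0) U"
      by (intro tendsto_mult tendsto_const) (simp add: h_sim z z')
    then have zz: "((\<lambda>n. mdist Z (z n) z') \<longlongrightarrow> 0) U" using cpos by simp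
    have "((\<lambda>n. real l * (mdist M (f n (b n)) (s n) + mdist Z (z n) z' + mdist M (g z') (f n (ap z' n)))) \<longlongrightarrow> real l * (0 + 0 + 0)) U"
      by (intro tendsto_mult tendsto_add tendsto_const toU s(2) zz ap(2) z')
    then have l0: "((\<lambda>n. real l * (mdist M (f n (b n)) (s n) + mdist Z (z n) z' + mdist M (g z') (f n (ap z' n)))) \<longlongrightarrow> 0) U" by simp
    have "\<forall>\<^sub>F n in U. norm (mdist sup_metric y (zoom n (ap z' n))) \<le>
        real l * (mdist M (f n (b n)) (s n) + mdist Z (z n) z' + mdist M (g z') (f n (ap z' n)))"
      using evJ
    proof eventually_elim
      case (elim n)
      have "mdist M (f n (b n)) (f n (ap z' n)) \<le> mdist M (f n (b n)) (s n) + mdist M (s n) (f n (ap z' n))"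
        using bK ap(1)[OF z'(1)] f_in g_in z by (intro mdist_triangle) auto
      moreover have "mdist M (s n) (f n (ap z' n)) \<le> mdist M (s n) (g z') + mdist M (g z') (f n (ap z' n))"
        using bK ap(1)[OF z'(1)] f_in g_in z z' by (intro mdist_triangle) auto
      moreover have "mdist M (s n) (g z') = mdist Z (z n) z'" using g_iso[OF z(1) z'(1)] by (simp add: z(2))
      ultimately have le: "mdist M (f n (b n)) (f n (ap z' n)) \<le> mdist M (f n (b n)) (s n) + mdist Z (z n) z' + mdist M (g z') (f n (ap z' n))"
        by linarith
      have "mdist sup_metric y (zoom n (ap z' n)) = cc n * mdist M (f n (b n)) (f n (ap z' n))"
        using zoom_d[OF bK ap(1)[OF z'(1)], of n n n] zoom_b[OF elim] by simp
      also have "\<dots> \<le> real l * (mdist M (f n (b n)) (s n) + mdist Z (z n) z' + mdist M (g z') (f n (ap z' n)))"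
        using le cc(2)[of n] by (intro mult_mono) auto
      finally show ?case by simp
    qed
    then have "((\<lambda>n. mdist sup_metric y (zoom n (ap z' n))) \<longlongrightarrow> 0) U"
      by (rule Lim_null_comparison[OF _ l0])
    moreover have "((\<lambda>n. mdist sup_metric y (zoom n (ap z' n))) \<longlongrightarrow> mdist sup_metric y (h z')) U"
      by (intro tendsto_sup_dist tendsto_const h z')
    ultimately have "mdist sup_metric y (h z') = 0" using tendsto_unique[OF Une] by blast
    then have "y = h z'" by (simp add: mdist_zero)
    then show "y \<in> Y" using z' by (auto simp: Y_def)
  qed
  \<comment> \<open>Only finitely many integer vectors matter in a ball, and on those
    \<open>JJ n\<close> agrees with \<open>J\<close> along the ultrafilter.\<close>
  have Y_local: "\<forall>\<^sub>F n in U. Y \<inter> {y. mdist sup_metric a y < \<rho>} = zoom n ` K \<inter> {y. mdist sup_metric a y < \<rho>}" for a \<rho>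
  proof -
    define T where "T = {j \<in> int_vecs. mdist sup_metric a j \<le> \<rho> + 1}"
    have "finite T" unfolding T_def by (rule bounded_int_vecs_finite)
    then have "\<forall>\<^sub>F n in U. \<forall>j\<in>T. j \<in> JJ n \<longleftrightarrow> j \<in> J"
      using J_iff by (intro eventually_ball_finite) auto
    then show ?thesis
    proof eventually_elim
      case (elim n)
      have T: "j \<in> T" if "j \<in> int_vecs" "y \<in> (\<lambda>x. x + j) ` K" "mdist sup_metric a y < \<rho>" for j y
        using translate_K_near[OF that(2), of a \<rho>] that by (simp add: T_def)
      show ?case
        unfolding Y_eq zoom_K using T elim J_int JJ_int[of n] by (intro equalityI subsetI) (simp, blast)+
    qed
  qed
  have upper: "emeasure H (Y \<inter> {y. mdist sup_metric a y < \<rho>}) \<le> ennreal (near_const * massK * \<rho> powr dimK)"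
    if "0 < \<rho>" for a \<rho>
  proof -
    obtain n where "Y \<inter> {y. mdist sup_metric a y < \<rho>} = zoom n ` K \<inter> {y. mdist sup_metric a y < \<rho>}"
      using eventually_ultra_ex[OF U(2) Y_local[of a \<rho>]] by blast
    then show ?thesis using blow_up_ball_upper[OF that] by (simp add: zoom_def)
  qed
  have lower: "ennreal (massK / real (card S) * \<rho> powr dimK) \<le> emeasure H (Y \<inter> {y. mdist sup_metric a y < \<rho>})"
    if a: "a \<in> Y" and \<rho>: "0 < \<rho>" and ex: "\<exists>x\<in>Y. \<exists>y\<in>Y. \<rho> < mdist sup_metric x y" for a \<rho>
  proof -
    obtain x1 y1 where xy: "x1 \<in> Y" "y1 \<in> Y" "\<rho> < mdist sup_metric x1 y1" using ex by blast
    \<comment> \<open>The second ball contains \<open>x1\<close> and \<open>y1\<close>, so the same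
      blow-up has diameter greater than \<rho>; this yields \<open>\<rho> \<le> l ^ k n\<close>, as
      the lower bound demands.\<close>
    obtain n where n: "Y \<inter> {y. mdist sup_metric a y < \<rho>} = zoom n ` K \<inter> {y. mdist sup_metric a y < \<rho>}"
      "Y \<inter> {y. mdist sup_metric x1 y < mdist sup_metric x1 y1 + 1} = zoom n ` K \<inter> {y. mdist sup_metric x1 y < mdist sup_metric x1 y1 + 1}"
      using eventually_ultra_ex[OF U(2) eventually_conj[OF Y_local[of a \<rho>] Y_local[of x1 "mdist sup_metric x1 y1 + 1"]]] by blast
    have "0 < mdist sup_metric x1 y1 + 1" by (simp add: add_nonneg_pos)
    then have "x1 \<in> Y \<inter> {y. mdist sup_metric x1 y < mdist sup_metric x1 y1 + 1}"
      "y1 \<in> Y \<inter> {y. mdist sup_metric x1 y < mdist sup_metric x1 y1 + 1}"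
      using xy by simp_all
    then have "x1 \<in> zoom n ` K" "y1 \<in> zoom n ` K" unfolding n(2) by blast+
    then obtain x2 y2 where "x2 \<in> K" "y2 \<in> K" "x1 = zoom n x2" "y1 = zoom n y2" by blast
    then have "mdist sup_metric x1 y1 \<le> real l ^ k n * 1"
      using K_sup_dist[of x2 y2] unfolding zoom_def by (simp add: blow_up_sup_dist)
    then have "\<rho> \<le> real l ^ k n" using xy(3) by simp
    moreover have "a \<in> Y \<inter> {y. mdist sup_metric a y < \<rho>}" using a \<rho> by simp
    then have "a \<in> zoom n ` K" unfolding n(1) by blast
    ultimately show ?thesis using blow_up_ball_lower[OF \<rho>] n(1) by (simp add: zoom_def)
  qed
  show ?thesis
    by (intro exI[of _ c] exI[of _ h] exI[of _ J] conjI allI impI ballI sim J_int Y_eq[unfolded Y_def]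
        Y_closed[unfolded Y_def] upper[unfolded Y_def] lower[unfolded Y_def])
qed

end

section \<open>Hausdorff measure on a similar copy of a closed set\<close>

text \<open>Restricted to a ball the measure is finite, hence outer regular. The open sets found
  there are cut down to the balls and united, with errors \<open>e / 2^(n + 1)\<close>.\<close>

lemma outer_regular_locally_finite:
  fixes \<Lambda> :: "'a :: euclidean_space measure"
  assumes sets: "sets \<Lambda> = sets borel" and fin: "\<And>n :: nat. emeasure \<Lambda> (ball 0 (real n)) < \<infinity>"
    and B: "B \<in> sets borel" and e: "0 < e"
  shows "\<exists>W. open W \<and> B \<subseteq> W \<and> emeasure \<Lambda> W \<le> emeasure \<Lambda> B + ennreal e"
proof -
  have [simp]: "space \<Lambda> = UNIV" using sets_eq_imp_space_eq[OF sets] by simp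
  note [simp] = sets
  define b where "b n = ball (0 :: 'a) (real n)" for n
  have b[simp]: "b n \<in> sets borel" "open (b n)" for n by (simp_all add: b_def)
  have "\<exists>W. open W \<and> B \<subseteq> W \<and> emeasure \<Lambda> (b n \<inter> W - B) \<le> ennreal (e * (1/2) ^ Suc n)" for n
  proof -
    define N where "N = density \<Lambda> (indicator (b n))"
    have N: "emeasure N A = emeasure \<Lambda> (b n \<inter> A)" if "A \<in> sets borel" for A
      unfolding N_def using that by (intro emeasure_restricted) simp_all
    have finN: "emeasure N (space N) \<noteq> \<infinity>"
      using fin[of n] by (simp add: N_def emeasure_restricted b_def)
    have "emeasure N B \<le> emeasure N (space N)"
      using B by (intro emeasure_mono) (auto simp: N_def sets.sets_into_space)
    then have Bfin: "emeasure N B < top" using finN by (simp add: less_top order_le_less_trans)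
    then have "emeasure N B < emeasure N B + ennreal (e * (1/2) ^ Suc n)"
      using e by (simp add: ennreal_zero_less_mult_iff)
    also have "emeasure N B = (INF W\<in>{W. B \<subseteq> W \<and> open W}. emeasure N W)"
      using finN B by (intro outer_regular) (simp_all add: N_def)
    finally obtain W where W: "B \<subseteq> W" "open W" "emeasure N W < emeasure N B + ennreal (e * (1/2) ^ Suc n)"
      unfolding INF_less_iff using \<open>emeasure N B = _\<close> by auto
    have "emeasure N W = emeasure N B + emeasure N (W - B)"
      using W(1,2) B by (subst plus_emeasure) (auto simp: N_def intro!: arg_cong[where f = "emeasure _"])
    with W(3) have "emeasure N (W - B) \<le> ennreal (e * (1/2) ^ Suc n)"
      using Bfin by (simp add: ennreal_add_left_cancel_less less_top[symmetric] less_imp_le)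
    moreover have "b n \<inter> (W - B) = b n \<inter> W - B" by blast
    ultimately show ?thesis using W(1,2) B by (auto simp: N)
  qed
  then obtain W where W: "\<And>n. open (W n)" "\<And>n. B \<subseteq> W n"
    "\<And>n. emeasure \<Lambda> (b n \<inter> W n - B) \<le> ennreal (e * (1/2) ^ Suc n)" by metis
  define W0 where "W0 = (\<Union>n. b n \<inter> W n)"
  have "B \<subseteq> W0"
  proof
    fix x assume x: "x \<in> B"
    obtain n :: nat where "norm x < real n" using reals_Archimedean2 by blast
    then show "x \<in> W0" using x W(2) by (auto simp: W0_def b_def)
  qed
  moreover have "open W0" unfolding W0_def using W(1) b(2) by (intro open_UN ballI open_Int)
  moreover have "emeasure \<Lambda> W0 \<le> emeasure \<Lambda> B + ennreal e"
  proof -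
    have "emeasure \<Lambda> W0 \<le> emeasure \<Lambda> (B \<union> (\<Union>n. b n \<inter> W n - B))"
      using B W(1) by (intro emeasure_mono) (auto simp: W0_def)
    also have "\<dots> \<le> emeasure \<Lambda> B + emeasure \<Lambda> (\<Union>n. b n \<inter> W n - B)"
      using B W(1) by (intro emeasure_subadditive) auto
    also have "emeasure \<Lambda> (\<Union>n. b n \<inter> W n - B) \<le> (\<Sum>n. emeasure \<Lambda> (b n \<inter> W n - B))"
      using B W(1) by (intro emeasure_subadditive_countably) auto
    also have "\<dots> \<le> (\<Sum>n. ennreal (e * (1/2) ^ Suc n))" using W(3) by (intro suminf_le) auto
    also have "\<dots> = ennreal e"
      using sums_mult[OF power_half_series, of e] e by (intro suminf_ennreal_eq) auto
    finally show ?thesis by (simp add: add_left_mono)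
  qed
  ultimately show ?thesis by blast
qed

text \<open>The Hausdorff measure of \<open>Z\<close> is studied through its copy in Euclidean
  space. A closed image makes the images of Borel sets Borel, and preimages of compact sets
  compact.\<close>

locale similar_copy =
  fixes c s :: real and Z :: "'z metric" and h :: "'z \<Rightarrow> real ^ 'n"
  assumes sim: "similarity c Z sup_metric h" and Y_closed: "closed (h ` mspace Z)" and s: "0 \<le> s"
begin

abbreviation "Y \<equiv> h ` mspace Z"
abbreviation "HZ \<equiv> hausdorff_measure s Z"
abbreviation "HR \<equiv> hausdorff_measure s (sup_metric :: (real ^ 'n) metric)"

lemma c_pos: "0 < c" using sim by (simp add: similarity_def)

lemma h_dist: "x \<in> mspace Z \<Longrightarrow> y \<in> mspace Z \<Longrightarrow> mdist sup_metric (h x) (h y) = c * mdist Z x y"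
  using sim by (simp add: similarity_def)

lemma inj_h: "inj_on h (mspace Z)" using sim by (rule similarity_inj_on)

lemma open_sub: "{U. openin (mtopology_of Z) U} \<subseteq> Pow (mspace Z)"
  using openin_subset by fastforce

lemma space_HZ: "space HZ = mspace Z"
  unfolding hausdorff_measure_def using open_sub by (rule space_measure_of)

lemma sets_HZ: "sets HZ = sigma_sets (mspace Z) {U. openin (mtopology_of Z) U}"
  unfolding hausdorff_measure_def using open_sub by (rule sets_measure_of)

lemma sets_HZ_borel_of: "sets HZ = sets (borel_of (mtopology_of Z))"
  unfolding sets_HZ borel_of_def using open_sub by (simp add: sets_measure_of)

lemma openin_HZ: "openin (mtopology_of Z) U \<Longrightarrow> U \<in> sets HZ"
  unfolding sets_HZ by auto

lemma openin_Z: "openin (mtopology_of Z) U \<longleftrightarrow> U \<subseteq> mspace Z \<and> (\<forall>x\<in>U. \<exists>r>0. \<forall>y\<in>mspace Z. mdist Z x y < r \<longrightarrow> y \<in> U)"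
proof -
  interpret Metric_space "mspace Z" "mdist Z" by simp
  have *: "mball x r \<subseteq> U \<longleftrightarrow> (\<forall>y\<in>mspace Z. mdist Z x y < r \<longrightarrow> y \<in> U)" if "x \<in> mspace Z" for x r
    using that by auto
  show ?thesis
    unfolding mtopology_of_def openin_mtopology Ball_def[of U]
    by (intro conj_cong refl all_cong1 imp_cong ex_cong1 *) blast
qed

lemma open_sup: "open W \<longleftrightarrow> (\<forall>x\<in>W. \<exists>r>0. \<forall>y :: real ^ 'n. mdist sup_metric x y < r \<longrightarrow> y \<in> W)"
proof -
  interpret Metric_space "UNIV :: (real ^ 'n) set" "mdist sup_metric"
    using Metric_space_mspace_mdist[of "sup_metric :: (real ^ 'n) metric"] by simp
  have "openin (mtopology_of sup_metric) W \<longleftrightarrow> open W" by (simp add: mtopology_of_sup_metric)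
  then show ?thesis by (auto simp: mtopology_of_def openin_mtopology subset_iff)
qed

lemma continuous_h: "continuous_map (mtopology_of Z) euclidean h"
  unfolding continuous_map_def
proof (intro conjI allI impI)
  fix W :: "(real ^ 'n) set" assume "openin euclidean W"
  then have W: "open W" by simp
  show "openin (mtopology_of Z) {x \<in> topspace (mtopology_of Z). h x \<in> W}"
    unfolding openin_Z
  proof (intro conjI ballI)
    fix x assume x: "x \<in> {x \<in> topspace (mtopology_of Z). h x \<in> W}"
    then obtain r where r: "0 < r" "\<And>y. mdist sup_metric (h x) y < r \<Longrightarrow> y \<in> W"
      using W unfolding open_sup by auto
    show "\<exists>r>0. \<forall>y\<in>mspace Z. mdist Z x y < r \<longrightarrow> y \<in> {x \<in> topspace (mtopology_of Z). h x \<in> W}"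
    proof (intro exI[of _ "r / c"] conjI ballI impI)
      show "0 < r / c" using r c_pos by simp
      fix y assume y: "y \<in> mspace Z" "mdist Z x y < r / c"
      then have "mdist sup_metric (h x) (h y) < r"
        using x c_pos by (simp add: h_dist pos_less_divide_eq mult.commute)
      then show "y \<in> {x \<in> topspace (mtopology_of Z). h x \<in> W}" using y r(2) by simp
    qed
  qed auto
qed simp

lemma measurable_h: "h \<in> borel_measurable HZ"
proof (rule borel_measurableI)
  fix W :: "(real ^ 'n) set" assume "open W"
  then have "openin (mtopology_of Z) {x \<in> topspace (mtopology_of Z). h x \<in> W}"
    using continuous_h by (simp add: continuous_map_def)
  then show "h -` W \<inter> space HZ \<in> sets HZ"
    by (intro openin_HZ) (simp add: space_HZ vimage_def Int_def conj_commute)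
qed

text \<open>A ball of radius \<open>r\<close> in \<open>Z\<close> corresponds to the trace on
  \<open>Y\<close> of a ball of radius \<open>c * r\<close>; the union of such balls cuts out the
  image.\<close>

lemma image_open:
  assumes "openin (mtopology_of Z) U"
  shows "\<exists>W. open W \<and> h ` U = Y \<inter> W"
proof -
  define W where "W = (\<Union>x\<in>U. \<Union>r\<in>{r. \<forall>y\<in>mspace Z. mdist Z x y < r \<longrightarrow> y \<in> U}. {y. mdist sup_metric (h x) y < c * r})"
  have "open W" unfolding W_def by (intro open_UN ballI open_sup_ball)
  moreover have "h ` U \<subseteq> Y \<inter> W"
  proof safe
    fix x assume x: "x \<in> U"
    then show "h x \<in> Y" using assms by (auto simp: openin_Z)
    obtain r where r: "0 < r" "\<forall>y\<in>mspace Z. mdist Z x y < r \<longrightarrow> y \<in> U"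
      using assms x by (auto simp: openin_Z)
    then have "h x \<in> {y. mdist sup_metric (h x) y < c * r}" using c_pos by simp
    then show "h x \<in> W" unfolding W_def using x r(2) by blast
  qed
  moreover have "Y \<inter> W \<subseteq> h ` U"
  proof safe
    fix y assume y: "y \<in> mspace Z" "h y \<in> W"
    then obtain x r where x: "x \<in> U" "\<forall>y\<in>mspace Z. mdist Z x y < r \<longrightarrow> y \<in> U" "mdist sup_metric (h x) (h y) < c * r"
      unfolding W_def by blast
    have "x \<in> mspace Z" using x(1) assms by (auto simp: openin_Z)
    then have "mdist Z x y < r" using x(3) y(1) c_pos by (simp add: h_dist)
    then show "h y \<in> h ` U" using x(2) y(1) by blast
  qed
  ultimately show ?thesis by blast
qed

definition h_inv :: "real ^ 'n \<Rightarrow> 'z" where "h_inv = inv_into (mspace Z) h"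

lemma h_inv: "x \<in> mspace Z \<Longrightarrow> h_inv (h x) = x" "y \<in> Y \<Longrightarrow> h_inv y \<in> mspace Z" "y \<in> Y \<Longrightarrow> h (h_inv y) = y"
  unfolding h_inv_def using inj_h by (auto intro: inv_into_f_f inv_into_into f_inv_into_f)

lemma h_inv_vimage: "U \<subseteq> mspace Z \<Longrightarrow> {y \<in> Y. h_inv y \<in> U} = h ` U"
proof (intro equalityI subsetI)
  fix y assume "U \<subseteq> mspace Z" "y \<in> {y \<in> Y. h_inv y \<in> U}"
  then show "y \<in> h ` U" using h_inv(3)[of y] by (metis (mono_tags, lifting) image_eqI mem_Collect_eq)
qed (auto simp: h_inv)

lemma continuous_h_inv: "continuous_map (top_of_set Y) (mtopology_of Z) h_inv"
  unfolding continuous_map_def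
proof (intro conjI allI impI)
  show "h_inv \<in> topspace (top_of_set Y) \<rightarrow> topspace (mtopology_of Z)"
    using h_inv(2) by auto
  fix U assume U: "openin (mtopology_of Z) U"
  obtain W where "open W" "h ` U = Y \<inter> W" using image_open[OF U] by blast
  moreover have "{y \<in> topspace (top_of_set Y). h_inv y \<in> U} = h ` U"
    using h_inv_vimage[of U] U by (simp add: openin_Z)
  ultimately show "openin (top_of_set Y) {y \<in> topspace (top_of_set Y). h_inv y \<in> U}"
    by (simp add: openin_open_Int)
qed

lemma measurable_h_inv: "h_inv \<in> measurable (restrict_space borel Y) HZ"
  unfolding hausdorff_measure_def
proof (rule measurable_measure_of[OF open_sub])
  show "h_inv \<in> space (restrict_space borel Y) \<rightarrow> mspace Z"
    using h_inv(2) by (auto simp: space_restrict_space)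
  fix U assume "U \<in> {U. openin (mtopology_of Z) U}"
  then have U: "openin (mtopology_of Z) U" by simp
  obtain W where W: "open W" "h ` U = Y \<inter> W" using image_open[OF U] by blast
  have "h_inv -` U \<inter> space (restrict_space borel Y) = {y \<in> Y. h_inv y \<in> U}"
    by (auto simp: space_restrict_space)
  also have "\<dots> = h ` U" using h_inv_vimage[of U] U by (simp add: openin_Z)
  finally show "h_inv -` U \<inter> space (restrict_space borel Y) \<in> sets (restrict_space borel Y)"
    using W Y_closed by (auto simp: sets_restrict_space)
qed

lemma image_borel:
  assumes "B \<in> sets HZ" shows "h ` B \<in> sets borel"
proof -
  have "h_inv -` B \<inter> space (restrict_space borel Y) \<in> sets (restrict_space borel Y)"
    by (rule measurable_sets[OF measurable_h_inv assms])
  moreover have "h_inv -` B \<inter> space (restrict_space borel Y) = {y \<in> Y. h_inv y \<in> B}"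
    by (auto simp: space_restrict_space)
  moreover have "\<dots> = h ` B"
    using sets.sets_into_space[OF assms] by (intro h_inv_vimage) (simp add: space_HZ)
  ultimately show ?thesis using Y_closed by (auto simp: sets_restrict_space)
qed

lemma emeasure_HZ:
  assumes "B \<in> sets HZ"
  shows "emeasure HR (h ` B) = ennreal (c powr s) * emeasure HZ B"
proof -
  have "B \<subseteq> mspace Z" using sets.sets_into_space[OF assms] by (simp add: space_HZ)
  then show ?thesis
    using hausdorff_outer_similarity_image[OF sim _ s, of B] image_borel[OF assms] assms
    by (simp add: emeasure_hausdorff_sup_metric emeasure_hausdorff_measure)
qed

lemma emeasure_HZ':
  assumes "B \<in> sets HZ"
  shows "emeasure HZ B = ennreal (1 / c powr s) * emeasure HR (h ` B)"
  using c_pos by (simp add: emeasure_HZ[OF assms] mult.assoc[symmetric] ennreal_mult[symmetric])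

lemma nn_integral_HZ:
  assumes F: "F \<in> borel_measurable borel"
  shows "(\<integral>\<^sup>+z. F (h z) \<partial>HZ) = ennreal (1 / c powr s) * (\<integral>\<^sup>+y\<in>Y. F y \<partial>HR)"
proof -
  have Yb: "Y \<in> sets borel" using Y_closed by (rule borel_closed)
  have eq: "distr HZ borel h = scale_measure (ennreal (1 / c powr s)) (density HR (indicator Y))"
  proof (rule measure_eqI)
    fix A assume "A \<in> sets (distr HZ borel h)"
    then have A: "A \<in> sets borel" by simp
    have hA: "h ` (h -` A \<inter> space HZ) = Y \<inter> A" by (auto simp: space_HZ)
    have "h -` A \<inter> space HZ \<in> sets HZ" using measurable_sets[OF measurable_h A] .
    then show "emeasure (distr HZ borel h) A = emeasure (scale_measure (ennreal (1 / c powr s)) (density HR (indicator Y))) A"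
      using A Yb by (simp add: emeasure_distr[OF measurable_h] emeasure_HZ' hA emeasure_restricted)
  qed simp
  have "(\<integral>\<^sup>+z. F (h z) \<partial>HZ) = (\<integral>\<^sup>+y. F y \<partial>distr HZ borel h)"
    by (rule nn_integral_distr[OF measurable_h, symmetric]) (use F in simp)
  also have "\<dots> = ennreal (1 / c powr s) * (\<integral>\<^sup>+y\<in>Y. F y \<partial>HR)"
    using F Yb unfolding eq
    by (subst nn_integral_scale_measure) (simp_all add: nn_integral_density mult.commute)
  finally show ?thesis .
qed

lemma image_ball:
  assumes z: "z \<in> mspace Z"
  shows "h ` mball_of Z z r = Y \<inter> {y. mdist sup_metric (h z) y < c * r}"
proof -
  have "mdist Z z w < r \<longleftrightarrow> mdist sup_metric (h z) (h w) < c * r" if "w \<in> mspace Z" for w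
    using that z c_pos by (simp add: h_dist)
  then show ?thesis using z by auto
qed

lemma ball_HZ: "mball_of Z z r \<in> sets HZ"
proof -
  interpret Metric_space "mspace Z" "mdist Z" by simp
  show ?thesis by (intro openin_HZ) (simp add: mball_of_def mtopology_of_def)
qed

lemma compactin_vimage:
  assumes "compact C"
  shows "compactin (mtopology_of Z) {z \<in> mspace Z. h z \<in> C}"
proof -
  have "compact (Y \<inter> C)" using Y_closed assms by (rule closed_Int_compact)
  then have "compactin (top_of_set Y) (Y \<inter> C)" by (simp add: compactin_subtopology)
  then have "compactin (mtopology_of Z) (h_inv ` (Y \<inter> C))" using continuous_h_inv by (rule image_compactin)
  moreover have "h_inv ` (Y \<inter> C) = {z \<in> mspace Z. h z \<in> C}"
  proof (intro equalityI subsetI)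
    fix z assume "z \<in> {z \<in> mspace Z. h z \<in> C}"
    then have "h z \<in> Y \<inter> C" "z = h_inv (h z)" by (auto simp: h_inv(1))
    then show "z \<in> h_inv ` (Y \<inter> C)" by (rule image_eqI[rotated])
  qed (auto simp: h_inv)
  ultimately show ?thesis by simp
qed

lemma closed_HZ:
  assumes "closedin (mtopology_of Z) C" shows "C \<in> sets HZ"
proof -
  have "mspace Z - (mspace Z - C) \<in> sets HZ"
    using assms openin_HZ[of "mspace Z - C"] sets.compl_sets[of "mspace Z - C" HZ]
    by (simp add: closedin_def space_HZ)
  moreover have "mspace Z - (mspace Z - C) = C" using closedin_subset[OF assms] by auto
  ultimately show ?thesis by simp
qed

lemma compactin_closedin_Z: "compactin (mtopology_of Z) C \<Longrightarrow> closedin (mtopology_of Z) C"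
proof -
  interpret Metric_space "mspace Z" "mdist Z" by simp
  show "compactin (mtopology_of Z) C \<Longrightarrow> closedin (mtopology_of Z) C"
    by (auto simp: mtopology_of_def intro: compactin_imp_closedin Hausdorff_space_mtopology)
qed

text \<open>Outer regularity is inherited from a locally finite Euclidean measure, and inner
  regularity on open sets from exhausting a Euclidean open set by compact sets and pulling these
  back.\<close>

lemma radon_measure_HZ:
  assumes fin: "\<And>r. emeasure HR (Y \<inter> {y. mdist sup_metric 0 y < r}) < \<infinity>"
  shows "radon_measure (mtopology_of Z) HZ"
  unfolding radon_measure_def
proof (intro conjI allI impI ballI)
  have Yb: "Y \<in> sets borel" using Y_closed by (rule borel_closed)
  show "space HZ = topspace (mtopology_of Z)" by (simp add: space_HZ)
  show "sets HZ = sets (borel_of (mtopology_of Z))" by (rule sets_HZ_borel_of)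
  fix C assume C: "compactin (mtopology_of Z) C"
  have "compactin euclidean (h ` C)" using C continuous_h by (rule image_compactin)
  then have "bounded (h ` C)" by (simp add: compact_imp_bounded)
  then obtain r where r: "\<And>y. y \<in> h ` C \<Longrightarrow> norm y \<le> r" by (auto simp: bounded_iff)
  have sub: "C \<subseteq> mspace Z" using compactin_subset_topspace[OF C] by simp
  have "emeasure HR (h ` C) \<le> emeasure HR (Y \<inter> {y. mdist sup_metric 0 y < r + 1})"
  proof (rule emeasure_mono)
    show "h ` C \<subseteq> Y \<inter> {y. mdist sup_metric 0 y < r + 1}"
    proof safe
      fix x assume x: "x \<in> C"
      then show "h x \<in> Y" using sub by blast
      show "mdist sup_metric 0 (h x) < r + 1"
        using r[of "h x"] x sup_dist_le_dist[of 0 "h x"] by (simp add: dist_norm)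
    qed
    show "Y \<inter> {y. mdist sup_metric 0 y < r + 1} \<in> sets HR"
      using sets.Int[OF Yb borel_open[OF open_sup_ball, of 0 "r + 1"]] by simp
  qed
  then have "emeasure HR (h ` C) < \<infinity>" using fin by (rule order_le_less_trans)
  then show "emeasure HZ C < \<infinity>"
    using closed_HZ[OF compactin_closedin_Z[OF C]] by (simp add: emeasure_HZ' ennreal_mult_less_top)
next
  have Yb: "Y \<in> sets borel" using Y_closed by (rule borel_closed)
  fix B assume B: "B \<in> sets HZ"
  define \<Lambda> where "\<Lambda> = density HR (indicator Y)"
  have \<Lambda>: "emeasure \<Lambda> A = emeasure HR (Y \<inter> A)" if "A \<in> sets borel" for A
    unfolding \<Lambda>_def using that Yb by (intro emeasure_restricted) simp_all
  show "emeasure HZ B = (INF U\<in>{U. openin (mtopology_of Z) U \<and> B \<subseteq> U}. emeasure HZ U)"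
  proof (rule antisym)
    show "emeasure HZ B \<le> (INF U\<in>{U. openin (mtopology_of Z) U \<and> B \<subseteq> U}. emeasure HZ U)"
      by (intro INF_greatest emeasure_mono) (auto intro: openin_HZ)
    show "(INF U\<in>{U. openin (mtopology_of Z) U \<and> B \<subseteq> U}. emeasure HZ U) \<le> emeasure HZ B"
    proof (rule ennreal_le_epsilon)
      fix e :: real assume e: "0 < e"
      \<comment> \<open>The factor \<open>c powr s\<close> in the error cancels when the measure is
        carried back to \<open>Z\<close>.\<close>
      have "\<exists>W. open W \<and> h ` B \<subseteq> W \<and> emeasure \<Lambda> W \<le> emeasure \<Lambda> (h ` B) + ennreal (e * c powr s)"
      proof (rule outer_regular_locally_finite)
        fix n :: nat
        have "ball (0 :: real ^ 'n) (real n) \<subseteq> {y. mdist sup_metric 0 y < real n}"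
        proof
          fix y :: "real ^ 'n" assume "y \<in> ball 0 (real n)"
          then show "y \<in> {y. mdist sup_metric 0 y < real n}"
            using sup_dist_le_dist[of 0 y] by simp
        qed
        then have "emeasure \<Lambda> (ball 0 (real n)) \<le> emeasure HR (Y \<inter> {y. mdist sup_metric 0 y < real n})"
          using Yb borel_open[OF open_sup_ball, of 0 "real n"] by (subst \<Lambda>) (auto intro!: emeasure_mono)
        then show "emeasure \<Lambda> (ball 0 (real n)) < \<infinity>" using fin by (rule order_le_less_trans)
      qed (use e c_pos image_borel[OF B] in \<open>simp_all add: \<Lambda>_def\<close>)
      then obtain W where W: "open W" "h ` B \<subseteq> W" "emeasure \<Lambda> W \<le> emeasure \<Lambda> (h ` B) + ennreal (e * c powr s)" by blast
      define U where "U = {z \<in> topspace (mtopology_of Z). h z \<in> W}"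
      have U: "openin (mtopology_of Z) U"
        unfolding U_def using continuous_h W(1) by (simp add: continuous_map_def)
      have BZ: "B \<subseteq> mspace Z" using sets.sets_into_space[OF B] by (simp add: space_HZ)
      then have BU: "B \<subseteq> U" using W(2) by (auto simp: U_def)
      have hU: "h ` U = Y \<inter> W" by (auto simp: U_def)
      have "emeasure HZ U = ennreal (1 / c powr s) * emeasure \<Lambda> W"
        using W(1) by (simp add: emeasure_HZ'[OF openin_HZ[OF U]] hU \<Lambda>)
      also have "\<dots> \<le> ennreal (1 / c powr s) * (emeasure \<Lambda> (h ` B) + ennreal (e * c powr s))"
        using W(3) by (rule mult_left_mono) simp
      also have "emeasure \<Lambda> (h ` B) = emeasure HR (h ` B)"
        using BZ by (simp add: \<Lambda>[OF image_borel[OF B]] Int_absorb1 image_mono)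
      also have "ennreal (1 / c powr s) * (emeasure HR (h ` B) + ennreal (e * c powr s)) = emeasure HZ B + ennreal e"
        using c_pos e by (simp add: emeasure_HZ'[OF B] distrib_left ennreal_mult[symmetric])
      finally have "emeasure HZ U \<le> emeasure HZ B + ennreal e" .
      then show "(INF U\<in>{U. openin (mtopology_of Z) U \<and> B \<subseteq> U}. emeasure HZ U) \<le> emeasure HZ B + ennreal e"
        using U BU by (intro INF_lower2[of U]) auto
    qed
  qed
next
  fix U assume U: "openin (mtopology_of Z) U"
  show "emeasure HZ U = (SUP C\<in>{C. compactin (mtopology_of Z) C \<and> closedin (mtopology_of Z) C \<and> C \<subseteq> U}. emeasure HZ C)"
  proof (rule antisym)
    show "(SUP C\<in>{C. compactin (mtopology_of Z) C \<and> closedin (mtopology_of Z) C \<and> C \<subseteq> U}. emeasure HZ C) \<le> emeasure HZ U"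
      by (intro SUP_least emeasure_mono openin_HZ U) auto
    obtain W where W: "open W" "h ` U = Y \<inter> W" using image_open[OF U] by blast
    obtain D where D: "\<And>n :: nat. compact (D n)" "\<And>n. D n \<subseteq> W" "\<And>n. D n \<subseteq> interior (D (Suc n))" "\<Union> (range D) = W"
      using open_Union_compact_subsets[OF W(1)] by metis
    define E where "E n = {z \<in> mspace Z. h z \<in> D n}" for n
    have E: "compactin (mtopology_of Z) (E n)" for n unfolding E_def by (rule compactin_vimage[OF D(1)])
    have U_eq: "U = (\<Union>n. E n)"
    proof -
      have UZ: "U \<subseteq> mspace Z" using U by (auto simp: openin_Z)
      have "z \<in> U \<longleftrightarrow> h z \<in> W" if "z \<in> mspace Z" for z
      proof -
        have "z \<in> U \<longleftrightarrow> h z \<in> h ` U" using inj_on_image_mem_iff[OF inj_h that UZ] by simp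
        then show ?thesis using W(2) that by auto
      qed
      then show ?thesis using UZ D(4) by (auto simp: E_def)
    qed
    have inc: "incseq E"
      unfolding incseq_Suc_iff E_def using D(3) interior_subset by blast
    have "(SUP n. emeasure HZ (E n)) = emeasure HZ (\<Union>n. E n)"
      using closed_HZ[OF compactin_closedin_Z[OF E]] by (intro SUP_emeasure_incseq inc) auto
    then have "emeasure HZ U = (SUP n. emeasure HZ (E n))" by (simp add: U_eq)
    also have "\<dots> \<le> (SUP C\<in>{C. compactin (mtopology_of Z) C \<and> closedin (mtopology_of Z) C \<and> C \<subseteq> U}. emeasure HZ C)"
      using E compactin_closedin_Z U_eq by (intro SUP_mono) blast
    finally show "emeasure HZ U \<le> (SUP C\<in>{C. compactin (mtopology_of Z) C \<and> closedin (mtopology_of Z) C \<and> C \<subseteq> U}. emeasure HZ C)" .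
  qed
qed

end

section \<open>Ahlfors regularity of a tangent\<close>

lemma (in carpet) ahlfors_regular_weak_tangent:
  fixes h :: "'z \<Rightarrow> real ^ 'n"
  assumes sc: "similar_copy c dimK Z h"
    and upper: "\<And>a r. 0 < r \<Longrightarrow> emeasure H (h ` mspace Z \<inter> {y. mdist sup_metric a y < r}) \<le> ennreal (near_const * massK * r powr dimK)"
    and lower: "\<And>a r. a \<in> h ` mspace Z \<Longrightarrow> 0 < r \<Longrightarrow> \<exists>x\<in>h ` mspace Z. \<exists>y\<in>h ` mspace Z. r < mdist sup_metric x y \<Longrightarrow>
      ennreal (massK / real (card S) * r powr dimK) \<le> emeasure H (h ` mspace Z \<inter> {y. mdist sup_metric a y < r})"
  shows "ahlfors_regular dimK Z"
proof -
  interpret similar_copy c dimK Z h by (rule sc)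
  define A where "A = near_const * massK"
  define a where "a = massK / real (card S)"
  have A: "0 < A" using near_const_pos massK_pos by (simp add: A_def)
  have a: "0 < a" using card_S massK_pos by (simp add: a_def)
  have radon: "radon_measure (mtopology_of Z) HZ"
  proof (rule radon_measure_HZ)
    fix r
    have "emeasure H (h ` mspace Z \<inter> {y. mdist sup_metric 0 y < r}) \<le> emeasure H (h ` mspace Z \<inter> {y. mdist sup_metric 0 y < \<bar>r\<bar> + 1})"
      using borel_closed[OF Y_closed] borel_open[OF open_sup_ball, of 0 "\<bar>r\<bar> + 1"] by (intro emeasure_mono) auto
    also have "\<dots> \<le> ennreal (near_const * massK * (\<bar>r\<bar> + 1) powr dimK)" by (intro upper) simp
    also have "\<dots> < \<infinity>" by simp
    finally show "emeasure H (h ` mspace Z \<inter> {y. mdist sup_metric 0 y < r}) < \<infinity>" .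
  qed
  \<comment> \<open>Greater than \<open>A\<close>, \<open>1 / a\<close> and \<open>1\<close>, so it
    serves both inequalities.\<close>
  define C where "C = A + 1 / a + 1"
  have C: "1 < C" using A a by (simp add: C_def add_pos_pos)
  have "ennreal (r powr dimK / C) \<le> emeasure HZ (mball_of Z z r) \<and> emeasure HZ (mball_of Z z r) \<le> ennreal (C * r powr dimK)"
    if z: "z \<in> mspace Z" and r: "0 < r" "ennreal r < ediam Z (mspace Z)" for z r
  proof -
    have em: "emeasure HZ (mball_of Z z r) = ennreal (1 / c powr dimK) * emeasure H (h ` mspace Z \<inter> {y. mdist sup_metric (h z) y < c * r})"
      by (simp only: emeasure_HZ'[OF ball_HZ] image_ball[OF z])
    have cr: "0 < c * r" using c_pos r by simp
    have crd: "(c * r) powr dimK = c powr dimK * r powr dimK" using c_pos r by (simp add: powr_mult)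
    obtain x y where xy: "x \<in> mspace Z" "y \<in> mspace Z" "ennreal r < ennreal (mdist Z x y)"
      using r(2) unfolding ediam_def less_SUP_iff by blast
    then have "r < mdist Z x y" using r(1) by (simp add: ennreal_less_iff)
    then have "c * r < mdist sup_metric (h x) (h y)" using xy c_pos by (simp add: h_dist)
    then have "ennreal (a * (c * r) powr dimK) \<le> emeasure H (h ` mspace Z \<inter> {y. mdist sup_metric (h z) y < c * r})"
      unfolding a_def using z xy cr by (intro lower) auto
    then have "ennreal (1 / c powr dimK) * ennreal (a * (c * r) powr dimK) \<le> emeasure HZ (mball_of Z z r)"
      unfolding em by (rule mult_left_mono) simp
    then have lo: "ennreal (a * r powr dimK) \<le> emeasure HZ (mball_of Z z r)"
      using c_pos a by (simp add: ennreal_mult[symmetric] crd)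
    have "emeasure HZ (mball_of Z z r) \<le> ennreal (1 / c powr dimK) * ennreal (A * (c * r) powr dimK)"
      unfolding em A_def using cr by (intro mult_left_mono upper) auto
    then have up: "emeasure HZ (mball_of Z z r) \<le> ennreal (A * r powr dimK)"
      using c_pos A by (simp add: ennreal_mult[symmetric] crd)
    have "1 / C \<le> 1 / (1 / a)" using a A by (intro divide_left_mono) (auto simp: C_def add_pos_pos)
    then have "1 / C \<le> a" by simp
    then have "r powr dimK / C \<le> a * r powr dimK"
      using mult_right_mono[of "1 / C" a "r powr dimK"] by simp
    moreover have "A * r powr dimK \<le> C * r powr dimK"
      using a by (intro mult_right_mono) (auto simp: C_def)
    ultimately show ?thesis using lo up by (meson ennreal_leI order_trans)
  qed
  then show ?thesis unfolding ahlfors_regular_def using radon C by blast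
qed

section \<open>Vanishing modulus\<close>

lemma measurable_enn_powr [measurable]:
  assumes [measurable]: "f \<in> borel_measurable M"
  shows "(\<lambda>x. enn_powr (f x) s) \<in> borel_measurable M"
  unfolding enn_powr_def by measurable

lemma enn_powr_inverse:
  assumes "0 < p"
  shows "enn_powr (enn_powr x p) (1 / p) = x" "enn_powr (enn_powr x (1 / p)) p = x"
  using assms by (cases x; simp add: enn_powr_def powr_powr)+

context carpet
begin

text \<open>The functions \<open>U n i\<close> approximate the coordinates and have gradients
  \<open>F n i\<close> of tiny energy in bounded regions. A non-constant curve changes some
  coordinate by a fixed amount, so the gradients with weight \<open>n\<close> have large integrals
  along it once \<open>n\<close> is large. The densities from index \<open>m\<close> on are merged
  into one, which is admissible for every family.\<close>

lemma vanishing_modulus_weak_tangent: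
  fixes h :: "'z \<Rightarrow> real ^ 'n"
  assumes sc: "similar_copy c dimK Z h" and J: "J \<subseteq> int_vecs"
    and Y_eq: "h ` mspace Z = (\<Union>j\<in>J. (\<lambda>x. x + j) ` K)" and p: "1 \<le> p"
  shows "vanishing_modulus p Z (hausdorff_measure dimK Z)"
proof -
  interpret similar_copy c dimK Z h by (rule sc)
  define e :: "'n \<Rightarrow> real ^ 'n" where "e i = axis i 1" for i
  define box :: "nat \<Rightarrow> (real ^ 'n) set" where "box n = {y. mdist sup_metric 0 y \<le> real n}" for n
  define Jn where "Jn n = {j \<in> J. mdist sup_metric 0 j \<le> real n + 1}" for n :: nat
  have Jn_fin: "finite (Jn n)" for n
    by (rule finite_subset[OF _ bounded_int_vecs_finite[of 0 "real n + 1"]]) (use J in \<open>auto simp: Jn_def\<close>)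
  have Jn_int: "Jn n \<subseteq> int_vecs" for n using J by (auto simp: Jn_def)
  define D where "D = real CARD('n)"
  have D: "1 \<le> D" using finite_UNIV_card_ge_0[where 'a = 'n] by (simp add: D_def Suc_le_eq)
  \<comment> \<open>The factor between the energy on one copy of \<open>K\<close> and that of the
    weighted density on the box: the scaling of the measure by \<open>h\<close>, the
    \<open>p\<close>-th power of the weight, and the number of translates that may meet the
    box.\<close>
  define \<kappa> where "\<kappa> n = (1 / c powr dimK) * (real n powr p * real (card (Jn n)))" for n
  have \<kappa>: "0 \<le> \<kappa> n" for n by (simp add: \<kappa>_def)
  \<comment> \<open>Chosen after \<open>\<kappa> n\<close> so as to beat it, even after summation
    over the \<open>D\<close> coordinates.\<close>
  define \<epsilon> where "\<epsilon> n = (1/2) ^ n / (D * (1 + \<kappa> n))" for n :: nat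
  have D\<kappa>: "1 \<le> D * (1 + \<kappa> n)" for n
    using mult_mono[of 1 D 1 "1 + \<kappa> n"] D \<kappa>[of n] by simp
  have \<epsilon>: "0 < \<epsilon> n" "\<epsilon> n \<le> (1/2) ^ n" "D * (\<kappa> n * \<epsilon> n) \<le> (1/2) ^ n" for n
  proof -
    show "0 < \<epsilon> n" using D\<kappa>[of n] by (simp add: \<epsilon>_def)
    show "\<epsilon> n \<le> (1/2) ^ n"
      using D\<kappa>[of n] mult_left_mono[OF D\<kappa>[of n], of "(1/2) ^ n"] by (simp add: \<epsilon>_def pos_divide_le_eq)
    have "D * (\<kappa> n * \<epsilon> n) = (1/2) ^ n * (\<kappa> n / (1 + \<kappa> n))" using D by (simp add: \<epsilon>_def)
    also have "\<dots> \<le> (1/2) ^ n * 1" using \<kappa>[of n] by (intro mult_left_mono) auto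
    finally show "D * (\<kappa> n * \<epsilon> n) \<le> (1/2) ^ n" by simp
  qed
  define Q where "Q n i P G \<longleftrightarrow> cube_test P G \<and> (\<forall>x. \<bar>P x\<bar> \<le> \<epsilon> n) \<and>
    (\<integral>\<^sup>+x\<in>K. ennreal (norm (e i + G x) powr p) \<partial>H) \<le> ennreal (\<epsilon> n)" for n i P G
  have "\<forall>n i. \<exists>P G. Q n i P G"
    unfolding Q_def by (intro allI small_energy_powr[OF p \<epsilon>(1)])
  then obtain P G where Q: "\<And>n i. Q n i (P n i) (G n i)" by metis
  have PG: "\<And>n i. cube_test (P n i) (G n i)" and P_le: "\<And>n i x. \<bar>P n i x\<bar> \<le> \<epsilon> n"
    and G_le: "\<And>n i. (\<integral>\<^sup>+x\<in>K. ennreal (norm (e i + G n i x) powr p) \<partial>H) \<le> ennreal (\<epsilon> n)"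
    using Q unfolding Q_def by simp_all
  define U where "U n i x = e i \<bullet> x + (\<Sum>j\<in>Jn n. P n i (x - j))" for n i x
  define F where "F n i x = e i + (\<Sum>j\<in>Jn n. G n i (x - j))" for n i x
  have UF: "has_grad (U n i) (F n i)" for n i
  proof -
    have sums: "has_grad (\<lambda>x. \<Sum>j\<in>I. P n i (x - j)) (\<lambda>x. \<Sum>j\<in>I. G n i (x - j))" if "finite I" for I
      using that
    proof (induction I rule: finite_induct)
      case (insert j I)
      have "has_grad (P n i) (G n i)" using PG by (simp add: cube_test_def)
      from has_grad_affine[OF this, where c = 1 and w = "- j"]
      have "has_grad (\<lambda>x. P n i (x - j)) (\<lambda>x. G n i (x - j))" by simp
      from has_grad_add[OF this insert.IH] show ?case using insert.hyps by simp
    qed (simp add: has_grad_zero)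
    show ?thesis
      unfolding U_def[abs_def] F_def[abs_def] by (intro has_grad_add has_grad_inner sums Jn_fin)
  qed
  have U_close: "\<bar>U n i x - x $ i\<bar> \<le> \<epsilon> n" for n i x
  proof -
    have "norm (\<Sum>j\<in>Jn n. P n i (x - j)) \<le> \<epsilon> n"
    proof (rule norm_sum_one_nonzero[OF Jn_fin])
      fix j j' assume "j \<in> Jn n" "j' \<in> Jn n" "P n i (x - j) \<noteq> 0" "P n i (x - j') \<noteq> 0"
      then show "j = j'"
        using translated_tests_disjoint[of "\<lambda>_. P n i" "\<lambda>_. G n i" "Jn n" j j' x, OF PG Jn_int] by auto
    qed (use P_le \<epsilon>(1)[of n] in auto)
    then show ?thesis by (simp add: U_def e_def inner_axis')
  qed
  \<comment> \<open>The cut-off leaves finitely many translates of \<open>K\<close> to integrate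
    over; a compact piece of a curve lies in every large box.\<close>
  define \<phi> where "\<phi> n i y = ennreal (real n * norm (F n i y)) * indicator (box n) y" for n i y
  have Fc: "continuous_on UNIV (F n i)" for n i using UF by (rule has_grad_continuous)
  have box_borel: "box n \<in> sets borel" for n
  proof -
    have "box n = (\<Inter>k. {y. \<bar>0 - y $ k\<bar> \<le> real n})" by (auto simp: box_def sup_dist_le_iff)
    moreover have "closed {y :: real ^ 'n. \<bar>0 - y $ k\<bar> \<le> real n}" for k
      by (intro closed_Collect_le continuous_intros)
    ultimately show ?thesis by (simp add: closed_INT borel_closed)
  qed
  have \<phi>_m [measurable]: "\<phi> n i \<in> borel_measurable borel" for n i
  proof -
    have "(\<lambda>y. norm (F n i y)) \<in> borel_measurable borel"
      by (intro borel_measurable_continuous_onI continuous_intros Fc)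
    then show ?thesis unfolding \<phi>_def[abs_def] using box_borel by measurable
  qed
  have \<phi>_int: "(\<integral>\<^sup>+z. enn_powr (\<phi> n i (h z)) p \<partial>HZ) \<le> ennreal (\<kappa> n * \<epsilon> n)" for n i
  proof -
    define w where "w y = ennreal (real n powr p) * ennreal (norm (F n i y) powr p)" for y
    have w_m [measurable]: "w \<in> borel_measurable borel"
    proof -
      have "(\<lambda>y. norm (F n i y)) \<in> borel_measurable borel"
        by (intro borel_measurable_continuous_onI continuous_intros Fc)
      then show ?thesis unfolding w_def[abs_def] by measurable
    qed
    have tr: "(\<lambda>x. x + j) ` K \<in> sets borel" for j
      by (intro borel_compact compact_continuous_image K_compact continuous_intros)
    have \<phi>_eq: "enn_powr (\<phi> n i y) p = w y * indicator (box n) y" for y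
      using p by (auto simp: \<phi>_def w_def enn_powr_def indicator_def powr_mult ennreal_mult[symmetric])
    have pt: "enn_powr (\<phi> n i y) p * indicator (h ` mspace Z) y \<le> (\<Sum>j\<in>Jn n. w y * indicator ((\<lambda>x. x + j) ` K) y)" for y
    proof (cases "y \<in> box n \<and> y \<in> h ` mspace Z")
      case True
      then obtain j where j: "j \<in> J" "y \<in> (\<lambda>x. x + j) ` K" using Y_eq by blast
      have "j \<in> Jn n" using translate_K_near[OF j(2), of 0 "real n"] True j(1) by (simp add: Jn_def box_def)
      have "w y = (\<Sum>j\<in>{j}. w y * indicator ((\<lambda>x. x + j) ` K) y)" using j(2) by simp
      also have "\<dots> \<le> (\<Sum>j\<in>Jn n. w y * indicator ((\<lambda>x. x + j) ` K) y)"
        using Jn_fin \<open>j \<in> Jn n\<close> by (intro sum_mono2) auto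
      finally show ?thesis using True by (simp add: \<phi>_eq)
    next
      case False
      then show ?thesis by (auto simp: \<phi>_eq)
    qed
    have cell_int: "(\<integral>\<^sup>+y. w y * indicator ((\<lambda>x. x + j) ` K) y \<partial>H) \<le> ennreal (real n powr p) * ennreal (\<epsilon> n)"
      if j: "j \<in> Jn n" for j
    proof -
      have sh: "affine_scale 1 j = (\<lambda>x. x + j)" by (simp add: affine_scale_def fun_eq_iff)
      have "(\<integral>\<^sup>+y. w y * indicator ((\<lambda>x. x + j) ` K) y \<partial>H)
        = (\<integral>\<^sup>+x. w (x + j) * indicator ((\<lambda>x. x + j) ` K) (x + j) \<partial>H)"
        using nn_integral_hausdorff_affine_scale[of 1 dimK "\<lambda>y. w y * indicator ((\<lambda>x. x + j) ` K) y" j] dimK_pos tr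
        by (simp add: sh)
      also have "\<dots> = (\<integral>\<^sup>+x. ennreal (real n powr p) * (ennreal (norm (e i + G n i x) powr p) * indicator K x) \<partial>H)"
      proof (rule nn_integral_cong)
        fix x
        show "w (x + j) * indicator ((\<lambda>x. x + j) ` K) (x + j) = ennreal (real n powr p) * (ennreal (norm (e i + G n i x) powr p) * indicator K x)"
        proof (cases "x \<in> K")
          case True
          \<comment> \<open>On the translate by \<open>j\<close> only the test function placed at
            \<open>j\<close> is seen.\<close>
          have "G n i (x + j - j') = 0" if "j' \<in> Jn n - {j}" for j'
          proof -
            have "x + (j - j') \<notin> open_cube"
              using that True K_sub_cube j Jn_int by (intro int_shift_not_in_open_cube) auto
            then have "x + j - j' \<notin> open_cube" by (simp add: add_diff_eq)
            then show ?thesis using PG[of n i] unfolding cube_test_def by blast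
          qed
          then have "(\<Sum>j'\<in>Jn n. G n i (x + j - j')) = G n i (x + j - j)"
            using j by (subst sum.remove[OF Jn_fin j]) simp
          then have "F n i (x + j) = e i + G n i x" by (simp add: F_def)
          then show ?thesis using True by (simp add: w_def)
        next
          case False
          then have "x + j \<notin> (\<lambda>x. x + j) ` K" by auto
          then show ?thesis using False by simp
        qed
      qed
      also have "\<dots> = ennreal (real n powr p) * (\<integral>\<^sup>+x\<in>K. ennreal (norm (e i + G n i x) powr p) \<partial>H)"
      proof (rule nn_integral_cmult)
        have "continuous_on UNIV (G n i)" using PG[of n i] by (auto simp: cube_test_def has_grad_continuous)
        then have "(\<lambda>x. norm (e i + G n i x)) \<in> borel_measurable borel"
          by (intro borel_measurable_continuous_onI continuous_intros)
        then show "(\<lambda>x. ennreal (norm (e i + G n i x) powr p) * indicator K x) \<in> borel_measurable H" by simp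
      qed
      also have "\<dots> \<le> ennreal (real n powr p) * ennreal (\<epsilon> n)" by (intro mult_left_mono G_le) simp
      finally show ?thesis .
    qed
    have "(\<integral>\<^sup>+z. enn_powr (\<phi> n i (h z)) p \<partial>HZ)
      = ennreal (1 / c powr dimK) * (\<integral>\<^sup>+y\<in>h ` mspace Z. enn_powr (\<phi> n i y) p \<partial>H)"
      by (rule nn_integral_HZ) measurable
    also have "(\<integral>\<^sup>+y\<in>h ` mspace Z. enn_powr (\<phi> n i y) p \<partial>H) \<le> (\<integral>\<^sup>+y. (\<Sum>j\<in>Jn n. w y * indicator ((\<lambda>x. x + j) ` K) y) \<partial>H)"
      by (intro nn_integral_mono pt)
    also have "\<dots> = (\<Sum>j\<in>Jn n. \<integral>\<^sup>+y. w y * indicator ((\<lambda>x. x + j) ` K) y \<partial>H)"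
      using tr by (intro nn_integral_sum) simp
    also have "\<dots> \<le> (\<Sum>j\<in>Jn n. ennreal (real n powr p) * ennreal (\<epsilon> n))"
      by (intro sum_mono cell_int)
    also have "\<dots> = ennreal (real (card (Jn n)) * (real n powr p * \<epsilon> n))"
      using \<epsilon>(1)[of n] by (simp add: ennreal_mult ennreal_of_nat_eq_real_of_nat)
    also have "ennreal (1 / c powr dimK) * ennreal (real (card (Jn n)) * (real n powr p * \<epsilon> n)) = ennreal (\<kappa> n * \<epsilon> n)"
      using \<epsilon>(1)[of n] by (simp add: \<kappa>_def ennreal_mult[symmetric] mult_ac)
    finally show ?thesis by (simp add: mult_left_mono)
  qed
  \<comment> \<open>The \<open>p\<close>-th root of a sum of \<open>p\<close>-th powers dominates
    each density, while its energy is exactly the sum of their energies.\<close>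
  define \<rho> where "\<rho> m z = enn_powr (\<Sum>n. \<Sum>i\<in>UNIV. enn_powr (\<phi> (n + m) i (h z)) p) (1 / p)" for m z
  have \<rho>_ge: "\<phi> n i (h z) \<le> \<rho> m z" if "m \<le> n" for m n i z
  proof -
    have "enn_powr (\<phi> n i (h z)) p \<le> (\<Sum>i\<in>UNIV. enn_powr (\<phi> (n - m + m) i (h z)) p)"
      using that by (simp add: sum.remove[of _ i])
    also have "\<dots> \<le> (\<Sum>n. \<Sum>i\<in>UNIV. enn_powr (\<phi> (n + m) i (h z)) p)"
      using sum_le_suminf[of "\<lambda>n. \<Sum>i\<in>UNIV. enn_powr (\<phi> (n + m) i (h z)) p" "{n - m}"] by simp
    finally have "enn_powr (enn_powr (\<phi> n i (h z)) p) (1 / p) \<le> \<rho> m z"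
      unfolding \<rho>_def using p by (intro enn_powr_mono) auto
    then show ?thesis using p by (simp add: enn_powr_inverse)
  qed
  have \<rho>_int: "(\<integral>\<^sup>+z. enn_powr (\<rho> m z) p \<partial>HZ) \<le> ennreal (2 * (1/2) ^ m)" for m
  proof -
    note mh = measurable_h
    have mphi: "(\<lambda>z. enn_powr (\<phi> n i (h z)) p) \<in> borel_measurable HZ" for n i
      using mh by measurable
    have "(\<integral>\<^sup>+z. enn_powr (\<rho> m z) p \<partial>HZ) = (\<integral>\<^sup>+z. (\<Sum>n. \<Sum>i\<in>UNIV. enn_powr (\<phi> (n + m) i (h z)) p) \<partial>HZ)"
      using p by (simp add: \<rho>_def enn_powr_inverse)
    also have "\<dots> = (\<Sum>n. \<integral>\<^sup>+z. (\<Sum>i\<in>UNIV. enn_powr (\<phi> (n + m) i (h z)) p) \<partial>HZ)"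
      using mphi by (intro nn_integral_suminf borel_measurable_sum)
    also have "\<dots> \<le> (\<Sum>n. ennreal ((1/2) ^ m * (1/2) ^ n))"
    proof (rule suminf_le)
      fix n
      have "(\<integral>\<^sup>+z. (\<Sum>i\<in>UNIV. enn_powr (\<phi> (n + m) i (h z)) p) \<partial>HZ) = (\<Sum>i\<in>UNIV. \<integral>\<^sup>+z. enn_powr (\<phi> (n + m) i (h z)) p \<partial>HZ)"
        using mphi by (intro nn_integral_sum)
      also have "\<dots> \<le> (\<Sum>i\<in>(UNIV :: 'n set). ennreal (\<kappa> (n + m) * \<epsilon> (n + m)))"
        by (intro sum_mono \<phi>_int)
      also have "\<dots> = ennreal (D * (\<kappa> (n + m) * \<epsilon> (n + m)))"
        using \<kappa>[of "n + m"] \<epsilon>(1)[of "n + m"] by (simp add: D_def ennreal_mult ennreal_of_nat_eq_real_of_nat)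
      also have "\<dots> \<le> ennreal ((1/2) ^ m * (1/2) ^ n)"
        using \<epsilon>(3)[of "n + m"] by (intro ennreal_leI) (simp add: power_add mult.commute)
      finally show "(\<integral>\<^sup>+z. (\<Sum>i\<in>UNIV. enn_powr (\<phi> (n + m) i (h z)) p) \<partial>HZ) \<le> ennreal ((1/2) ^ m * (1/2) ^ n)" .
    qed auto
    also have "\<dots> = ennreal ((1/2) ^ m * 2)"
      using geometric_sums[of "1/2 :: real"] by (intro suminf_ennreal_eq sums_mult) auto
    finally show ?thesis by (simp add: mult.commute)
  qed
  have adm: "admissible Z \<Gamma> (\<rho> m)" if \<Gamma>: "\<Gamma> \<subseteq> curves Z" for \<Gamma> m
    unfolding admissible_def
  proof (intro conjI ballI impI)
    have "h \<in> borel_measurable (borel_of (mtopology_of Z))"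
      using measurable_h measurable_cong_sets[OF sets_HZ_borel_of refl] by blast
    then show "\<rho> m \<in> borel_measurable (borel_of (mtopology_of Z))"
      unfolding \<rho>_def[abs_def] by measurable
    fix q assume q: "q \<in> \<Gamma>" "locally_rectifiable Z q"
    obtain I \<gamma> where q_eq: "q = (I, \<gamma>)" by (cases q)
    have cur: "(I, \<gamma>) \<in> curves Z" using q(1) \<Gamma> q_eq by blast
    then have int: "is_interval I" and cont: "continuous_map (top_of_set I) (mtopology_of Z) \<gamma>"
      and "\<exists>a\<in>I. \<exists>b\<in>I. \<gamma> a \<noteq> \<gamma> b" by (auto simp: curves_def)
    then obtain a' b' where ab': "a' \<in> I" "b' \<in> I" "\<gamma> a' \<noteq> \<gamma> b'" by blast
    define a b where "a = min a' b'" and "b = max a' b'"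
    have ab: "a \<in> I" "b \<in> I" "a < b" "\<gamma> a \<noteq> \<gamma> b"
      using ab' unfolding a_def b_def by (cases "a' < b'"; cases "a' = b'"; force simp: min_def max_def)+
    have sub: "{a..b} \<subseteq> I"
      using int[unfolded is_interval_1, rule_format, OF ab(1,2)] by auto
    have \<gamma>Z: "\<gamma> t \<in> mspace Z" if "t \<in> I" for t
      using continuous_map_image_subset_topspace[OF cont] that by auto
    have "h (\<gamma> a) \<noteq> h (\<gamma> b)" using inj_on_contraD[OF inj_h ab(4)] \<gamma>Z ab by blast
    then obtain i where i: "h (\<gamma> a) $ i \<noteq> h (\<gamma> b) $ i" by (auto simp: vec_eq_iff)
    define \<Delta> where "\<Delta> = \<bar>h (\<gamma> b) $ i - h (\<gamma> a) $ i\<bar>"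
    have \<Delta>: "0 < \<Delta>" using i by (simp add: \<Delta>_def)
    have "continuous_map (top_of_set {a..b}) euclidean (h \<circ> \<gamma>)"
      using continuous_map_from_subtopology_mono[OF cont sub] continuous_h by (rule continuous_map_compose)
    then have "compact ((h \<circ> \<gamma>) ` {a..b})" by (intro compact_continuous_image) auto
    then have "bounded ((h \<circ> \<gamma>) ` {a..b})" by (rule compact_imp_bounded)
    then obtain R where R: "\<And>t. t \<in> {a..b} \<Longrightarrow> norm (h (\<gamma> t)) \<le> R"
      unfolding bounded_iff by (simp del: atLeastAtMost_iff) blast
    obtain n1 :: nat where n1: "R \<le> real n1" using real_arch_simple by blast
    obtain n2 where n2: "(1/2) ^ n2 < \<Delta> / 4" using real_arch_pow_inv[of "\<Delta> / 4" "1/2"] \<Delta> by auto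
    obtain n3 :: nat where n3: "D * c / (\<Delta> / 2) \<le> real n3" using real_arch_simple by blast
    \<comment> \<open>Large enough to come after \<open>m\<close>, to have the curve segment in its
      box, to approximate within \<open>\<Delta> / 4\<close>, and to let the weight times
      \<open>\<Delta> / 2\<close> reach the Lipschitz constant \<open>D * c\<close>.\<close>
    define n where "n = max m (max n1 (max n2 n3))"
    have "(1/2 :: real) ^ n \<le> (1/2) ^ n2" by (rule power_decreasing) (auto simp: n_def)
    then have eps: "\<epsilon> n < \<Delta> / 4" using \<epsilon>(2)[of n] n2 by linarith
    have in_box: "h (\<gamma> t) \<in> box n" if "t \<in> {a..b}" for t
    proof -
      have "mdist sup_metric 0 (h (\<gamma> t)) \<le> R"
        using R[OF that] sup_dist_le_dist[of 0 "h (\<gamma> t)"] by simp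
      also have "R \<le> real n" using n1 by (simp add: n_def)
      finally show ?thesis by (simp add: box_def)
    qed
    have upper: "ennreal (real n * \<bar>U n i (h (\<gamma> b)) - U n i (h (\<gamma> a))\<bar>) \<le> ennreal (real CARD('n) * c) * line_integral Z (\<rho> m) (I, \<gamma>)"
    proof (rule line_integral_ge[OF sim UF cur])
      fix t assume t: "t \<in> {a..b}"
      have "ennreal (real n * norm (F n i (h (\<gamma> t)))) = \<phi> n i (h (\<gamma> t))"
        using in_box[OF t] by (simp add: \<phi>_def)
      also have "\<dots> \<le> \<rho> m (\<gamma> t)" by (rule \<rho>_ge) (simp add: n_def)
      finally show "ennreal (real n * norm (F n i (h (\<gamma> t)))) \<le> \<rho> m (\<gamma> t)" .
    qed (use q q_eq ab sub in auto)
    have lower: "ennreal (D * c) \<le> ennreal (real n * \<bar>U n i (h (\<gamma> b)) - U n i (h (\<gamma> a))\<bar>)"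
    proof (rule ennreal_leI)
      have "\<Delta> / 2 \<le> \<bar>U n i (h (\<gamma> b)) - U n i (h (\<gamma> a))\<bar>"
      proof -
        have "\<bar>s - t\<bar> \<le> \<bar>u - v\<bar> + \<bar>u - s\<bar> + \<bar>v - t\<bar>" for s t u v :: real by linarith
        from this[of "h (\<gamma> b) $ i" "h (\<gamma> a) $ i" "U n i (h (\<gamma> b))" "U n i (h (\<gamma> a))"]
        show ?thesis
          using U_close[of n i "h (\<gamma> b)"] U_close[of n i "h (\<gamma> a)"] eps unfolding \<Delta>_def[symmetric] by linarith
      qed
      then have "real n * (\<Delta> / 2) \<le> real n * \<bar>U n i (h (\<gamma> b)) - U n i (h (\<gamma> a))\<bar>"
        by (rule mult_left_mono) simp
      moreover have "D * c \<le> real n * (\<Delta> / 2)"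
      proof -
        have "D * c / (\<Delta> / 2) \<le> real n" using n3 by (rule order_trans) (simp add: n_def)
        then show ?thesis using \<Delta> by (simp add: pos_divide_le_eq)
      qed
      ultimately show "D * c \<le> real n * \<bar>U n i (h (\<gamma> b)) - U n i (h (\<gamma> a))\<bar>" by linarith
    qed
    have "ennreal (D * c) * 1 \<le> ennreal (D * c) * line_integral Z (\<rho> m) (I, \<gamma>)"
      using order_trans[OF lower upper[folded D_def]] by simp
    moreover have "0 < D * c" using D c_pos by simp
    ultimately show "1 \<le> line_integral Z (\<rho> m) q"
      unfolding q_eq by (subst (asm) ennreal_mult_le_mult_iff) auto
  qed
  show ?thesis
    unfolding vanishing_modulus_def
  proof (intro allI impI)
    fix \<Gamma> assume \<Gamma>: "\<Gamma> \<subseteq> curves Z"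
    have "modulus p Z HZ \<Gamma> \<le> 0"
    proof (rule ennreal_le_epsilon)
      fix \<delta> :: real assume \<delta>: "0 < \<delta>"
      obtain m where m: "(1/2) ^ m < \<delta> / 2" using real_arch_pow_inv[of "\<delta> / 2" "1/2"] \<delta> by auto
      have "modulus p Z HZ \<Gamma> \<le> (\<integral>\<^sup>+z. enn_powr (\<rho> m z) p \<partial>HZ)"
        unfolding modulus_def using adm[OF \<Gamma>] by (intro INF_lower) simp
      also have "\<dots> \<le> ennreal (2 * (1/2) ^ m)" by (rule \<rho>_int)
      also have "\<dots> \<le> ennreal \<delta>" using m by (intro ennreal_leI) simp
      finally show "modulus p Z HZ \<Gamma> \<le> 0 + ennreal \<delta>" by simp
    qed
    then show "modulus p Z HZ \<Gamma> = 0" by simp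
  qed
qed

end

theorem lemma3p9:
  fixes l :: nat and S :: "(nat ^ 'n) set" and K :: "(real ^ 'n) set"
    and d\<^sub>f :: real and Z :: "'z metric"
  assumes "generalized_sierpinski_carpet l S K"
    and "hausdorff_dim (submetric sup_metric K) = ereal d\<^sub>f"
    and "weak_tangent TYPE('m) (submetric sup_metric K) Z"
  shows "ahlfors_regular d\<^sub>f Z \<and>
    (\<forall>p\<ge>1. vanishing_modulus p Z (hausdorff_measure d\<^sub>f Z))"
proof -
  interpret carpet l S K by unfold_locales (rule assms(1))
  \<comment> \<open>At the exponent \<open>dimK\<close> the carpet has positive finite measure,
    which determines its dimension.\<close>
  have d: "d\<^sub>f = dimK" using assms(2) hausdorff_dim_K by simp
  obtain c h J where sim: "similarity c Z sup_metric h" and J: "J \<subseteq> int_vecs"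
    and Y: "h ` mspace Z = (\<Union>j\<in>J. (\<lambda>x. x + j) ` K)" and closed: "closed (h ` mspace Z)"
    and upper: "\<And>a r. 0 < r \<Longrightarrow> emeasure H (h ` mspace Z \<inter> {y. mdist sup_metric a y < r}) \<le> ennreal (near_const * massK * r powr dimK)"
    and lower: "\<And>a r. a \<in> h ` mspace Z \<Longrightarrow> 0 < r \<Longrightarrow> \<exists>x\<in>h ` mspace Z. \<exists>y\<in>h ` mspace Z. r < mdist sup_metric x y \<Longrightarrow>
      ennreal (massK / real (card S) * r powr dimK) \<le> emeasure H (h ` mspace Z \<inter> {y. mdist sup_metric a y < r})"
    using weak_tangent_structure[OF assms(3)] by metis
  have sc: "similar_copy c dimK Z h"
    by unfold_locales (use sim closed dimK_pos in auto)
  show ?thesis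
    unfolding d
    using ahlfors_regular_weak_tangent[OF sc upper lower] vanishing_modulus_weak_tangent[OF sc J Y] by blast
qed

end
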